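(* Let $\mathcal{H}$ be a finite-dimensional Hilbert space (the system) and $U$ a unitary on $\mathcal{H}$. Let $\Lambda$ be a finite set with a probability distribution $p$ on it, and for each $\lambda\in\Lambda$ let $W^{\mathrm{in}}_a(\lambda)$ be a unitary acting on $\mathcal{H}\otimes\mathbb{C}^2$, where $\mathbb{C}^2$ is the space of a qubit $a$; define $W^{\mathrm{out}}_a(\lambda)=(U\otimes I_a)W^{\mathrm{in}}_a(\lambda)(U^\dagger\otimes I_a)$. Let $|\phi^{\mathrm{in}}\rangle\in\mathcal{H}$ be a unit vector and $|\phi^{\mathrm{out}}\rangle=U|\phi^{\mathrm{in}}\rangle$. Fix an integer $T\ge 1$ and consider the following procedure applied to a system in state $\rho$: (i) choose $\lambda_1,\dots,\lambda_T\in\Lambda$ independently according to $p$; prepare qubits $a_1,\dots,a_T$ each in $|-\rangle=(|0\rangle-|1\rangle)/\sqrt2$ and apply successively $W^{\mathrm{in}}_{a_1}(\lambda_1)$ (to system and $a_1$), then $W^{\mathrm{in}}_{a_2}(\lambda_2)$, ..., then $W^{\mathrm{in}}_{a_T}(\lambda_T)$; (ii) prepare a qubit $c$ in $|-\rangle$, apply the controlled reflection $R_c=|0\rangle\langle0|_c\otimes I+|1\rangle\langle1|_c\otimes e^{i\pi|\phi^{\mathrm{in}}\rangle\langle\phi^{\mathrm{in}}|}$ to $c$ and the system, then a Hadamard gate on $c$, and measure $c$ in the computational basis; (iii) discard the system state and replace it by $|\phi^{\mathrm{out}}\rangle$; (iv) apply successively $W^{\mathrm{out}}_{a_T}(\lambda_T)^\dagger$,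 then $W^{\mathrm{out}}_{a_{T-1}}(\lambda_{T-1})^\dagger$, ..., then $W^{\mathrm{out}}_{a_1}(\lambda_1)^\dagger$ (each to the system and the indicated qubit). Define the channel $\mathcal{W}(\tau)=\sum_{\lambda\in\Lambda}p(\lambda)\,\mathrm{Tr}_a\big(W^{\mathrm{in}}_a(\lambda)[\tau\otimes|-\rangle\langle-|_a]W^{\mathrm{in}}_a(\lambda)^\dagger\big)$ and $p_{\mathrm{erase}}(\rho)=\langle\phi^{\mathrm{in}}|\mathcal{W}^T(\rho)|\phi^{\mathrm{in}}\rangle$. Then $p_{\mathrm{erase}}(\rho)$ is the probability of outcome $0$ in step (ii), and, letting $\mathcal{E}_U$ denote the channel describing the overall action of the procedure on the system when the outcome of step (ii) is ignored (averaged over the random $\lambda_i$ and with all ancillas traced out), for every state $\rho$ on $\mathcal{H}$: $$F(\mathcal{E}_U(\rho),U\rho U^\dagger)\ge p_{\mathrm{erase}}(\rho).$$ Moreover, if $\rho$ is pure and $\tilde\rho_{\mathrm{post}}$ denotes the final system state conditioned on outcome $0$ in step (ii), then $F(\tilde\rho_{\mathrm{post}},U\rho U^\dagger)\ge\sqrt{p_{\mathrm{erase}}(\rho)}$.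
   Context: $F(\sigma_1,\sigma_2)=\|\sqrt{\sigma_1}\sqrt{\sigma_2}\|_1=\mathrm{Tr}\sqrt{\sqrt{\sigma_1}\sigma_2\sqrt{\sigma_1}}$ is the Uhlmann fidelity. The Hadamard gate maps $|0\rangle\mapsto|+\rangle$, $|1\rangle\mapsto|-\rangle$ with $|\pm\rangle=(|0\rangle\pm|1\rangle)/\sqrt2$. $e^{i\pi|\phi\rangle\langle\phi|}=I-2|\phi\rangle\langle\phi|$ is the reflection about $|\phi\rangle$. *)

theory Defs
  imports "Jordan_Normal_Form.Schur_Decomposition"
begin

text \<open>All operators are complex matrices (Jordan_Normal_Form).  The system Hilbert space is
  \<open>\<complex>^n\<close>.  Tensor products use the Kronecker convention: in \<open>kron A B\<close> the
  basis index of \<open>x \<otimes> y\<close> is \<open>x * dim B + y\<close>.\<close>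

definition kron :: "complex mat \<Rightarrow> complex mat \<Rightarrow> complex mat" where
  "kron A B = mat (dim_row A * dim_row B) (dim_col A * dim_col B)
     (\<lambda>(r, s). A $$ (r div dim_row B, s div dim_col B) * B $$ (r mod dim_row B, s mod dim_col B))"

fun kron_pow :: "nat \<Rightarrow> complex mat \<Rightarrow> complex mat" where
  "kron_pow 0 M = 1\<^sub>m 1"
| "kron_pow (Suc k) M = kron M (kron_pow k M)"

definition ptrace_left :: "nat \<Rightarrow> nat \<Rightarrow> complex mat \<Rightarrow> complex mat" where
  "ptrace_left dA dB M = mat dB dB (\<lambda>(x, y). \<Sum>i<dA. M $$ (i * dB + x, i * dB + y))"

definition ptrace_right :: "nat \<Rightarrow> nat \<Rightarrow> complex mat \<Rightarrow> complex mat" where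
  "ptrace_right dA dB M = mat dA dA (\<lambda>(i, j). \<Sum>x<dB. M $$ (i * dB + x, j * dB + x))"

definition msum :: "nat \<Rightarrow> 'b set \<Rightarrow> ('b \<Rightarrow> complex mat) \<Rightarrow> complex mat" where
  "msum n A f = mat n n (\<lambda>(i, j). \<Sum>x\<in>A. f x $$ (i, j))"

definition mtrace :: "complex mat \<Rightarrow> complex" where
  "mtrace A = (\<Sum>i<dim_row A. A $$ (i, i))"

definition outer :: "complex vec \<Rightarrow> complex mat" where
  "outer v = mat (dim_vec v) (dim_vec v) (\<lambda>(i, j). v $ i * cnj (v $ j))"

definition unitary_mat :: "nat \<Rightarrow> complex mat \<Rightarrow> bool" where
  "unitary_mat n U \<longleftrightarrow> U \<in> carrier_mat n n \<and> U * mat_adjoint U = 1\<^sub>m n \<and> mat_adjoint U * U = 1\<^sub>m n"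

definition is_unit_vec :: "nat \<Rightarrow> complex vec \<Rightarrow> bool" where
  "is_unit_vec n v \<longleftrightarrow> v \<in> carrier_vec n \<and> v \<bullet>c v = 1"

definition psd :: "nat \<Rightarrow> complex mat \<Rightarrow> bool" where
  "psd n A \<longleftrightarrow> A \<in> carrier_mat n n \<and> mat_adjoint A = A \<and>
     (\<forall>v \<in> carrier_vec n. (A *\<^sub>v v) \<bullet>c v \<in> \<real> \<and> 0 \<le> Re ((A *\<^sub>v v) \<bullet>c v))"

definition density :: "nat \<Rightarrow> complex mat \<Rightarrow> bool" where
  "density n \<rho> \<longleftrightarrow> psd n \<rho> \<and> mtrace \<rho> = 1"

definition pure_state :: "nat \<Rightarrow> complex mat \<Rightarrow> bool" where
  "pure_state n \<rho> \<longleftrightarrow> (\<exists>\<psi>. is_unit_vec n \<psi> \<and> \<rho> = outer \<psi>)"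

definition msqrt :: "complex mat \<Rightarrow> complex mat" where
  "msqrt A = (THE B. psd (dim_row A) B \<and> B * B = A)"

definition fidelity :: "complex mat \<Rightarrow> complex mat \<Rightarrow> real" where
  "fidelity s1 s2 = Re (mtrace (msqrt (msqrt s1 * s2 * msqrt s1)))"

definition ket_minus :: "complex vec" where
  "ket_minus = vec 2 (\<lambda>i. if i = 0 then 1 / complex_of_real (sqrt 2) else - 1 / complex_of_real (sqrt 2))"

definition proj0 :: "complex mat" where
  "proj0 = mat 2 2 (\<lambda>(i, j). if i = 0 \<and> j = 0 then 1 else 0)"

definition proj1 :: "complex mat" where
  "proj1 = mat 2 2 (\<lambda>(i, j). if i = 1 \<and> j = 1 then 1 else 0)"

definition hadamard :: "complex mat" where
  "hadamard = mat 2 2 (\<lambda>(i, j). if i = 1 \<and> j = 1 then - 1 / complex_of_real (sqrt 2)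
                                 else 1 / complex_of_real (sqrt 2))"

text \<open>Reflection about a unit vector: \<open>exp(i \<pi> |\<phi>\<rangle>\<langle>\<phi>|) = I - 2|\<phi>\<rangle>\<langle>\<phi>|\<close>.\<close>
definition reflection :: "nat \<Rightarrow> complex vec \<Rightarrow> complex mat" where
  "reflection n \<phi> = 1\<^sub>m n - 2 \<cdot>\<^sub>m outer \<phi>"

text \<open>Global space: \<open>\<complex>^n \<otimes> (\<complex>^2)^{\<otimes> N}\<close>; global index \<open>i * 2^N + b\<close>, with
  qubit number \<open>q < N\<close> stored in bit \<open>q\<close> of \<open>b\<close>.  \<open>emb n N q W\<close> lets an operator \<open>W\<close>
  on \<open>\<complex>^n \<otimes> \<complex>^2\<close> (index \<open>i*2+x\<close>) act on the system and qubit \<open>q\<close>, identity elsewhere.\<close>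
definition qbit :: "nat \<Rightarrow> nat \<Rightarrow> nat" where
  "qbit q b = b div 2 ^ q mod 2"

definition emb :: "nat \<Rightarrow> nat \<Rightarrow> nat \<Rightarrow> complex mat \<Rightarrow> complex mat" where
  "emb n N q W = mat (n * 2 ^ N) (n * 2 ^ N) (\<lambda>(r, s).
     let i = r div 2 ^ N; b = r mod 2 ^ N; j = s div 2 ^ N; b' = s mod 2 ^ N in
     if b - qbit q b * 2 ^ q = b' - qbit q b' * 2 ^ q
     then W $$ (i * 2 + qbit q b, j * 2 + qbit q b') else 0)"

definition conj_by :: "complex mat \<Rightarrow> complex mat \<Rightarrow> complex mat" where
  "conj_by V \<sigma> = V * \<sigma> * mat_adjoint V"

text \<open>Qubits \<open>a_1..a_T\<close> are positions \<open>0..T-1\<close>, the control qubit \<open>c\<close> is position \<open>T\<close>;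
  so \<open>N = T + 1\<close>.  The random labels are a list \<open>ls\<close> with \<open>ls ! k = \<lambda>_{k+1}\<close>.\<close>

definition W_out :: "nat \<Rightarrow> complex mat \<Rightarrow> ('l \<Rightarrow> complex mat) \<Rightarrow> 'l \<Rightarrow> complex mat" where
  "W_out n U Win l = kron U (1\<^sub>m 2) * Win l * kron (mat_adjoint U) (1\<^sub>m 2)"

definition state_ii :: "nat \<Rightarrow> nat \<Rightarrow> ('l \<Rightarrow> complex mat) \<Rightarrow> complex vec \<Rightarrow> 'l list \<Rightarrow> complex mat \<Rightarrow> complex mat" where
  "state_ii n T Win \<phi>in ls \<rho> =
     (let N = T + 1;
          \<sigma>0 = kron \<rho> (kron_pow N (outer ket_minus));
          \<sigma>1 = foldl (\<lambda>\<sigma> k. conj_by (emb n N k (Win (ls ! k))) \<sigma>) \<sigma>0 [0..<T];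
          Rc = kron (1\<^sub>m n) proj0 + kron (reflection n \<phi>in) proj1
      in conj_by (emb n N T (kron (1\<^sub>m n) hadamard)) (conj_by (emb n N T Rc) \<sigma>1))"

definition meas_proj :: "nat \<Rightarrow> nat \<Rightarrow> complex mat \<Rightarrow> complex mat" where
  "meas_proj n T P = emb n (T + 1) T (kron (1\<^sub>m n) P)"

definition steps_iii_iv :: "nat \<Rightarrow> nat \<Rightarrow> complex mat \<Rightarrow> ('l \<Rightarrow> complex mat) \<Rightarrow> complex vec \<Rightarrow> 'l list \<Rightarrow> complex mat \<Rightarrow> complex mat" where
  "steps_iii_iv n T U Win \<phi>in ls \<sigma> =
     (let N = T + 1;
          \<sigma>4 = kron (outer (U *\<^sub>v \<phi>in)) (ptrace_left n (2 ^ N) \<sigma>);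
          \<sigma>5 = foldl (\<lambda>\<tau> k. conj_by (emb n N k (mat_adjoint (W_out n U Win (ls ! k)))) \<tau>) \<sigma>4 (rev [0..<T])
      in ptrace_right n (2 ^ N) \<sigma>5)"

definition label_seqs :: "'l set \<Rightarrow> nat \<Rightarrow> 'l list set" where
  "label_seqs \<Lambda> T = {ls. set ls \<subseteq> \<Lambda> \<and> length ls = T}"

definition seq_prob :: "('l \<Rightarrow> real) \<Rightarrow> 'l list \<Rightarrow> real" where
  "seq_prob p ls = (\<Prod>l\<leftarrow>ls. p l)"

definition prob_outcome0 :: "nat \<Rightarrow> nat \<Rightarrow> 'l set \<Rightarrow> ('l \<Rightarrow> real) \<Rightarrow> ('l \<Rightarrow> complex mat) \<Rightarrow> complex vec \<Rightarrow> complex mat \<Rightarrow> real" where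
  "prob_outcome0 n T \<Lambda> p Win \<phi>in \<rho> =
     (\<Sum>ls\<in>label_seqs \<Lambda> T. seq_prob p ls *
        Re (mtrace (conj_by (meas_proj n T proj0) (state_ii n T Win \<phi>in ls \<rho>))))"

definition E_U :: "nat \<Rightarrow> nat \<Rightarrow> 'l set \<Rightarrow> ('l \<Rightarrow> real) \<Rightarrow> complex mat \<Rightarrow> ('l \<Rightarrow> complex mat) \<Rightarrow> complex vec \<Rightarrow> complex mat \<Rightarrow> complex mat" where
  "E_U n T \<Lambda> p U Win \<phi>in \<rho> =
     msum n (label_seqs \<Lambda> T) (\<lambda>ls. complex_of_real (seq_prob p ls) \<cdot>\<^sub>m
        steps_iii_iv n T U Win \<phi>in ls
          (conj_by (meas_proj n T proj0) (state_ii n T Win \<phi>in ls \<rho>) +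
           conj_by (meas_proj n T proj1) (state_ii n T Win \<phi>in ls \<rho>)))"

definition post_state0 :: "nat \<Rightarrow> nat \<Rightarrow> 'l set \<Rightarrow> ('l \<Rightarrow> real) \<Rightarrow> complex mat \<Rightarrow> ('l \<Rightarrow> complex mat) \<Rightarrow> complex vec \<Rightarrow> complex mat \<Rightarrow> complex mat" where
  "post_state0 n T \<Lambda> p U Win \<phi>in \<rho> =
     complex_of_real (1 / prob_outcome0 n T \<Lambda> p Win \<phi>in \<rho>) \<cdot>\<^sub>m
     msum n (label_seqs \<Lambda> T) (\<lambda>ls. complex_of_real (seq_prob p ls) \<cdot>\<^sub>m
        steps_iii_iv n T U Win \<phi>in ls
          (conj_by (meas_proj n T proj0) (state_ii n T Win \<phi>in ls \<rho>)))"

definition chanW :: "nat \<Rightarrow> 'l set \<Rightarrow> ('l \<Rightarrow> real) \<Rightarrow> ('l \<Rightarrow> complex mat) \<Rightarrow> complex mat \<Rightarrow> complex mat" where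
  "chanW n \<Lambda> p Win \<tau> = msum n \<Lambda> (\<lambda>l. complex_of_real (p l) \<cdot>\<^sub>m
      ptrace_right n 2 (conj_by (Win l) (kron \<tau> (outer ket_minus))))"

definition p_erase :: "nat \<Rightarrow> nat \<Rightarrow> 'l set \<Rightarrow> ('l \<Rightarrow> real) \<Rightarrow> ('l \<Rightarrow> complex mat) \<Rightarrow> complex vec \<Rightarrow> complex mat \<Rightarrow> real" where
  "p_erase n T \<Lambda> p Win \<phi>in \<rho> = Re ((((chanW n \<Lambda> p Win) ^^ T) \<rho> *\<^sub>v \<phi>in) \<bullet>c \<phi>in)"

end

(* For a fixed label sequence let V be the product of the interactions, P = |phi><phi|, and w the
   register state |-...->|0> (control qubit flipped by outcome 0). Outcome 0 applies P V to rho and w,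
   and the replacement followed by the inverse interactions turns this into V^* P V, up to
   conjugation by U. Compressing the register to w shows that the unnormalised output dominates
   (U M) rho (U M)^*, where M = <w| V^* P V |w> and tr (M rho) is the probability of outcome 0. By
   the operator Jensen inequality the average output dominates the same expression with the mean
   of M. If A >= N B N^*, then N sqrt B = sqrt A W with a contraction W (Douglas), so
   tr (N B) = tr (sqrt B sqrt A W) <= F(A, B). This gives the first bound with N = U M U^*, and the
   second one after dividing N by sqrt p_erase. *)
theory Submission
  imports Defs "Jordan_Normal_Form.Spectral_Radius" "HOL-Analysis.L2_Norm"
begin

subsection \<open>Complex matrices\<close>

text \<open>The output is a mixture over labels, outcomes and discarded registers, while its partner
  in the fidelity is a single unitary image of \<rho>. M has two roles. It is an amplitude, the
  Kraus operator that leads back to \<rho>; since P is a projection, it is also the operator whose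
  expectation is the probability of outcome 0. Hence the unnormalised bound is p_erase itself, and
  normalisation turns it into p_erase / sqrt p_erase. M is computed in the Heisenberg picture: P is
  pulled back through one interaction at a time, each ancilla being still in |-> when its
  interaction starts. Independence of the labels turns the average of these pull-backs into the dual
  of the T-th power of the channel.\<close>

lemma adjoint_dim [simp]:
  "dim_row (mat_adjoint A) = dim_col A" "dim_col (mat_adjoint A) = dim_row A"
  by (simp_all add: mat_adjoint_def)

lemma adjoint_carrier [simp]: "A \<in> carrier_mat n m \<Longrightarrow> mat_adjoint A \<in> carrier_mat m n"
  by (intro carrier_matI) auto

lemma adjoint_index [simp]:
  "i < dim_col A \<Longrightarrow> j < dim_row A \<Longrightarrow> mat_adjoint A $$ (i, j) = cnj (A $$ (j, i))"
  by (simp add: mat_adjoint_def mat_of_rows_index)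

lemma adjoint_adjoint [simp]: "mat_adjoint (mat_adjoint A) = (A :: complex mat)"
  by (intro eq_matI) auto

lemma mult_index:
  "i < dim_row A \<Longrightarrow> j < dim_col B \<Longrightarrow> dim_col A = dim_row B \<Longrightarrow>
    (A * B) $$ (i, j) = (\<Sum>k<dim_row B. A $$ (i, k) * B $$ (k, j))"
  by (auto simp: scalar_prod_def lessThan_atLeast0)

lemma mult_vec_index:
  "i < dim_row A \<Longrightarrow> dim_col A = dim_vec v \<Longrightarrow>
    (A *\<^sub>v v) $ i = (\<Sum>k<dim_vec v. A $$ (i, k) * v $ k)"
  by (auto simp: scalar_prod_def lessThan_atLeast0)

lemma cscalar_sum:
  fixes v w :: "complex vec"
  shows "dim_vec v = dim_vec w \<Longrightarrow> v \<bullet>c w = (\<Sum>k<dim_vec w. v $ k * cnj (w $ k))"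
  by (auto simp: scalar_prod_def lessThan_atLeast0)

text \<open>As a simp rule this normalises products to right-nested form. Dimension equations
  replace carrier sets because the simplifier can check them without guessing intermediate
  dimensions.\<close>

lemma mult_assoc_dim [simp]:
  "dim_col A = dim_row B \<Longrightarrow> dim_col B = dim_row C \<Longrightarrow> A * B * C = A * (B * C)"
  for A B C :: "complex mat"
  by (rule assoc_mult_mat) auto

text \<open>After right-nesting, a redex \<open>A * B\<close> inside a longer product appears only
  as \<open>A * (B * C)\<close>. This transports an equation for \<open>A * B\<close> to that
  position, typically a cancellation such as V\<dagger> V = 1.\<close>

lemma mult_left_eq:
  "A * B = D \<Longrightarrow> dim_col A = dim_row B \<Longrightarrow> dim_col B = dim_row C \<Longrightarrow> A * (B * C) = D * C"
  for A B C D :: "complex mat"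
  using mult_assoc_dim[of A B C] by simp

lemma add_mult_dim:
  "dim_row A = dim_row B \<Longrightarrow> dim_col A = dim_col B \<Longrightarrow> dim_col B = dim_row C \<Longrightarrow> (A + B) * C = A * C + B * C"
  for A B C :: "complex mat"
  by (rule add_mult_distrib_mat) auto

lemma mult_add_dim:
  "dim_col A = dim_row B \<Longrightarrow> dim_row B = dim_row C \<Longrightarrow> dim_col B = dim_col C \<Longrightarrow> A * (B + C) = A * B + A * C"
  for A B C :: "complex mat"
  by (rule mult_add_distrib_mat) auto

lemma minus_mult_dim:
  "dim_row A = dim_row B \<Longrightarrow> dim_col A = dim_col B \<Longrightarrow> dim_col B = dim_row C \<Longrightarrow> (A - B) * C = A * C - B * C"
  for A B C :: "complex mat"
  by (rule minus_mult_distrib_mat) auto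

lemma mult_minus_dim:
  "dim_col A = dim_row B \<Longrightarrow> dim_row B = dim_row C \<Longrightarrow> dim_col B = dim_col C \<Longrightarrow> A * (B - C) = A * B - A * C"
  for A B C :: "complex mat"
  by (rule mult_minus_distrib_mat) auto

lemma one_mult_dim [simp]: "dim_row A = n \<Longrightarrow> 1\<^sub>m n * A = (A :: complex mat)"
  by (rule left_mult_one_mat) auto

lemma mult_one_dim [simp]: "dim_col A = n \<Longrightarrow> A * 1\<^sub>m n = (A :: complex mat)"
  by (rule right_mult_one_mat) auto

lemma adjoint_mult [simp]:
  "dim_col A = dim_row B \<Longrightarrow> mat_adjoint (A * B) = mat_adjoint B * mat_adjoint A"
  for A B :: "complex mat"
  by (intro eq_matI) (auto simp: mult_index mult.commute simp del: index_mult_mat(1))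

lemma adjoint_one [simp]: "mat_adjoint (1\<^sub>m n) = (1\<^sub>m n :: complex mat)"
  by (intro eq_matI) auto

lemma adjoint_smult [simp]: "mat_adjoint (c \<cdot>\<^sub>m A) = cnj c \<cdot>\<^sub>m mat_adjoint A"
  by (intro eq_matI) auto

lemma adjoint_add:
  "dim_row A = dim_row B \<Longrightarrow> dim_col A = dim_col B \<Longrightarrow>
    mat_adjoint (A + B) = mat_adjoint A + mat_adjoint B" for A B :: "complex mat"
  by (intro eq_matI) auto

lemma adjoint_minus:
  "dim_row A = dim_row B \<Longrightarrow> dim_col A = dim_col B \<Longrightarrow>
    mat_adjoint (A - B) = mat_adjoint A - mat_adjoint B" for A B :: "complex mat"
  by (intro eq_matI) auto

lemma mult_vec_carrier_dim [simp]: "dim_row A = n \<Longrightarrow> A *\<^sub>v v \<in> carrier_vec n"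
  by (intro carrier_vecI) simp

lemma mult_vec_assoc_dim:
  "dim_col A = dim_row B \<Longrightarrow> dim_col B = dim_vec v \<Longrightarrow> A * B *\<^sub>v v = A *\<^sub>v (B *\<^sub>v v)"
  for A B :: "complex mat"
  by (rule assoc_mult_mat_vec) auto

lemma adjoint_cscalar:
  fixes A :: "complex mat"
  assumes "A \<in> carrier_mat n m" "v \<in> carrier_vec m" "w \<in> carrier_vec n"
  shows "(A *\<^sub>v v) \<bullet>c w = v \<bullet>c (mat_adjoint A *\<^sub>v w)"
proof -
  have "(A *\<^sub>v v) \<bullet>c w = (\<Sum>i<n. \<Sum>k<m. A $$ (i, k) * v $ k * cnj (w $ i))"
    using assms by (auto simp: cscalar_sum mult_vec_index sum_distrib_right simp del: index_mult_mat_vec)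
  also have "\<dots> = (\<Sum>k<m. \<Sum>i<n. A $$ (i, k) * v $ k * cnj (w $ i))"
    by (rule sum.swap)
  also have "\<dots> = v \<bullet>c (mat_adjoint A *\<^sub>v w)"
    using assms by (auto simp: cscalar_sum mult_vec_index sum_distrib_left mult_ac simp del: index_mult_mat_vec)
  finally show ?thesis .
qed

lemma cscalar_self: "v \<bullet>c v = complex_of_real (\<Sum>k<dim_vec v. (cmod (v $ k))\<^sup>2)"
  unfolding cscalar_sum[OF refl] of_real_sum complex_norm_square ..

lemma mtrace_comm:
  assumes "dim_row A = dim_col B" "dim_col A = dim_row B"
  shows "mtrace (A * B) = mtrace (B * A)"
proof -
  have "mtrace (A * B) = (\<Sum>i<dim_row A. \<Sum>k<dim_row B. A $$ (i, k) * B $$ (k, i))"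
    using assms by (auto simp: mtrace_def mult_index simp del: index_mult_mat(1))
  also have "\<dots> = (\<Sum>k<dim_row B. \<Sum>i<dim_row A. A $$ (i, k) * B $$ (k, i))"
    by (rule sum.swap)
  also have "\<dots> = mtrace (B * A)"
    using assms by (auto simp: mtrace_def mult_index mult.commute simp del: index_mult_mat(1))
  finally show ?thesis .
qed

lemma mtrace_smult: "dim_row A = dim_col A \<Longrightarrow> mtrace (c \<cdot>\<^sub>m A) = c * mtrace A"
  by (auto simp: mtrace_def sum_distrib_left)

subsection \<open>Positive semidefinite matrices\<close>

lemma psdD:
  assumes "psd n A"
  shows "A \<in> carrier_mat n n" "mat_adjoint A = A" "dim_row A = n" "dim_col A = n"
    "v \<in> carrier_vec n \<Longrightarrow> 0 \<le> Re ((A *\<^sub>v v) \<bullet>c v)"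
  using assms by (auto simp: psd_def)

text \<open>Self-adjointness already makes the form real, so that positivity proofs through
  \<open>psdI\<close> only treat the sign of the real part.\<close>

lemma hermitian_form_real:
  fixes A :: "complex mat"
  assumes "A \<in> carrier_mat n n" "mat_adjoint A = A" "v \<in> carrier_vec n"
  shows "(A *\<^sub>v v) \<bullet>c v \<in> \<real>"
proof -
  have "cnj ((A *\<^sub>v v) \<bullet>c v) = v \<bullet>c (A *\<^sub>v v)"
    using assms by (auto simp: cscalar_sum mult.commute simp del: index_mult_mat_vec)
  also have "\<dots> = (A *\<^sub>v v) \<bullet>c v"
    using adjoint_cscalar[OF assms(1,3,3)] assms by simp
  finally show ?thesis by (simp add: Reals_cnj_iff)
qed

lemma psdI:
  assumes "A \<in> carrier_mat n n" "mat_adjoint A = A"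
    and "\<And>v. v \<in> carrier_vec n \<Longrightarrow> 0 \<le> Re ((A *\<^sub>v v) \<bullet>c v)"
  shows "psd n A"
  using assms hermitian_form_real by (auto simp: psd_def)

lemma psd_gram: "A \<in> carrier_mat n m \<Longrightarrow> psd n (A * mat_adjoint A)"
proof (rule psdI)
  assume A: "A \<in> carrier_mat n m"
  fix v :: "complex vec" assume v: "v \<in> carrier_vec n"
  have "((A * mat_adjoint A) *\<^sub>v v) \<bullet>c v = (mat_adjoint A *\<^sub>v v) \<bullet>c (mat_adjoint A *\<^sub>v v)"
    using A v by (simp add: assoc_mult_mat_vec[of _ n m _ n] adjoint_cscalar[of A n m] del: index_mult_mat_vec)
  then show "0 \<le> Re (((A * mat_adjoint A) *\<^sub>v v) \<bullet>c v)"
    by (simp add: cscalar_self sum_nonneg del: index_mult_mat_vec)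
qed auto

lemma psd_add:
  assumes "psd n A" "psd n B"
  shows "psd n (A + B)"
proof (rule psdI)
  note [simp] = psdD(1-4)[OF assms(1)] psdD(1-4)[OF assms(2)]
  show "A + B \<in> carrier_mat n n" "mat_adjoint (A + B) = A + B"
    by (auto simp: adjoint_add)
  fix v :: "complex vec" assume v: "v \<in> carrier_vec n"
  have "(A + B) *\<^sub>v v = A *\<^sub>v v + B *\<^sub>v v"
    using v by (intro add_mult_distrib_mat_vec) auto
  moreover have "(A *\<^sub>v v + B *\<^sub>v v) \<bullet>c v = (A *\<^sub>v v) \<bullet>c v + (B *\<^sub>v v) \<bullet>c v"
    using v by (intro add_scalar_prod_distrib[of _ n]) auto
  ultimately show "0 \<le> Re (((A + B) *\<^sub>v v) \<bullet>c v)"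
    using psdD(5)[OF assms(1) v] psdD(5)[OF assms(2) v] by simp
qed

lemma psd_conj:
  assumes "psd n A" "K \<in> carrier_mat m n"
  shows "psd m (conj_by K A)"
  unfolding conj_by_def
proof (rule psdI)
  note [simp] = psdD(1-4)[OF assms(1)]
  show "K * A * mat_adjoint K \<in> carrier_mat m m" "mat_adjoint (K * A * mat_adjoint K) = K * A * mat_adjoint K"
    using assms(2) by auto
  fix v :: "complex vec" assume v: "v \<in> carrier_vec m"
  have [simp]: "mat_adjoint K *\<^sub>v v \<in> carrier_vec n" using assms(2) v by auto
  have "((K * A * mat_adjoint K) *\<^sub>v v) \<bullet>c v = (K *\<^sub>v (A *\<^sub>v (mat_adjoint K *\<^sub>v v))) \<bullet>c v"
    using assms(2) v by (simp add: mult_vec_assoc_dim del: index_mult_mat_vec)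
  also have "\<dots> = (A *\<^sub>v (mat_adjoint K *\<^sub>v v)) \<bullet>c (mat_adjoint K *\<^sub>v v)"
    using assms(2) v by (subst adjoint_cscalar[of K m n]) auto
  finally show "0 \<le> Re (((K * A * mat_adjoint K) *\<^sub>v v) \<bullet>c v)"
    using psdD(5)[OF assms(1), of "mat_adjoint K *\<^sub>v v"] by simp
qed

lemma psd_smult:
  assumes "psd n A" "0 \<le> c"
  shows "psd n (complex_of_real c \<cdot>\<^sub>m A)"
proof -
  have "complex_of_real c \<cdot>\<^sub>m A = conj_by (complex_of_real (sqrt c) \<cdot>\<^sub>m 1\<^sub>m n) A"
    using psdD(1-4)[OF assms(1)] assms(2)
    by (intro eq_matI) (auto simp: conj_by_def adjoint_smult simp flip: mult.assoc of_real_mult)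
  then show ?thesis using psd_conj[OF assms(1), of "complex_of_real (sqrt c) \<cdot>\<^sub>m 1\<^sub>m n" n] by simp
qed

lemma psd_zero: "psd n (0\<^sub>m n n)"
  using psd_gram[of "0\<^sub>m n n" n n] by simp

lemma msum_carrier [simp]: "msum n S f \<in> carrier_mat n n" "dim_row (msum n S f) = n" "dim_col (msum n S f) = n"
  by (auto simp: msum_def)

lemma msum_index [simp]: "i < n \<Longrightarrow> j < n \<Longrightarrow> msum n S f $$ (i, j) = (\<Sum>x\<in>S. f x $$ (i, j))"
  by (simp add: msum_def)

lemma psd_msum:
  assumes "finite S" "\<And>x. x \<in> S \<Longrightarrow> psd n (f x)"
  shows "psd n (msum n S f)"
  using assms
proof (induction S)
  case empty
  have "msum n {} f = 0\<^sub>m n n" by (intro eq_matI) auto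
  then show ?case by (simp add: psd_zero)
next
  case (insert x S)
  have "msum n (insert x S) f = f x + msum n S f"
    using insert psdD(3,4)[OF insert.prems[of x]] by (intro eq_matI) auto
  then show ?case using insert psd_add by simp
qed

lemma psd_diag:
  assumes "psd n A" "i < n"
  shows "0 \<le> Re (A $$ (i, i))"
proof -
  have "(A *\<^sub>v unit_vec n i) \<bullet>c unit_vec n i = A $$ (i, i)"
    using psdD(1-4)[OF assms(1)] assms(2)
    by (auto simp: cscalar_sum mult_vec_index unit_vec_def if_distrib if_distribR sum.delta cong: if_cong simp del: index_mult_mat_vec)
  then show ?thesis using psdD(5)[OF assms(1), of "unit_vec n i"] by simp
qed

lemma psd_trace_nonneg: "psd n A \<Longrightarrow> 0 \<le> Re (mtrace A)"
  by (auto simp: mtrace_def psdD intro!: sum_nonneg psd_diag)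

subsection \<open>The spectral theorem\<close>

definition diagm :: "nat \<Rightarrow> (nat \<Rightarrow> real) \<Rightarrow> complex mat" where
  "diagm n d = mat n n (\<lambda>(i, j). if i = j then complex_of_real (d i) else 0)"

lemma diagm_dim [simp]: "dim_row (diagm n d) = n" "dim_col (diagm n d) = n" "diagm n d \<in> carrier_mat n n"
  by (auto simp: diagm_def)

lemma diagm_index [simp]:
  "i < n \<Longrightarrow> j < n \<Longrightarrow> diagm n d $$ (i, j) = (if i = j then complex_of_real (d i) else 0)"
  by (simp add: diagm_def)

lemma diagm_mult_index:
  "dim_row X = n \<Longrightarrow> i < n \<Longrightarrow> j < dim_col X \<Longrightarrow> (diagm n d * X) $$ (i, j) = d i * X $$ (i, j)"
  by (simp add: mult_index if_distrib if_distribR sum.delta' sum.delta cong: if_cong del: index_mult_mat(1))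

lemma diagm_mult [simp]: "diagm n a * diagm n b = diagm n (\<lambda>i. a i * b i)"
  by (intro eq_matI) (auto simp: diagm_mult_index simp del: index_mult_mat(1))

lemma adjoint_diagm [simp]: "mat_adjoint (diagm n d) = diagm n d"
  by (intro eq_matI) auto

lemma psd_diagm:
  assumes "\<And>i. i < n \<Longrightarrow> 0 \<le> d i"
  shows "psd n (diagm n d)"
proof -
  have "diagm n d = diagm n (\<lambda>i. sqrt (d i)) * mat_adjoint (diagm n (\<lambda>i. sqrt (d i)))"
    using assms by (intro eq_matI) auto
  then show ?thesis using psd_gram[of "diagm n (\<lambda>i. sqrt (d i))" n n] by simp
qed

lemma conj_diagm_index:
  assumes "V \<in> carrier_mat n n" "i < n" "j < n"
  shows "(V * diagm n d * mat_adjoint V) $$ (i, j) = (\<Sum>k<n. V $$ (i, k) * d k * cnj (V $$ (j, k)))"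
  using assms
  by (simp add: mult_index[of i V j "diagm n d * mat_adjoint V"] diagm_mult_index mult.assoc del: index_mult_mat(1))

lemma unitary_matD:
  assumes "unitary_mat n V"
  shows "V \<in> carrier_mat n n" "dim_row V = n" "dim_col V = n"
    "V * mat_adjoint V = 1\<^sub>m n" "mat_adjoint V * V = 1\<^sub>m n"
  using assms by (auto simp: unitary_mat_def)

lemma unitary_matI:
  assumes "V \<in> carrier_mat n n" "V * mat_adjoint V = 1\<^sub>m n"
  shows "unitary_mat n V"
  using assms mat_mult_left_right_inverse[of V n "mat_adjoint V"] by (auto simp: unitary_mat_def)

text \<open>Completing an eigenvector to a basis and applying Gram-Schmidt keeps it as the first
  vector. After normalisation the columns are orthonormal and column 0 is an eigenvector: this is
  the deflation step of the spectral theorem.\<close>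

lemma hermitian_eigen_unitary:
  fixes A :: "complex mat"
  assumes A: "A \<in> carrier_mat n n" and n: "0 < n"
  shows "\<exists>W e. unitary_mat n W \<and> (\<forall>k<n. (A * W) $$ (k, 0) = e * W $$ (k, 0))"
proof -
  obtain e where "eigenvalue A e"
    using spectrum_non_empty[OF A] n by (auto simp: spectrum_def)
  then obtain v where ev: "eigenvector A v e" by (auto simp: eigenvalue_def)
  then have v: "v \<in> carrier_vec n" and v0: "v \<noteq> 0\<^sub>v n" and Av: "A *\<^sub>v v = e \<cdot>\<^sub>v v"
    using A by (auto simp: eigenvector_def)
  interpret cof_vec_space n "TYPE(complex)" .
  note bc = basis_completion[OF v v0]
  define ws where "ws = gram_schmidt n (basis_completion v)"
  have ws: "set ws \<subseteq> carrier_vec n" "corthogonal ws" "length ws = n"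
    using gram_schmidt_result[OF bc(2,4,5) ws_def] bc(6) by auto
  obtain vs where "basis_completion v = v # vs"
    using bc(6,7) n by (cases "basis_completion v") auto
  then have "hd ws = v" using gram_schmidt_hd[OF v, of vs] by (simp add: ws_def)
  then have ws0: "ws ! 0 = v" using ws(3) n by (metis hd_conv_nth length_greater_0_conv)
  \<comment> \<open>\<open>gram_schmidt\<close> orthogonalises without normalising;
    \<open>c j\<close> is the norm of vector j and supplies the missing scaling.\<close>
  define c where "c j = complex_of_real (sqrt (\<Sum>k<n. (cmod (ws ! j $ k))\<^sup>2))" for j
  define W where "W = mat n n (\<lambda>(i, j). ws ! j $ i / c j)"
  have dim: "dim_vec (ws ! j) = n" if "j < n" for j
    using ws that by (metis carrier_vecD nth_mem subsetD)
  have self: "ws ! j \<bullet>c ws ! j = c j * c j" if "j < n" for j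
    using that dim[OF that] by (simp add: cscalar_self c_def sum_nonneg flip: of_real_mult)
  have orth: "(ws ! i \<bullet>c ws ! j = 0) = (i \<noteq> j)" if "i < n" "j < n" for i j
    using corthogonalD[OF ws(2)] that ws(3) by simp
  have c0: "c j \<noteq> 0" if "j < n" for j
    using self[OF that] orth[OF that that] by auto
  have cc: "cnj (c j) = c j" for j by (simp add: c_def)
  have W: "W \<in> carrier_mat n n" by (simp add: W_def)
  have "mat_adjoint W * W = 1\<^sub>m n"
  proof (intro eq_matI)
    fix i j assume ij: "i < dim_row (1\<^sub>m n :: complex mat)" "j < dim_col (1\<^sub>m n :: complex mat)"
    then have "(mat_adjoint W * W) $$ (i, j) = (\<Sum>k<n. cnj (ws ! i $ k / c i) * (ws ! j $ k / c j))"
      using W by (auto simp: mult_index W_def simp del: index_mult_mat(1))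
    also have "\<dots> = (ws ! j \<bullet>c ws ! i) / (c i * c j)"
      using ij by (simp add: cscalar_sum dim cc sum_divide_distrib mult_ac)
    also have "\<dots> = 1\<^sub>m n $$ (i, j)"
      using ij self[of i] orth[of j i] c0 by auto
    finally show "(mat_adjoint W * W) $$ (i, j) = 1\<^sub>m n $$ (i, j)" .
  qed (use W in auto)
  then have "unitary_mat n W"
    using mat_mult_left_right_inverse[of "mat_adjoint W" n W] W by (auto simp: unitary_mat_def)
  moreover have "(A * W) $$ (k, 0) = e * W $$ (k, 0)" if "k < n" for k
  proof -
    have "(A * W) $$ (k, 0) = (\<Sum>m<n. A $$ (k, m) * v $ m) / c 0"
      using that A n by (auto simp: mult_index W_def ws0 sum_divide_distrib simp del: index_mult_mat(1))
    also have "(\<Sum>m<n. A $$ (k, m) * v $ m) = (A *\<^sub>v v) $ k"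
      using that A v by (auto simp: mult_vec_index simp del: index_mult_mat_vec)
    also have "\<dots> = e * v $ k" using that v by (simp add: Av)
    finally show ?thesis using that n by (simp add: W_def ws0)
  qed
  ultimately show ?thesis by blast
qed

text \<open>Deflation: in an orthonormal basis that starts with an eigenvector the first column of
  the matrix is (e, 0, ..., 0). Self-adjointness gives the same first row and a real e, so the
  matrix splits into the number e and a Hermitian block of size n for the induction.\<close>

lemma hermitian_spectral:
  assumes "A \<in> carrier_mat n n" "mat_adjoint A = A"
  shows "\<exists>V d. unitary_mat n V \<and> A = V * diagm n d * mat_adjoint V"
  using assms
proof (induction n arbitrary: A)
  case 0
  then show ?case
    by (intro exI[of _ "1\<^sub>m 0"] exI[of _ undefined] conjI) (auto simp: unitary_mat_def)
next
  case (Suc n)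
  note A = Suc.prems
  obtain W e where W: "unitary_mat (Suc n) W" and We: "\<And>k. k < Suc n \<Longrightarrow> (A * W) $$ (k, 0) = e * W $$ (k, 0)"
    using hermitian_eigen_unitary[OF A(1)] by auto
  note [simp] = unitary_matD(1-3)[OF W]
  have [simp]: "dim_row A = Suc n" "dim_col A = Suc n" using A(1) by auto
  define A' where "A' = mat_adjoint W * (A * W)"
  have A': "A' \<in> carrier_mat (Suc n) (Suc n)" "dim_row A' = Suc n" "dim_col A' = Suc n" "mat_adjoint A' = A'"
    using A by (auto simp: A'_def intro!: carrier_matI)
  have sym: "A' $$ (i, j) = cnj (A' $$ (j, i))" if "i < Suc n" "j < Suc n" for i j
    using adjoint_index[of i A' j] that A' by simp
  have col0: "A' $$ (i, 0) = (if i = 0 then e else 0)" if "i < Suc n" for i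
  proof -
    have "A' $$ (i, 0) = (\<Sum>k<Suc n. mat_adjoint W $$ (i, k) * (A * W) $$ (k, 0))"
      using that by (simp add: A'_def mult_index del: index_mult_mat(1) sum.lessThan_Suc)
    also have "\<dots> = e * (mat_adjoint W * W) $$ (i, 0)"
      using that We by (simp add: mult_index sum_distrib_left mult_ac del: index_mult_mat(1) sum.lessThan_Suc)
    finally show ?thesis using that by (simp add: unitary_matD(5)[OF W])
  qed
  have e: "complex_of_real (Re e) = e"
    using sym[of 0 0] col0[of 0] by (simp add: complex_eq_iff)
  have row0: "A' $$ (0, i) = (if i = 0 then e else 0)" if "i < Suc n" for i
  proof -
    have "cnj e = e" by (subst (1 2) e[symmetric]) simp
    then show ?thesis using sym[of 0 i] col0[OF that] that by simp
  qed
  define B where "B = mat n n (\<lambda>(i, j). A' $$ (Suc i, Suc j))"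
  have Bc: "B \<in> carrier_mat n n" by (simp add: B_def)
  have "mat_adjoint B = B"
    using sym[symmetric] by (intro eq_matI) (auto simp: B_def)
  then obtain V d where V: "unitary_mat n V" and B: "B = V * diagm n d * mat_adjoint V"
    using Suc.IH[OF Bc] by blast
  \<comment> \<open>The direct sum of 1 and \<open>V\<close>; correspondingly \<open>d'\<close> is
    \<open>d\<close> with the new eigenvalue in front.\<close>
  define V' where "V' = mat (Suc n) (Suc n)
    (\<lambda>(i, j). if i = 0 \<and> j = 0 then 1 else if i = 0 \<or> j = 0 then 0 else V $$ (i - 1, j - 1))"
  define d' where "d' k = (case k of 0 \<Rightarrow> Re e | Suc k \<Rightarrow> d k)" for k
  have V'c: "V' \<in> carrier_mat (Suc n) (Suc n)" by (simp add: V'_def)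
  have VV: "(\<Sum>k<n. V $$ (i, k) * cnj (V $$ (j, k))) = (if i = j then 1 else 0)" if "i < n" "j < n" for i j
    using that arg_cong[OF unitary_matD(4)[OF V], of "\<lambda>M. M $$ (i, j)"] unitary_matD(1-3)[OF V]
    by (simp add: mult_index del: index_mult_mat(1))
  have BB: "A' $$ (Suc i, Suc j) = (\<Sum>k<n. V $$ (i, k) * d k * cnj (V $$ (j, k)))" if "i < n" "j < n" for i j
    using that arg_cong[OF B, of "\<lambda>M. M $$ (i, j)"] conj_diagm_index[OF unitary_matD(1)[OF V], of i j d]
    by (simp add: B_def del: index_mult_mat(1) mult_assoc_dim)
  have V': "unitary_mat (Suc n) V'"
  proof (rule unitary_matI[OF V'c], intro eq_matI)
    fix i j assume "i < dim_row (1\<^sub>m (Suc n) :: complex mat)" "j < dim_col (1\<^sub>m (Suc n) :: complex mat)"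
    then show "(V' * mat_adjoint V') $$ (i, j) = 1\<^sub>m (Suc n) $$ (i, j)"
      using V'c VV
      by (cases i; cases j) (auto simp: mult_index V'_def sum.lessThan_Suc_shift simp del: index_mult_mat(1) sum.lessThan_Suc)
  qed (use V'c in auto)
  have A'V: "A' = V' * diagm (Suc n) d' * mat_adjoint V'"
  proof (intro eq_matI)
    fix i j assume "i < dim_row (V' * diagm (Suc n) d' * mat_adjoint V')" "j < dim_col (V' * diagm (Suc n) d' * mat_adjoint V')"
    then have ij: "i < Suc n" "j < Suc n" using V'c by auto
    show "A' $$ (i, j) = (V' * diagm (Suc n) d' * mat_adjoint V') $$ (i, j)"
      unfolding conj_diagm_index[OF V'c ij]
      using ij col0[OF ij(1)] row0[OF ij(2)] e BB
      by (cases i; cases j) (auto simp: V'_def d'_def sum.lessThan_Suc_shift simp del: sum.lessThan_Suc)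
  qed (use A' V'c in auto)
  note [simp] = unitary_matD(1-3)[OF V']
  have WW: "W * (mat_adjoint W * X) = X" if "dim_row X = Suc n" for X
    using that mult_left_eq[OF unitary_matD(4)[OF W]] by simp
  have "A = W * A' * mat_adjoint W"
    by (simp add: A'_def WW unitary_matD(4)[OF W])
  also have "\<dots> = (W * V') * diagm (Suc n) d' * mat_adjoint (W * V')"
    by (simp add: A'V)
  finally have "A = (W * V') * diagm (Suc n) d' * mat_adjoint (W * V')" .
  moreover have "unitary_mat (Suc n) (W * V')"
  proof (rule unitary_matI)
    show "W * V' * mat_adjoint (W * V') = 1\<^sub>m (Suc n)"
      by (simp add: mult_left_eq[OF unitary_matD(4)[OF V']] unitary_matD(4)[OF W])
  qed (auto intro!: carrier_matI)
  ultimately show ?case by blast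
qed

lemma psd_spectral:
  assumes "psd n A"
  obtains V d where "unitary_mat n V" "A = V * diagm n d * mat_adjoint V" "\<And>i. i < n \<Longrightarrow> 0 \<le> d i"
proof -
  obtain V d where V: "unitary_mat n V" and A: "A = V * diagm n d * mat_adjoint V"
    using hermitian_spectral psdD[OF assms] by blast
  note [simp] = unitary_matD[OF V]
  have "conj_by (mat_adjoint V) A = diagm n d"
    by (simp add: conj_by_def A mult_left_eq[OF unitary_matD(5)[OF V]])
  then have "psd n (diagm n d)" using psd_conj[OF assms, of "mat_adjoint V" n] by simp
  then have "0 \<le> d i" if "i < n" for i using psd_diag[of n "diagm n d" i] that by simp
  then show ?thesis using that V A by blast
qed

subsection \<open>Square roots\<close>

text \<open>In an eigenbasis of \<open>B - C\<close> the two matrices differ only on the diagonal,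
  by \<open>d\<close>. The diagonal of the equal squares gives d_i (2 B'_ii - d_i) = 0. A nonzero
  d_i would equal 2 B'_ii \<ge> 0, whereas C'_ii = B'_ii - d_i = - d_i / 2 \<ge> 0, a contradiction.
  Uniqueness is what gives the \<open>THE\<close> in \<open>msqrt\<close> its meaning.\<close>

lemma psd_sqrt_unique:
  assumes B: "psd n B" and C: "psd n C" and eq: "B * B = C * C"
  shows "B = C"
proof -
  note [simp] = psdD(1-4)[OF B] psdD(1-4)[OF C]
  have "mat_adjoint (B - C) = B - C" by (subst adjoint_minus) auto
  moreover have "B - C \<in> carrier_mat n n" by (intro carrier_matI) auto
  ultimately obtain V d where V: "unitary_mat n V" and D: "B - C = V * diagm n d * mat_adjoint V"
    using hermitian_spectral by blast
  note [simp] = unitary_matD(1-3)[OF V]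
  define B' where "B' = conj_by (mat_adjoint V) B"
  define C' where "C' = conj_by (mat_adjoint V) C"
  have psd': "psd n B'" "psd n C'" unfolding B'_def C'_def by (auto intro!: psd_conj B C)
  note [simp] = psdD(1-4)[OF psd'(1)] psdD(1-4)[OF psd'(2)]
  note VV = mult_left_eq[OF unitary_matD(4)[OF V]] mult_left_eq[OF unitary_matD(5)[OF V]]
  have "B' - C' = conj_by (mat_adjoint V) (B - C)"
    by (simp add: B'_def C'_def conj_by_def minus_mult_dim mult_minus_dim)
  also have "\<dots> = diagm n d"
    by (simp add: conj_by_def D VV unitary_matD(5)[OF V])
  finally have diff: "B' - C' = diagm n d" .
  have ent: "C' $$ (i, j) = B' $$ (i, j) - (if i = j then complex_of_real (d i) else 0)" if "i < n" "j < n" for i j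
    using arg_cong[OF diff, of "\<lambda>M. M $$ (i, j)"] that by (simp add: algebra_simps)
  have "B' * B' = C' * C'"
    using eq by (simp add: B'_def C'_def conj_by_def VV mult_left_eq[OF eq])
  have d0: "d i = 0" if i: "i < n" for i
  proof -
    have "(\<Sum>k<n. B' $$ (i, k) * B' $$ (k, i)) = (\<Sum>k<n. C' $$ (i, k) * C' $$ (k, i))"
      using i arg_cong[OF \<open>B' * B' = C' * C'\<close>, of "\<lambda>M. M $$ (i, i)"]
      by (simp add: mult_index del: index_mult_mat(1))
    also have "\<dots> = (\<Sum>k<n. B' $$ (i, k) * B' $$ (k, i)
        - (if k = i then 2 * complex_of_real (d i) * B' $$ (i, i) - (complex_of_real (d i))\<^sup>2 else 0))"
      using i by (intro sum.cong) (auto simp: ent algebra_simps power2_eq_square)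
    also have "\<dots> = (\<Sum>k<n. B' $$ (i, k) * B' $$ (k, i)) -
        (2 * complex_of_real (d i) * B' $$ (i, i) - (complex_of_real (d i))\<^sup>2)"
      using i by (simp add: sum_subtractf)
    finally have "complex_of_real (d i) * (2 * B' $$ (i, i) - complex_of_real (d i)) = 0"
      by (simp add: algebra_simps power2_eq_square)
    then have "d i = 0 \<or> 2 * Re (B' $$ (i, i)) = d i"
      by (auto simp: complex_eq_iff)
    moreover have "0 \<le> Re (B' $$ (i, i))" "0 \<le> Re (B' $$ (i, i)) - d i"
      using psd_diag[OF psd'(1) i] psd_diag[OF psd'(2) i] ent[OF i i] by auto
    ultimately show ?thesis by auto
  qed
  have "B' = C'"
    using ent d0 by (intro eq_matI) auto
  then have "V * (B' * mat_adjoint V) = V * (C' * mat_adjoint V)" by simp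
  then show ?thesis
    by (simp add: B'_def C'_def conj_by_def VV unitary_matD(4,5)[OF V])
qed

lemma msqrt_eqI:
  assumes "psd n B" "B * B = A"
  shows "msqrt A = B"
  unfolding msqrt_def
proof (rule the_equality)
  have n: "dim_row A = n" using assms psdD(3)[OF assms(1)] by auto
  show "psd (dim_row A) B \<and> B * B = A" using assms n by simp
  show "X = B" if "psd (dim_row A) X \<and> X * X = A" for X
    using that assms n psd_sqrt_unique[of n X B] by simp
qed

lemma conj_diagm_sqrt:
  assumes V: "unitary_mat n V" and d: "\<And>i. i < n \<Longrightarrow> 0 \<le> d i"
  shows "msqrt (V * diagm n d * mat_adjoint V) = V * diagm n (\<lambda>i. sqrt (d i)) * mat_adjoint V"
proof (rule msqrt_eqI)
  note [simp] = unitary_matD(1-3)[OF V]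
  show "psd n (V * diagm n (\<lambda>i. sqrt (d i)) * mat_adjoint V)"
    using psd_conj[OF psd_diagm, of n "\<lambda>i. sqrt (d i)" V n] d by (simp add: conj_by_def)
  have "diagm n (\<lambda>i. sqrt (d i)) * diagm n (\<lambda>i. sqrt (d i)) = diagm n d"
    using d by (intro eq_matI) auto
  note dd = mult_left_eq[OF this]
  show "V * diagm n (\<lambda>i. sqrt (d i)) * mat_adjoint V * (V * diagm n (\<lambda>i. sqrt (d i)) * mat_adjoint V)
    = V * diagm n d * mat_adjoint V"
    by (simp add: mult_left_eq[OF unitary_matD(5)[OF V]] dd del: diagm_mult)
qed

lemma msqrt:
  assumes "psd n A"
  shows "psd n (msqrt A)" "msqrt A * msqrt A = A"
proof -
  obtain V d where V: "unitary_mat n V" and A: "A = V * diagm n d * mat_adjoint V"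
    and d: "\<And>i. i < n \<Longrightarrow> 0 \<le> d i"
    using psd_spectral[OF assms] by metis
  note [simp] = unitary_matD(1-3)[OF V]
  have eq: "msqrt A = V * diagm n (\<lambda>i. sqrt (d i)) * mat_adjoint V"
    unfolding A by (rule conj_diagm_sqrt[OF V d])
  show "psd n (msqrt A)"
    unfolding eq using psd_conj[OF psd_diagm, of n "\<lambda>i. sqrt (d i)" V n] d by (simp add: conj_by_def)
  have "diagm n (\<lambda>i. sqrt (d i)) * diagm n (\<lambda>i. sqrt (d i)) = diagm n d"
    using d by (intro eq_matI) auto
  note dd = mult_left_eq[OF this]
  show "msqrt A * msqrt A = A"
    unfolding eq unfolding A
    by (simp add: mult_left_eq[OF unitary_matD(5)[OF V]] dd del: diagm_mult)
qed

lemma psd_gramE: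
  assumes "psd n A"
  obtains S where "S \<in> carrier_mat n n" "A = S * mat_adjoint S"
  using msqrt[OF assms] psdD[OF msqrt(1)[OF assms]] that[of "msqrt A"] by simp

subsection \<open>A lower bound for the fidelity\<close>

lemma gram_diag:
  assumes "i < dim_row X"
  shows "(X * mat_adjoint X) $$ (i, i) = complex_of_real (\<Sum>k<dim_col X. (cmod (X $$ (i, k)))\<^sup>2)"
  using assms by (simp add: mult_index complex_norm_square del: index_mult_mat(1) of_real_power)

text \<open>Douglas' factorization lemma: the contraction is \<open>W = A\<^bsup>-1/2\<^esup> C\<close>, with the inverse taken on the range of \<open>A\<close>.\<close>
lemma psd_factor:
  assumes A: "psd n A" and C: "C \<in> carrier_mat n m" and le: "psd n (A - C * mat_adjoint C)"
  obtains W where "W \<in> carrier_mat n m" "C = msqrt A * W" "psd n (1\<^sub>m n - W * mat_adjoint W)"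
proof -
  obtain V d where V: "unitary_mat n V" and Aeq: "A = V * diagm n d * mat_adjoint V"
    and d: "\<And>i. i < n \<Longrightarrow> 0 \<le> d i"
    using psd_spectral[OF A] by metis
  note [simp] = unitary_matD(1-3)[OF V] psdD(1-4)[OF A]
  note VV = mult_left_eq[OF unitary_matD(4)[OF V]] mult_left_eq[OF unitary_matD(5)[OF V]]
  have sq: "msqrt A = V * diagm n (\<lambda>i. sqrt (d i)) * mat_adjoint V"
    unfolding Aeq by (rule conj_diagm_sqrt[OF V d])
  have [simp]: "dim_row C = n" "dim_col C = m" using C by auto
  define r where "r i = (if d i = 0 then 0 else 1 / sqrt (d i))" for i
  define X where "X = mat_adjoint V * C"
  have X [simp]: "dim_row X = n" "dim_col X = m" by (auto simp: X_def)
  define W where "W = V * (diagm n r * X)"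
  have W [simp]: "dim_row W = n" "dim_col W = m" by (auto simp: W_def)
  have eq: "conj_by (mat_adjoint V) (A - C * mat_adjoint C) = diagm n d - X * mat_adjoint X"
    by (simp add: conj_by_def Aeq X_def minus_mult_dim mult_minus_dim VV
        unitary_matD(5)[OF V] carrier_matI)
  have le': "psd n (diagm n d - X * mat_adjoint X)"
    using psd_conj[OF le adjoint_carrier[OF unitary_matD(1)[OF V]]] unfolding eq .
  \<comment> \<open>On the kernel of \<open>A\<close> the domination forces \<open>C\<close> to
    vanish: where d_i = 0, the diagonal entry of the positive matrix is minus the squared norm of
    row i of \<open>X\<close>. So nothing is lost by setting r_i = 0 there.\<close>
  have row0: "X $$ (i, j) = 0" if "i < n" "j < m" "d i = 0" for i j
  proof -
    have "(\<Sum>k<m. (cmod (X $$ (i, k)))\<^sup>2) \<le> 0"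
      using psd_diag[OF le' that(1)] that by (simp add: gram_diag del: index_mult_mat(1) of_real_sum of_real_power)
    then have "(\<Sum>k<m. (cmod (X $$ (i, k)))\<^sup>2) = 0"
      by (intro antisym sum_nonneg) auto
    then show ?thesis using that(2) by (simp add: sum_nonneg_eq_0_iff)
  qed
  have "diagm n (\<lambda>i. sqrt (d i)) * (diagm n r * X) = X"
    using row0 d by (intro eq_matI) (auto simp: diagm_mult_index r_def simp del: index_mult_mat(1))
  then have "msqrt A * W = V * X"
    by (simp add: sq W_def VV)
  then have "C = msqrt A * W"
    by (simp add: X_def VV)
  moreover have "psd n (1\<^sub>m n - W * mat_adjoint W)"
  proof -
    \<comment> \<open>The product r d r is 1 only where d_i \<noteq> 0; adding the projection
      \<open>?p\<close> onto the kernel completes it to the identity.\<close>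
    let ?p = "\<lambda>i. if d i = 0 then 1 else 0"
    have "psd n (diagm n ?p + conj_by (diagm n r) (diagm n d - X * mat_adjoint X))"
      by (rule psd_add[OF psd_diagm psd_conj[OF le']]) auto
    then have "psd n (conj_by V (diagm n ?p + conj_by (diagm n r) (diagm n d - X * mat_adjoint X)))"
      by (rule psd_conj) simp
    moreover have "diagm n ?p + conj_by (diagm n r) (diagm n d - X * mat_adjoint X)
        = 1\<^sub>m n - diagm n r * X * mat_adjoint (diagm n r * X)"
    proof -
      have "diagm n r * (diagm n d * diagm n r) = 1\<^sub>m n - diagm n ?p"
        using d by (intro eq_matI) (auto simp: r_def simp flip: of_real_mult)
      then show ?thesis
        by (simp add: conj_by_def minus_mult_dim mult_minus_dim carrier_matI del: diagm_mult)
          (intro eq_matI, auto)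
    qed
    moreover have "conj_by V (1\<^sub>m n - diagm n r * X * mat_adjoint (diagm n r * X)) = 1\<^sub>m n - W * mat_adjoint W"
      by (simp add: conj_by_def W_def minus_mult_dim mult_minus_dim unitary_matD(4)[OF V] carrier_matI)
    ultimately show ?thesis by simp
  qed
  ultimately show ?thesis using that W carrier_matI by blast
qed

text \<open>The trace is estimated entry by entry in an eigenbasis of \<open>R\<close>.\<close>
lemma trace_contraction_le:
  assumes Y: "Y \<in> carrier_mat m n" and W: "W \<in> carrier_mat n m"
    and contr: "psd n (1\<^sub>m n - W * mat_adjoint W)"
    and R: "psd n R" and RR: "R * R = mat_adjoint Y * Y"
  shows "Re (mtrace (Y * W)) \<le> Re (mtrace R)"
proof -
  obtain V d where V: "unitary_mat n V" and Req: "R = V * diagm n d * mat_adjoint V"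
    and d: "\<And>i. i < n \<Longrightarrow> 0 \<le> d i"
    using psd_spectral[OF R] by metis
  note [simp] = unitary_matD(1-3)[OF V]
  have [simp]: "dim_row Y = m" "dim_col Y = n" "dim_row W = n" "dim_col W = m" using Y W by auto
  note VV = mult_left_eq[OF unitary_matD(4)[OF V]] mult_left_eq[OF unitary_matD(5)[OF V]]
  define X where "X = mat_adjoint V * W"
  define Z where "Z = Y * V"
  have [simp]: "dim_row X = n" "dim_col X = m" "dim_row Z = m" "dim_col Z = n" by (auto simp: X_def Z_def)
  have "mtrace (Y * W) = mtrace (Z * X)" by (simp add: X_def Z_def VV)
  also have "\<dots> = mtrace (X * Z)" by (rule mtrace_comm) auto
  finally have tr: "mtrace (Y * W) = mtrace (X * Z)" .
  have "mat_adjoint Z * Z = mat_adjoint V * (R * R) * V" by (simp add: Z_def RR)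
  also have "\<dots> = diagm n (\<lambda>i. d i * d i)"
    by (simp add: Req VV unitary_matD(5)[OF V] mult_left_eq[OF diagm_mult])
  finally have ZZ: "mat_adjoint Z * mat_adjoint (mat_adjoint Z) = diagm n (\<lambda>i. d i * d i)" by simp
  \<comment> \<open>Since R is the modulus of \<open>Y\<close>, passing to Z = Y V makes Z\<dagger>
    Z diagonal, and column i of \<open>Z\<close> has norm d_i.\<close>
  have Zn: "(\<Sum>k<m. (cmod (Z $$ (k, i)))\<^sup>2) = (d i)\<^sup>2" if "i < n" for i
  proof -
    have "complex_of_real (\<Sum>k<m. (cmod (Z $$ (k, i)))\<^sup>2) = (mat_adjoint Z * mat_adjoint (mat_adjoint Z)) $$ (i, i)"
      using that by (subst gram_diag) (auto simp del: of_real_sum of_real_power)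
    also have "\<dots> = complex_of_real ((d i)\<^sup>2)" unfolding ZZ using that by (simp add: power2_eq_square)
    finally show ?thesis by (simp only: of_real_eq_iff)
  qed
  have "conj_by (mat_adjoint V) (1\<^sub>m n - W * mat_adjoint W) = 1\<^sub>m n - X * mat_adjoint X"
    by (simp add: conj_by_def X_def minus_mult_dim mult_minus_dim unitary_matD(5)[OF V] carrier_matI)
  then have "psd n (1\<^sub>m n - X * mat_adjoint X)" using psd_conj[OF contr, of "mat_adjoint V" n] by simp
  then have Xn: "(\<Sum>k<m. (cmod (X $$ (i, k)))\<^sup>2) \<le> 1" if "i < n" for i
    using psd_diag[of n "1\<^sub>m n - X * mat_adjoint X" i] that
    by (simp add: gram_diag del: index_mult_mat(1) of_real_sum of_real_power)
  \<comment> \<open>Cauchy-Schwarz between row i of the contraction \<open>X\<close>, of norm at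
    most 1, and column i of \<open>Z\<close>.\<close>
  have "Re ((X * Z) $$ (i, i)) \<le> d i" if i: "i < n" for i
  proof -
    have "Re ((X * Z) $$ (i, i)) \<le> cmod (\<Sum>k<m. X $$ (i, k) * Z $$ (k, i))"
      using i complex_Re_le_cmod by (simp add: mult_index del: index_mult_mat(1) Re_sum)
    also have "\<dots> \<le> (\<Sum>k<m. \<bar>cmod (X $$ (i, k))\<bar> * \<bar>cmod (Z $$ (k, i))\<bar>)"
      by (rule order_trans[OF norm_sum]) (simp add: norm_mult)
    also have "\<dots> \<le> L2_set (\<lambda>k. cmod (X $$ (i, k))) {..<m} * L2_set (\<lambda>k. cmod (Z $$ (k, i))) {..<m}"
      by (rule L2_set_mult_ineq)
    also have "\<dots> \<le> 1 * d i"
      using Xn[OF i] Zn[OF i] d[OF i] by (intro mult_mono) (auto simp: L2_set_def)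
    finally show ?thesis by simp
  qed
  then have "Re (mtrace (X * Z)) \<le> (\<Sum>i<n. d i)"
    unfolding mtrace_def Re_sum by (auto intro!: sum_mono simp del: index_mult_mat(1))
  also have "mtrace R = mtrace (mat_adjoint V * (V * diagm n d))"
    unfolding Req by (subst mtrace_comm) auto
  then have "(\<Sum>i<n. d i) = Re (mtrace R)"
    by (simp add: VV) (simp add: mtrace_def)
  finally show ?thesis by (simp add: tr)
qed

text \<open>With \<open>Y = msqrt B * msqrt A\<close> the matrix under the root in the fidelity is
  Y\<dagger> Y, so the fidelity is the trace norm of \<open>Y\<close> and dominates Re tr (Y W) for
  every contraction \<open>W\<close>. The domination hypothesis supplies the \<open>W\<close> that
  turns tr (Y W) into tr (N B).\<close>

lemma fidelity_ge:
  assumes A: "psd n A" and B: "psd n B" and N: "N \<in> carrier_mat n n"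
    and le: "psd n (A - conj_by N B)"
  shows "Re (mtrace (N * B)) \<le> fidelity A B"
proof -
  note sA = msqrt[OF A] and sB = msqrt[OF B]
  note [simp] = psdD(1-4)[OF A] psdD(1-4)[OF B] psdD(1-4)[OF sA(1)] psdD(1-4)[OF sB(1)]
  have [simp]: "dim_row N = n" "dim_col N = n" using N by auto
  define Y where "Y = msqrt B * msqrt A"
  have [simp]: "dim_row Y = n" "dim_col Y = n" by (auto simp: Y_def)
  have "conj_by N B = N * msqrt B * mat_adjoint (N * msqrt B)"
    by (simp add: conj_by_def mult_left_eq[OF sB(2)])
  then obtain W where W: "W \<in> carrier_mat n n" "N * msqrt B = msqrt A * W" "psd n (1\<^sub>m n - W * mat_adjoint W)"
    using psd_factor[OF A, of "N * msqrt B" n] le carrier_matI[of "N * msqrt B"] by auto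
  have YY: "msqrt A * B * msqrt A = mat_adjoint Y * Y"
    by (simp add: Y_def mult_left_eq[OF sB(2)])
  have "psd n (mat_adjoint Y * Y)"
    using psd_gram[of "mat_adjoint Y" n n] by (simp add: carrier_matI)
  note R = msqrt[OF this]
  have "mtrace (N * B) = mtrace (N * msqrt B * msqrt B)"
    by (simp add: sB(2))
  also have "\<dots> = mtrace (msqrt B * (N * msqrt B))"
    by (subst mtrace_comm) auto
  also have "\<dots> = mtrace (Y * W)"
    unfolding W(2) using W(1) by (simp add: Y_def)
  finally have "mtrace (N * B) = mtrace (Y * W)" .
  moreover have "Re (mtrace (Y * W)) \<le> Re (mtrace (msqrt (mat_adjoint Y * Y)))"
    by (rule trace_contraction_le[OF _ W(1,3) R]) (simp add: carrier_matI)
  ultimately show ?thesis by (simp add: fidelity_def YY)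
qed

subsection \<open>Kronecker products\<close>

lemma kron_dim [simp]:
  "dim_row (kron A B) = dim_row A * dim_row B" "dim_col (kron A B) = dim_col A * dim_col B"
  by (auto simp: kron_def)

lemma kron_carrier [simp]:
  "A \<in> carrier_mat a b \<Longrightarrow> B \<in> carrier_mat c d \<Longrightarrow> kron A B \<in> carrier_mat (a * c) (b * d)"
  by (intro carrier_matI) auto

lemma prod_index_less: "i < a \<Longrightarrow> x < b \<Longrightarrow> i * b + x < a * (b::nat)"
  using mult_le_mono1[of "Suc i" a b] by simp

lemma kron_index:
  assumes "i < dim_row A" "x < dim_row B" "j < dim_col A" "y < dim_col B"
  shows "kron A B $$ (i * dim_row B + x, j * dim_col B + y) = A $$ (i, j) * B $$ (x, y)"
  using assms prod_index_less[of i "dim_row A" x "dim_row B"] prod_index_less[of j "dim_col A" y "dim_col B"]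
  by (simp add: kron_def)

text \<open>Comparing entries at indices i * b + x keeps most of the \<open>div\<close> and
  \<open>mod\<close> arithmetic out of entrywise proofs on tensor products.\<close>

lemma eq_mat_prodI:
  assumes "dim_row M = a * b" "dim_row N = a * b" "dim_col M = c * d" "dim_col N = c * d"
    and "\<And>i x j y. i < a \<Longrightarrow> x < b \<Longrightarrow> j < c \<Longrightarrow> y < d \<Longrightarrow>
      M $$ (i * b + x, j * d + y) = N $$ (i * b + x, j * d + y)"
  shows "M = N"
proof (rule eq_matI)
  fix r s assume "r < dim_row N" "s < dim_col N"
  then have r: "r < a * b" "s < c * d" using assms by auto
  then have "b > 0" "d > 0" by (auto intro: Nat.gr0I)
  then have "M $$ (r div b * b + r mod b, s div d * d + s mod d) = N $$ (r div b * b + r mod b, s div d * d + s mod d)"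
    using r by (intro assms(5)) (auto simp: less_mult_imp_div_less)
  then show "M $$ (r, s) = N $$ (r, s)" by simp
qed (use assms in auto)

lemma sum_prod_index: "(\<Sum>k<a * b. f k) = (\<Sum>i<a. \<Sum>x<b. f (i * b + x :: nat))"
proof -
  have "(\<Sum>k<a * b. f k) = (\<Sum>i<a. sum f {i * b..<i * b + b})"
    by (rule sum.nat_group[symmetric])
  also have "\<dots> = (\<Sum>i<a. \<Sum>x<b. f (i * b + x))"
  proof (rule sum.cong[OF refl])
    show "sum f {i * b..<i * b + b} = (\<Sum>x<b. f (i * b + x))" for i
      by (rule sum.reindex_bij_witness[of _ "\<lambda>x. i * b + x" "\<lambda>k. k - i * b"]) auto
  qed
  finally show ?thesis .
qed

lemma kron_mult:
  assumes "dim_col A = dim_row C" "dim_col B = dim_row D"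
  shows "kron A B * kron C D = kron (A * C) (B * D)"
proof (rule eq_mat_prodI[of _ "dim_row A" "dim_row B" _ "dim_col C" "dim_col D"])
  fix i x j y assume *: "i < dim_row A" "x < dim_row B" "j < dim_col C" "y < dim_col D"
  have "(kron A B * kron C D) $$ (i * dim_row B + x, j * dim_col D + y)
    = (\<Sum>k<dim_row C. \<Sum>z<dim_row D. kron A B $$ (i * dim_row B + x, k * dim_row D + z) * kron C D $$ (k * dim_row D + z, j * dim_col D + y))"
    using * assms by (subst mult_index) (auto simp: prod_index_less sum_prod_index)
  also have "\<dots> = (\<Sum>k<dim_row C. \<Sum>z<dim_row D. (A $$ (i, k) * C $$ (k, j)) * (B $$ (x, z) * D $$ (z, y)))"
    using * assms kron_index[of i A x B] kron_index[of _ C _ D j y] by (intro sum.cong refl) auto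
  also have "\<dots> = (A * C) $$ (i, j) * (B * D) $$ (x, y)"
    using * assms by (simp add: mult_index sum_product del: index_mult_mat(1))
  also have "\<dots> = kron (A * C) (B * D) $$ (i * dim_row B + x, j * dim_col D + y)"
    using * kron_index[of i "A * C" x "B * D" j y] by (simp del: index_mult_mat(1))
  finally show "(kron A B * kron C D) $$ (i * dim_row B + x, j * dim_col D + y) = \<dots>" .
qed auto

lemma adjoint_kron [simp]: "mat_adjoint (kron A B) = kron (mat_adjoint A) (mat_adjoint B)"
proof (rule eq_mat_prodI[of _ "dim_col A" "dim_col B" _ "dim_row A" "dim_row B"])
  fix i x j y assume *: "i < dim_col A" "x < dim_col B" "j < dim_row A" "y < dim_row B"
  show "mat_adjoint (kron A B) $$ (i * dim_col B + x, j * dim_row B + y)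
    = kron (mat_adjoint A) (mat_adjoint B) $$ (i * dim_col B + x, j * dim_row B + y)"
    using * kron_index[of j A y B i x] kron_index[of i "mat_adjoint A" x "mat_adjoint B" j y]
    by (simp add: prod_index_less)
qed auto

lemma kron_one_one: "kron (1\<^sub>m a) (1\<^sub>m b) = 1\<^sub>m (a * b)"
proof (rule eq_mat_prodI[of _ a b _ a b])
  fix i x j y assume *: "i < a" "x < b" "j < a" "y < b"
  have "(i * b + x = j * b + y) = (i = j \<and> x = y)"
  proof
    assume "i * b + x = j * b + y"
    then have "(i * b + x) div b = (j * b + y) div b" "(i * b + x) mod b = (j * b + y) mod b" by auto
    then show "i = j \<and> x = y" using * by simp
  qed auto
  then show "kron (1\<^sub>m a) (1\<^sub>m b) $$ (i * b + x, j * b + y) = 1\<^sub>m (a * b) $$ (i * b + x, j * b + y)"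
    using * kron_index[of i "1\<^sub>m a" x "1\<^sub>m b" j y] by (simp add: prod_index_less)
qed auto

lemma kron_one_right [simp]: "kron A (1\<^sub>m (Suc 0)) = A"
  by (intro eq_matI) (auto simp: kron_def)

lemma psd_kron:
  assumes "psd a A" "psd b B"
  shows "psd (a * b) (kron A B)"
proof -
  obtain S R where "S \<in> carrier_mat a a" "A = S * mat_adjoint S" "R \<in> carrier_mat b b" "B = R * mat_adjoint R"
    using assms by (metis psd_gramE)
  then show ?thesis using psd_gram[of "kron S R" "a * b" "a * b"] by (simp add: kron_mult)
qed

lemma conj_by_index:
  assumes "dim_col K = dim_row X" "dim_row X = dim_col X" "i < dim_row K" "j < dim_row K"
  shows "conj_by K X $$ (i, j) = (\<Sum>k<dim_row X. \<Sum>m<dim_row X. K $$ (i, k) * X $$ (k, m) * cnj (K $$ (j, m)))"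
proof -
  have "conj_by K X = K * (X * mat_adjoint K)" using assms by (simp add: conj_by_def)
  then show ?thesis using assms by (simp add: mult_index sum_distrib_left mult_ac del: index_mult_mat(1))
qed

lemma conj_by_dim [simp]: "dim_row (conj_by K X) = dim_row K" "dim_col (conj_by K X) = dim_row K"
  by (auto simp: conj_by_def)

lemma conj_by_mult:
  "dim_col K = dim_row L \<Longrightarrow> dim_col L = dim_row X \<Longrightarrow> dim_row X = dim_col X \<Longrightarrow> conj_by K (conj_by L X) = conj_by (K * L) X"
  by (simp add: conj_by_def)

subsection \<open>Partial traces\<close>

lemma sum_if: "(\<Sum>x\<in>S. if P then f x else 0) = (if P then sum f S else 0)"
  by simp

text \<open>A row matrix rather than a vector: \<open>kron (1\<^sub>m n) (bra d k)\<close> is then a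
  rectangular Kraus operator of the partial trace, to which \<open>conj_by\<close> applies.\<close>

definition bra :: "nat \<Rightarrow> nat \<Rightarrow> complex mat" where
  "bra d k = mat 1 d (\<lambda>(i, j). if j = k then 1 else 0)"

lemma bra_dim [simp]: "dim_row (bra d k) = 1" "dim_col (bra d k) = d"
  by (auto simp: bra_def)

lemma ptrace_dim [simp]:
  "dim_row (ptrace_right n d X) = n" "dim_col (ptrace_right n d X) = n"
  "dim_row (ptrace_left n d X) = d" "dim_col (ptrace_left n d X) = d"
  by (auto simp: ptrace_right_def ptrace_left_def)

text \<open>The partial trace is a sum of conjugations by 1 \<otimes> <x|, each of which preserves
  positivity.\<close>

lemma psd_ptrace_right:
  assumes "psd (n * d) X"
  shows "psd n (ptrace_right n d X)"
proof -
  note [simp] = psdD(1-4)[OF assms]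
  have "ptrace_right n d X = msum n {..<d} (\<lambda>x. conj_by (kron (1\<^sub>m n) (bra d x)) X)"
  proof (rule eq_matI)
    fix i j assume "i < dim_row (msum n {..<d} (\<lambda>x. conj_by (kron (1\<^sub>m n) (bra d x)) X))"
      "j < dim_col (msum n {..<d} (\<lambda>x. conj_by (kron (1\<^sub>m n) (bra d x)) X))"
    then have ij: "i < n" "j < n" by auto
    have k: "kron (1\<^sub>m n) (bra d x) $$ (i, k * d + y) = (if k = i then if y = x then 1 else 0 else 0)"
      if "i < n" "k < n" "y < d" for i k x y
      using kron_index[of i "1\<^sub>m n" 0 "bra d x" k y] that by (auto simp: bra_def)
    have "conj_by (kron (1\<^sub>m n) (bra d x)) X $$ (i, j) = X $$ (i * d + x, j * d + x)" if "x < d" for x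
      using ij that
      by (simp add: conj_by_index sum_prod_index k if_distrib[of cnj] if_distrib[of "\<lambda>z. z * _"] if_distrib[of "\<lambda>z. _ * z"]
          sum_if cong: if_cong)
    then show "ptrace_right n d X $$ (i, j) = msum n {..<d} (\<lambda>x. conj_by (kron (1\<^sub>m n) (bra d x)) X) $$ (i, j)"
      using ij by (simp add: ptrace_right_def)
  qed auto
  moreover have "psd n (conj_by (kron (1\<^sub>m n) (bra d x)) X)" for x
    using assms by (rule psd_conj) (simp add: carrier_matI)
  ultimately show ?thesis by (simp add: psd_msum)
qed

lemma psd_ptrace_left:
  assumes "psd (n * d) X"
  shows "psd d (ptrace_left n d X)"
proof -
  note [simp] = psdD(1-4)[OF assms]
  have "ptrace_left n d X = msum d {..<n} (\<lambda>x. conj_by (kron (bra n x) (1\<^sub>m d)) X)"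
  proof (rule eq_matI)
    fix i j assume "i < dim_row (msum d {..<n} (\<lambda>x. conj_by (kron (bra n x) (1\<^sub>m d)) X))"
      "j < dim_col (msum d {..<n} (\<lambda>x. conj_by (kron (bra n x) (1\<^sub>m d)) X))"
    then have ij: "i < d" "j < d" by auto
    have k: "kron (bra n x) (1\<^sub>m d) $$ (i, k * d + y) = (if k = x then if y = i then 1 else 0 else 0)"
      if "i < d" "k < n" "y < d" for i k x y
      using kron_index[of 0 "bra n x" i "1\<^sub>m d" k y] that by (auto simp: bra_def)
    have "conj_by (kron (bra n x) (1\<^sub>m d)) X $$ (i, j) = X $$ (x * d + i, x * d + j)" if "x < n" for x
      using ij that
      by (simp add: conj_by_index sum_prod_index k if_distrib[of cnj] if_distrib[of "\<lambda>z. z * _"] if_distrib[of "\<lambda>z. _ * z"]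
          sum_if cong: if_cong)
    then show "ptrace_left n d X $$ (i, j) = msum d {..<n} (\<lambda>x. conj_by (kron (bra n x) (1\<^sub>m d)) X) $$ (i, j)"
      using ij by (simp add: ptrace_left_def)
  qed auto
  moreover have "psd d (conj_by (kron (bra n x) (1\<^sub>m d)) X)" for x
    using assms by (rule psd_conj) (simp add: carrier_matI)
  ultimately show ?thesis by (simp add: psd_msum)
qed

lemma one_kron_mult_index:
  assumes "dim_col Z = d'" "dim_row Z = d" "dim_row X = n * d'" "i < n" "x < d" "c < dim_col X"
  shows "(kron (1\<^sub>m n) Z * X) $$ (i * d + x, c) = (\<Sum>z<d'. Z $$ (x, z) * X $$ (i * d' + z, c))"
proof -
  have k: "kron (1\<^sub>m n) Z $$ (i * d + x, k * d' + z) = (if k = i then Z $$ (x, z) else 0)" if "k < n" "z < d'" for k z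
    using assms that kron_index[of i "1\<^sub>m n" x Z k z] by auto
  have "(kron (1\<^sub>m n) Z * X) $$ (i * d + x, c)
    = (\<Sum>k<n. \<Sum>z<d'. kron (1\<^sub>m n) Z $$ (i * d + x, k * d' + z) * X $$ (k * d' + z, c))"
    using assms by (subst mult_index) (auto simp: prod_index_less sum_prod_index)
  also have "\<dots> = (\<Sum>k<n. if k = i then \<Sum>z<d'. Z $$ (x, z) * X $$ (i * d' + z, c) else 0)"
    by (intro sum.cong) (auto simp: k)
  finally show ?thesis using assms by simp
qed

lemma mult_one_kron_index:
  assumes "dim_row Z = d'" "dim_col Z = d" "dim_col X = n * d'" "j < n" "y < d" "r < dim_row X"
  shows "(X * kron (1\<^sub>m n) Z) $$ (r, j * d + y) = (\<Sum>z<d'. X $$ (r, j * d' + z) * Z $$ (z, y))"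
proof -
  have k: "kron (1\<^sub>m n) Z $$ (k * d' + z, j * d + y) = (if k = j then Z $$ (z, y) else 0)" if "k < n" "z < d'" for k z
    using assms that kron_index[of k "1\<^sub>m n" z Z j y] by auto
  have "(X * kron (1\<^sub>m n) Z) $$ (r, j * d + y)
    = (\<Sum>k<n. \<Sum>z<d'. X $$ (r, k * d' + z) * kron (1\<^sub>m n) Z $$ (k * d' + z, j * d + y))"
    using assms by (subst mult_index) (auto simp: prod_index_less sum_prod_index)
  also have "\<dots> = (\<Sum>k<n. if k = j then \<Sum>z<d'. X $$ (r, j * d' + z) * Z $$ (z, y) else 0)"
    by (intro sum.cong) (auto simp: k)
  finally show ?thesis using assms by simp
qed

text \<open>Cyclicity of the partial trace for operators on the traced factor alone.
  \<open>Z\<close> may be rectangular, so that the traced factor can shrink to dimension 1.\<close>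

lemma ptrace_right_comm:
  assumes "dim_row Z = d" "dim_col Z = d'" "dim_row X = n * d'" "dim_col X = n * d"
  shows "ptrace_right n d (kron (1\<^sub>m n) Z * X) = ptrace_right n d' (X * kron (1\<^sub>m n) Z)"
proof (rule eq_matI)
  fix i j assume "i < dim_row (ptrace_right n d' (X * kron (1\<^sub>m n) Z))" "j < dim_col (ptrace_right n d' (X * kron (1\<^sub>m n) Z))"
  then have ij: "i < n" "j < n" by auto
  have "ptrace_right n d (kron (1\<^sub>m n) Z * X) $$ (i, j) = (\<Sum>x<d. \<Sum>z<d'. Z $$ (x, z) * X $$ (i * d' + z, j * d + x))"
    using ij assms by (simp add: ptrace_right_def one_kron_mult_index[where d' = d'] prod_index_less del: index_mult_mat(1))
  also have "\<dots> = (\<Sum>z<d'. \<Sum>x<d. Z $$ (x, z) * X $$ (i * d' + z, j * d + x))"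
    by (rule sum.swap)
  also have "\<dots> = ptrace_right n d' (X * kron (1\<^sub>m n) Z) $$ (i, j)"
    using ij assms by (simp add: ptrace_right_def mult_one_kron_index[where d' = d and n = n] prod_index_less mult.commute[of "Z $$ _"] del: index_mult_mat(1))
  finally show "ptrace_right n d (kron (1\<^sub>m n) Z * X) $$ (i, j) = ptrace_right n d' (X * kron (1\<^sub>m n) Z) $$ (i, j)" .
qed auto

lemma ptrace_right_one: "X \<in> carrier_mat n n \<Longrightarrow> ptrace_right n 1 X = X"
  by (rule eq_matI) (auto simp: ptrace_right_def)

lemma ptrace_right_minus:
  assumes "X \<in> carrier_mat (n * d) (n * d)" "Y \<in> carrier_mat (n * d) (n * d)"
  shows "ptrace_right n d (X - Y) = ptrace_right n d X - ptrace_right n d Y"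
  using assms by (intro eq_matI) (auto simp: ptrace_right_def prod_index_less sum_subtractf)

text \<open>The difference is the partial trace of \<open>X\<close> compressed by \<open>1 \<otimes> (1 - w w\<^sup>\<dagger>)\<close>.\<close>
lemma psd_ptrace_right_minus:
  assumes X: "psd (n * d) X" and w: "w \<in> carrier_mat d 1" "mat_adjoint w * w = 1\<^sub>m 1"
  shows "psd n (ptrace_right n d X - conj_by (kron (1\<^sub>m n) (mat_adjoint w)) X)"
proof -
  note [simp] = psdD(1-4)[OF X]
  have [simp]: "dim_row w = d" "dim_col w = 1" using w by auto
  define Z where "Z = 1\<^sub>m d - w * mat_adjoint w"
  have [simp]: "dim_row Z = d" "dim_col Z = d" by (auto simp: Z_def)
  have adj: "mat_adjoint Z = Z" by (simp add: Z_def adjoint_minus)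
  have "w * (mat_adjoint w * (w * mat_adjoint w)) = w * mat_adjoint w"
    by (simp add: mult_left_eq[OF w(2)])
  then have ZZ: "Z * Z = Z"
    by (simp add: Z_def minus_mult_dim mult_minus_dim) (intro eq_matI, auto)
  have k: "kron (1\<^sub>m n) (1\<^sub>m d - w * mat_adjoint w) = 1\<^sub>m (n * d) - kron (1\<^sub>m n) (w * mat_adjoint w)"
  proof (rule eq_mat_prodI[of _ n d _ n d])
    fix i x j y assume *: "i < n" "x < d" "j < n" "y < d"
    have "(1\<^sub>m (n * d) :: complex mat) $$ (i * d + x, j * d + y) = 1\<^sub>m n $$ (i, j) * 1\<^sub>m d $$ (x, y)"
      using kron_index[of i "1\<^sub>m n" x "1\<^sub>m d" j y] * by (simp add: kron_one_one)
    then show "kron (1\<^sub>m n) (1\<^sub>m d - w * mat_adjoint w) $$ (i * d + x, j * d + y) =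
       (1\<^sub>m (n * d) - kron (1\<^sub>m n) (w * mat_adjoint w)) $$ (i * d + x, j * d + y)"
      using * kron_index[of i "1\<^sub>m n" x "1\<^sub>m d - w * mat_adjoint w" j y] kron_index[of i "1\<^sub>m n" x "w * mat_adjoint w" j y]
      by (simp add: prod_index_less del: index_mult_mat(1))
  qed auto
  have "ptrace_right n d (conj_by (kron (1\<^sub>m n) Z) X) = ptrace_right n d (kron (1\<^sub>m n) Z * (X * kron (1\<^sub>m n) Z))"
    by (simp add: conj_by_def adj)
  \<comment> \<open>Cyclicity merges the two copies of the projection \<open>Z\<close> into one,
    which makes the expression linear in w w\<dagger>.\<close>
  also have "\<dots> = ptrace_right n d (X * kron (1\<^sub>m n) Z)"
    by (subst ptrace_right_comm[where d' = d]) (auto simp: kron_mult ZZ)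
  also have "X * kron (1\<^sub>m n) Z = X - X * kron (1\<^sub>m n) (w * mat_adjoint w)"
    by (simp add: Z_def k mult_minus_dim)
  also have "ptrace_right n d \<dots> = ptrace_right n d X - ptrace_right n d (X * kron (1\<^sub>m n) (w * mat_adjoint w))"
    by (rule ptrace_right_minus) (auto intro!: carrier_matI)
  also have "X * kron (1\<^sub>m n) (w * mat_adjoint w) = X * kron (1\<^sub>m n) w * kron (1\<^sub>m n) (mat_adjoint w)"
    by (simp add: kron_mult)
  \<comment> \<open>Cycling the row w\<dagger> to the front leaves a traced factor of dimension 1,
    where the partial trace does nothing.\<close>
  also have "ptrace_right n d \<dots> = ptrace_right n 1 (kron (1\<^sub>m n) (mat_adjoint w) * (X * kron (1\<^sub>m n) w))"
    by (rule ptrace_right_comm[symmetric]) auto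
  also have "\<dots> = conj_by (kron (1\<^sub>m n) (mat_adjoint w)) X"
    by (subst ptrace_right_one) (auto simp: conj_by_def intro!: carrier_matI)
  finally have "ptrace_right n d X - conj_by (kron (1\<^sub>m n) (mat_adjoint w)) X = ptrace_right n d (conj_by (kron (1\<^sub>m n) Z) X)"
    by simp
  then show ?thesis using psd_ptrace_right[OF psd_conj[OF X, of "kron (1\<^sub>m n) Z" "n * d"]]
    by (simp add: carrier_matI)
qed

lemma mtrace_ptrace_right:
  assumes "dim_row P = n" "dim_col P = n" "dim_row X = n * d" "dim_col X = n * d"
  shows "mtrace (P * ptrace_right n d X) = mtrace (kron P (1\<^sub>m d) * X)"
proof -
  have k: "kron P (1\<^sub>m d) $$ (i * d + x, j * d + y) = (if x = y then P $$ (i, j) else 0)"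
    if "i < n" "j < n" "x < d" "y < d" for i j x y
    using kron_index[of i P x "1\<^sub>m d" j y] that assms by simp
  have "mtrace (kron P (1\<^sub>m d) * X) = (\<Sum>i<n. \<Sum>x<d. \<Sum>j<n. \<Sum>y<d. if x = y then P $$ (i, j) * X $$ (j * d + x, i * d + x) else 0)"
    using assms
    by (auto simp: mtrace_def mult_index sum_prod_index k prod_index_less if_distrib[of "\<lambda>z. z * _"] cong: if_cong simp del: index_mult_mat(1) intro!: sum.cong)
  also have "\<dots> = (\<Sum>i<n. \<Sum>x<d. \<Sum>j<n. P $$ (i, j) * X $$ (j * d + x, i * d + x))"
    by (simp add: sum.delta')
  also have "\<dots> = (\<Sum>i<n. \<Sum>j<n. \<Sum>x<d. P $$ (i, j) * X $$ (j * d + x, i * d + x))"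
    by (intro sum.cong refl sum.swap)
  also have "\<dots> = mtrace (P * ptrace_right n d X)"
    using assms by (simp add: mtrace_def mult_index ptrace_right_def sum_distrib_left del: index_mult_mat(1))
  finally show ?thesis by simp
qed

subsection \<open>Operators on one qubit of a register\<close>

definition clear_bit :: "nat \<Rightarrow> nat \<Rightarrow> nat" where
  "clear_bit q b = b - qbit q b * 2 ^ q"

definition put_bit :: "nat \<Rightarrow> nat \<Rightarrow> nat \<Rightarrow> nat" where
  "put_bit q x b = (if x = 0 then unset_bit q b else set_bit q b)"

lemma qbit_eq: "qbit q b = of_bool (bit b q)"
  by (simp add: qbit_def bit_iff_odd odd_iff_mod_2_eq_one)

lemma qbit_less [simp]: "qbit q b < 2"
  by (simp add: qbit_eq)

text \<open>\<open>emb\<close> clears a bit by subtraction; identifying this with the bit operation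
  makes bitwise extensionality available for register indices.\<close>

lemma clear_bit_eq: "clear_bit q b = unset_bit q b"
proof -
  have "unset_bit q b + of_bool (bit b q) * 2 ^ q = or (unset_bit q b) (of_bool (bit b q) * 2 ^ q)"
    by (rule disjunctive_add_eq_or) (auto simp: bit_eq_iff bit_simps)
  also have "\<dots> = b" by (rule bit_eqI) (auto simp: bit_simps)
  finally show ?thesis
    unfolding clear_bit_def qbit_eq by linarith
qed

lemma less_2_cases: "x < 2 \<longleftrightarrow> x = 0 \<or> x = (1::nat)"
  by auto

lemma qbit_put [simp]: "x < 2 \<Longrightarrow> qbit q (put_bit q x b) = x"
  by (auto simp: qbit_eq put_bit_def bit_simps less_2_cases)

lemma qbit_put_other [simp]: "q \<noteq> k \<Longrightarrow> qbit k (put_bit q x b) = qbit k b"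
  by (auto simp: qbit_eq put_bit_def bit_simps)

lemma put_qbit [simp]: "put_bit q (qbit q b) b = b"
  by (auto intro!: bit_eqI simp: qbit_eq put_bit_def bit_simps)

lemma put_put [simp]: "put_bit q x (put_bit q y b) = put_bit q x b"
  by (rule bit_eqI) (auto simp: put_bit_def bit_simps)

lemma put_bit_comm: "q \<noteq> k \<Longrightarrow> put_bit q x (put_bit k y b) = put_bit k y (put_bit q x b)"
  by (rule bit_eqI) (auto simp: put_bit_def bit_simps)

lemma clear_bit_eq_put: "clear_bit q b = put_bit q 0 b"
  by (simp add: clear_bit_eq put_bit_def)

lemma clear_eq_iff: "clear_bit q b = clear_bit q b' \<longleftrightarrow> b' = put_bit q (qbit q b') b"
  by (metis clear_bit_eq_put put_put put_qbit)

lemma less_pow_iff: "b < 2 ^ N \<longleftrightarrow> (\<forall>k\<ge>N. \<not> bit b k)" for b :: nat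
proof -
  have "b < 2 ^ N \<longleftrightarrow> take_bit N b = b" by (simp add: take_bit_nat_eq_self_iff)
  also have "\<dots> \<longleftrightarrow> (\<forall>k\<ge>N. \<not> bit b k)"
  proof
    assume "take_bit N b = b"
    then show "\<forall>k\<ge>N. \<not> bit b k" by (metis bit_take_bit_iff not_less)
  next
    assume "\<forall>k\<ge>N. \<not> bit b k"
    then show "take_bit N b = b" by (intro bit_eqI) (simp add: bit_take_bit_iff, metis not_le)
  qed
  finally show ?thesis .
qed

lemma put_bit_less [simp]: "q < N \<Longrightarrow> b < 2 ^ N \<Longrightarrow> put_bit q x b < 2 ^ N"
  by (auto simp: less_pow_iff put_bit_def bit_simps)

text \<open>In a row of an embedded operator only register indices that agree with b off qubit q
  contribute, and these are the two values of \<open>put_bit q x b\<close>.\<close>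

lemma sum_put_bit:
  assumes "q < N" "b < 2 ^ N"
  shows "(\<Sum>b'<2 ^ N. if clear_bit q b = clear_bit q b' then f b' else 0) = (\<Sum>x<2. f (put_bit q x b))"
proof -
  have "(\<Sum>b'<2 ^ N. if clear_bit q b = clear_bit q b' then f b' else 0)
    = (\<Sum>b' \<in> {b'. b' < 2 ^ N \<and> clear_bit q b = clear_bit q b'}. f b')"
    by (rule sum.mono_neutral_cong_right) auto
  also have "\<dots> = (\<Sum>x<2. f (put_bit q x b))"
    by (rule sum.reindex_bij_witness[of _ "\<lambda>x. put_bit q x b" "qbit q"])
      (use assms in \<open>auto simp: clear_eq_iff\<close>)
  finally show ?thesis .
qed

lemma emb_dim [simp]:
  "dim_row (emb n N q W) = n * 2 ^ N" "dim_col (emb n N q W) = n * 2 ^ N"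
  by (auto simp: emb_def)

lemma emb_index:
  assumes "i < n" "b < 2 ^ N" "j < n" "b' < 2 ^ N"
  shows "emb n N q W $$ (i * 2 ^ N + b, j * 2 ^ N + b') =
    (if clear_bit q b = clear_bit q b' then W $$ (i * 2 + qbit q b, j * 2 + qbit q b') else 0)"
  using assms by (simp add: emb_def prod_index_less Let_def clear_bit_def)

lemma emb_mult_index:
  assumes "q < N" "dim_row X = n * 2 ^ N" "i < n" "b < 2 ^ N" "c < dim_col X"
  shows "(emb n N q W * X) $$ (i * 2 ^ N + b, c) =
    (\<Sum>j<n. \<Sum>x<2. W $$ (i * 2 + qbit q b, j * 2 + x) * X $$ (j * 2 ^ N + put_bit q x b, c))"
proof -
  have "(emb n N q W * X) $$ (i * 2 ^ N + b, c)
    = (\<Sum>j<n. \<Sum>b'<2 ^ N. emb n N q W $$ (i * 2 ^ N + b, j * 2 ^ N + b') * X $$ (j * 2 ^ N + b', c))"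
    using assms by (subst mult_index) (auto simp: prod_index_less sum_prod_index)
  also have "\<dots> = (\<Sum>j<n. \<Sum>b'<2 ^ N. if clear_bit q b = clear_bit q b'
      then W $$ (i * 2 + qbit q b, j * 2 + qbit q b') * X $$ (j * 2 ^ N + b', c) else 0)"
    using assms by (intro sum.cong refl) (auto simp: emb_index)
  also have "\<dots> = (\<Sum>j<n. \<Sum>x<2. W $$ (i * 2 + qbit q b, j * 2 + x) * X $$ (j * 2 ^ N + put_bit q x b, c))"
    by (subst sum_put_bit[OF assms(1,4)]) (auto intro!: sum.cong)
  finally show ?thesis .
qed

lemma clear_put [simp]: "clear_bit q (put_bit q x b) = clear_bit q b"
  by (simp add: clear_bit_eq_put)

lemma emb_mult:
  assumes "q < N" "dim_row V = n * 2" "dim_col V = n * 2" "dim_row W = n * 2" "dim_col W = n * 2"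
  shows "emb n N q V * emb n N q W = emb n N q (V * W)"
proof (rule eq_mat_prodI[of _ n "2 ^ N" _ n "2 ^ N"])
  fix i b j b' :: nat assume *: "i < n" "b < 2 ^ N" "j < n" "b' < 2 ^ N"
  have VW: "(V * W) $$ (i * 2 + x, j * 2 + y) = (\<Sum>l<n. \<Sum>z<2. V $$ (i * 2 + x, l * 2 + z) * W $$ (l * 2 + z, j * 2 + y))"
    if "x < 2" "y < 2" for x y
    using * assms that by (subst mult_index) (auto simp: prod_index_less sum_prod_index)
  show "(emb n N q V * emb n N q W) $$ (i * 2 ^ N + b, j * 2 ^ N + b') = emb n N q (V * W) $$ (i * 2 ^ N + b, j * 2 ^ N + b')"
    using * assms VW
    by (auto simp: emb_mult_index emb_index prod_index_less simp del: index_mult_mat(1) intro!: sum.cong)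
qed auto

lemma adjoint_emb [simp]:
  assumes "q < N" "dim_row W = n * 2" "dim_col W = n * 2"
  shows "mat_adjoint (emb n N q W) = emb n N q (mat_adjoint W)"
proof (rule eq_mat_prodI[of _ n "2 ^ N" _ n "2 ^ N"])
  fix i b j b' :: nat assume "i < n" "b < 2 ^ N" "j < n" "b' < 2 ^ N"
  then show "mat_adjoint (emb n N q W) $$ (i * 2 ^ N + b, j * 2 ^ N + b') = emb n N q (mat_adjoint W) $$ (i * 2 ^ N + b, j * 2 ^ N + b')"
    using assms by (auto simp: emb_index prod_index_less)
qed auto

lemma emb_kron_one:
  assumes "q < N" "dim_row X = n" "dim_col X = n"
  shows "emb n N q (kron X (1\<^sub>m 2)) = kron X (1\<^sub>m (2 ^ N))"
proof (rule eq_mat_prodI[of _ n "2 ^ N" _ n "2 ^ N"])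
  fix i b j b' :: nat assume *: "i < n" "b < 2 ^ N" "j < n" "b' < 2 ^ N"
  have "b = b' \<longleftrightarrow> clear_bit q b = clear_bit q b' \<and> qbit q b = qbit q b'"
    using clear_eq_iff by (metis put_qbit)
  then show "emb n N q (kron X (1\<^sub>m 2)) $$ (i * 2 ^ N + b, j * 2 ^ N + b') = kron X (1\<^sub>m (2 ^ N)) $$ (i * 2 ^ N + b, j * 2 ^ N + b')"
    using * assms kron_index[of i X b "1\<^sub>m (2 ^ N)" j b'] kron_index[of i X "qbit q b" "1\<^sub>m 2" j "qbit q b'"]
    by (auto simp: emb_index prod_index_less)
qed (use assms in auto)

lemma kron_one_index:
  "i < n \<Longrightarrow> j < n \<Longrightarrow> x < dim_row m \<Longrightarrow> y < dim_col m \<Longrightarrow>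
    kron (1\<^sub>m n) m $$ (i * dim_row m + x, j * dim_col m + y) = (if i = j then m $$ (x, y) else 0)"
  using kron_index[of i "1\<^sub>m n" x m j y] by auto

text \<open>\<open>W\<close> acts on the system and qubit q, the other factor on qubit k alone. In
  either order a single intermediate index can connect the row with the column, and it does so
  exactly when b and b' agree off both qubits.\<close>

lemma emb_comm:
  assumes "q < N" "k < N" "q \<noteq> k" "dim_row W = n * 2" "dim_col W = n * 2" "dim_row m = 2" "dim_col m = 2"
  shows "emb n N q W * emb n N k (kron (1\<^sub>m n) m) = emb n N k (kron (1\<^sub>m n) m) * emb n N q W"
proof (rule eq_mat_prodI[of _ n "2 ^ N" _ n "2 ^ N"])
  fix i b j b' :: nat assume *: "i < n" "b < 2 ^ N" "j < n" "b' < 2 ^ N"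
  have m: "kron (1\<^sub>m n) m $$ (i * 2 + x, j * 2 + y) = (if i = j then m $$ (x, y) else 0)"
    if "i < n" "j < n" "x < 2" "y < 2" for i j x y
    using kron_one_index[of i n j x m y] that assms by simp
  have c1: "clear_bit k (put_bit q x b) \<noteq> clear_bit k b'" if "x < 2" "x \<noteq> qbit q b'" for x
    using assms(3) that by (metis clear_bit_eq_put qbit_put qbit_put_other)
  have c2: "clear_bit q (put_bit k y b) \<noteq> clear_bit q b'" if "y < 2" "y \<noteq> qbit k b'" for y
    using assms(3) that by (metis clear_bit_eq_put qbit_put qbit_put_other)
  have c3: "clear_bit k (put_bit q (qbit q b') b) = clear_bit k b' \<longleftrightarrow> clear_bit q (put_bit k (qbit k b') b) = clear_bit q b'"
    using assms(3) by (metis clear_eq_iff put_bit_comm qbit_put_other)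
  have "(emb n N q W * emb n N k (kron (1\<^sub>m n) m)) $$ (i * 2 ^ N + b, j * 2 ^ N + b')
    = (\<Sum>l<n. \<Sum>x<2. W $$ (i * 2 + qbit q b, l * 2 + x) *
        (if clear_bit k (put_bit q x b) = clear_bit k b' then if l = j then m $$ (qbit k b, qbit k b') else 0 else 0))"
    using * assms by (auto simp: emb_mult_index emb_index prod_index_less m intro!: sum.cong simp del: index_mult_mat(1))
  also have "\<dots> = (\<Sum>l<n. \<Sum>x<2. if l = j then if x = qbit q b'
      then if clear_bit k (put_bit q (qbit q b') b) = clear_bit k b' then W $$ (i * 2 + qbit q b, j * 2 + qbit q b') * m $$ (qbit k b, qbit k b') else 0 else 0 else 0)"
    by (intro sum.cong refl) (use c1 in auto)
  also have "\<dots> = (if clear_bit k (put_bit q (qbit q b') b) = clear_bit k b' then W $$ (i * 2 + qbit q b, j * 2 + qbit q b') * m $$ (qbit k b, qbit k b') else 0)"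
    using * by (simp add: sum_if)
  finally have L: "(emb n N q W * emb n N k (kron (1\<^sub>m n) m)) $$ (i * 2 ^ N + b, j * 2 ^ N + b') = \<dots>" .
  have "(emb n N k (kron (1\<^sub>m n) m) * emb n N q W) $$ (i * 2 ^ N + b, j * 2 ^ N + b')
    = (\<Sum>l<n. \<Sum>y<2. (if i = l then m $$ (qbit k b, y) else 0) *
        (if clear_bit q (put_bit k y b) = clear_bit q b' then W $$ (l * 2 + qbit q b, j * 2 + qbit q b') else 0))"
    using * assms by (auto simp: emb_mult_index emb_index prod_index_less m intro!: sum.cong simp del: index_mult_mat(1))
  also have "\<dots> = (\<Sum>l<n. \<Sum>y<2. if l = i then if y = qbit k b'
      then if clear_bit q (put_bit k (qbit k b') b) = clear_bit q b' then W $$ (i * 2 + qbit q b, j * 2 + qbit q b') * m $$ (qbit k b, qbit k b') else 0 else 0 else 0)"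
    by (intro sum.cong refl) (use c2 in auto)
  also have "\<dots> = (if clear_bit q (put_bit k (qbit k b') b) = clear_bit q b' then W $$ (i * 2 + qbit q b, j * 2 + qbit q b') * m $$ (qbit k b, qbit k b') else 0)"
    using * by (simp add: sum_if)
  finally show "(emb n N q W * emb n N k (kron (1\<^sub>m n) m)) $$ (i * 2 ^ N + b, j * 2 ^ N + b')
      = (emb n N k (kron (1\<^sub>m n) m) * emb n N q W) $$ (i * 2 ^ N + b, j * 2 ^ N + b')"
    unfolding L c3 by simp
qed auto

subsection \<open>Product vectors\<close>

text \<open>Kept as a one-column matrix, so that \<open>kron (1\<^sub>m n) (prod_ket N f)\<close> is
  the map adjoining the register and preparation becomes a factor in a matrix product.\<close>

definition prod_ket :: "nat \<Rightarrow> (nat \<Rightarrow> complex vec) \<Rightarrow> complex mat" where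
  "prod_ket N f = mat (2 ^ N) 1 (\<lambda>(b, _). \<Prod>q<N. f q $ qbit q b)"

lemma prod_ket_dim [simp]: "dim_row (prod_ket N f) = 2 ^ N" "dim_col (prod_ket N f) = 1"
  by (auto simp: prod_ket_def)

lemma prod_ket_index [simp]: "b < 2 ^ N \<Longrightarrow> prod_ket N f $$ (b, 0) = (\<Prod>q<N. f q $ qbit q b)"
  by (simp add: prod_ket_def)

lemma emb_prod_ket:
  assumes "k < N" "dim_row m = 2" "dim_col m = 2" "dim_vec (f k) = 2"
  shows "emb n N k (kron (1\<^sub>m n) m) * kron (1\<^sub>m n) (prod_ket N f) = kron (1\<^sub>m n) (prod_ket N (f(k := m *\<^sub>v f k)))"
proof (rule eq_mat_prodI[of _ n "2 ^ N" _ n 1])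
  fix i b j y :: nat assume *: "i < n" "b < 2 ^ N" "j < n" "y < (1::nat)"
  have m: "kron (1\<^sub>m n) m $$ (i * 2 + x, j * 2 + y) = (if i = j then m $$ (x, y) else 0)"
    if "i < n" "j < n" "x < 2" "y < 2" for i j x y
    using kron_one_index[of i n j x m y] that assms by simp
  have p: "kron (1\<^sub>m n) (prod_ket N f) $$ (i * 2 ^ N + b, j) = (if i = j then \<Prod>q<N. f q $ qbit q b else 0)"
    if "i < n" "j < n" "b < 2 ^ N" for i j b f
    using kron_one_index[of i n j b "prod_ket N f" 0] that by simp
  have pr: "(\<Prod>q<N. g q) = g k * (\<Prod>q\<in>{..<N} - {k}. g q)" for g :: "nat \<Rightarrow> complex"
    using assms(1) by (simp add: prod.remove)
  have "(emb n N k (kron (1\<^sub>m n) m) * kron (1\<^sub>m n) (prod_ket N f)) $$ (i * 2 ^ N + b, j)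
    = (\<Sum>l<n. \<Sum>x<2. if l = i then if i = j then m $$ (qbit k b, x) * (\<Prod>q<N. f q $ qbit q (put_bit k x b)) else 0 else 0)"
    using * assms by (auto simp: emb_mult_index prod_index_less m p intro!: sum.cong simp del: index_mult_mat(1))
  also have "\<dots> = (if i = j then \<Sum>x<2. m $$ (qbit k b, x) * (\<Prod>q<N. f q $ qbit q (put_bit k x b)) else 0)"
    using * by (simp add: sum_if)
  also have "(\<Sum>x<2. m $$ (qbit k b, x) * (\<Prod>q<N. f q $ qbit q (put_bit k x b)))
     = (\<Sum>x<2. m $$ (qbit k b, x) * f k $ x) * (\<Prod>q\<in>{..<N} - {k}. f q $ qbit q b)"
    unfolding sum_distrib_right by (intro sum.cong) (auto simp: pr intro!: prod.cong)
  also have "(\<Sum>x<2. m $$ (qbit k b, x) * f k $ x) = (m *\<^sub>v f k) $ qbit k b"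
    using assms by (simp add: mult_vec_index del: index_mult_mat_vec)
  also have "\<dots> * (\<Prod>q\<in>{..<N} - {k}. f q $ qbit q b) = (\<Prod>q<N. (f(k := m *\<^sub>v f k)) q $ qbit q b)"
    by (auto simp: pr simp del: index_mult_mat_vec intro!: prod.cong)
  finally show "(emb n N k (kron (1\<^sub>m n) m) * kron (1\<^sub>m n) (prod_ket N f)) $$ (i * 2 ^ N + b, j * 1 + y)
      = kron (1\<^sub>m n) (prod_ket N (f(k := m *\<^sub>v f k))) $$ (i * 2 ^ N + b, j * 1 + y)"
    using * p by simp
qed auto

lemma qbit_top: "b < 2 ^ N \<Longrightarrow> x < 2 \<Longrightarrow> qbit N (x * 2 ^ N + b) = x"
  by (simp add: qbit_def)

lemma qbit_low: "q < N \<Longrightarrow> qbit q (x * 2 ^ N + b) = qbit q b"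
proof -
  assume "q < N"
  then obtain d where d: "N = q + Suc d" using less_iff_Suc_add by auto
  have "x * 2 ^ N + b = b + (x * 2 ^ d * 2) * 2 ^ q" by (simp add: d power_add mult_ac)
  then have "(x * 2 ^ N + b) div 2 ^ q = x * 2 ^ d * 2 + b div 2 ^ q"
    by (simp only: div_mult_self1 power_not_zero zero_neq_numeral not_False_eq_True)
  then show ?thesis by (simp add: qbit_def mod_mult_self4)
qed

lemma prod_ket_norm:
  assumes "\<And>q. q < N \<Longrightarrow> (\<Sum>x<2. (cmod (f q $ x))\<^sup>2) = 1"
  shows "mat_adjoint (prod_ket N f) * prod_ket N f = 1\<^sub>m 1"
proof -
  have "(\<Sum>b<2 ^ N. (cmod (\<Prod>q<N. f q $ qbit q b))\<^sup>2) = 1"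
    using assms
  proof (induction N)
    case (Suc N)
    have "(\<Sum>b<2 ^ Suc N. (cmod (\<Prod>q<Suc N. f q $ qbit q b))\<^sup>2)
      = (\<Sum>x<2. \<Sum>b<2 ^ N. (cmod (f N $ x))\<^sup>2 * (cmod (\<Prod>q<N. f q $ qbit q b))\<^sup>2)"
      unfolding power_Suc sum_prod_index
      by (intro sum.cong refl) (auto simp: qbit_top qbit_low norm_mult power_mult_distrib mult.commute)
    also have "\<dots> = (\<Sum>x<2. (cmod (f N $ x))\<^sup>2)"
      using Suc by (simp flip: sum_distrib_left)
    finally show ?case using Suc.prems by simp
  qed simp
  then have "complex_of_real (\<Sum>b<2 ^ N. (cmod (\<Prod>q<N. f q $ qbit q b))\<^sup>2) = 1" by simp
  then have "(mat_adjoint (prod_ket N f) * prod_ket N f) $$ (0, 0) = 1"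
    unfolding of_real_sum complex_norm_square by (simp add: mult_index mult.commute del: index_mult_mat(1))
  then show ?thesis by (intro eq_matI) auto
qed

text \<open>\<open>kron_pow\<close> adds each new factor on the left, which is the top bit of the
  register index; hence the split by \<open>qbit_top\<close> and \<open>qbit_low\<close>.\<close>

lemma kron_pow_outer:
  assumes "dim_vec v = 2"
  shows "kron_pow N (outer v) = prod_ket N (\<lambda>_. v) * mat_adjoint (prod_ket N (\<lambda>_. v))"
proof (induction N)
  case 0
  show ?case by (rule eq_matI) (auto simp: prod_ket_def mult_index simp del: index_mult_mat(1))
next
  case (Suc N)
  let ?k = "\<lambda>N. prod_ket N (\<lambda>_. v)"
  have o: "dim_row (outer v) = 2" "dim_col (outer v) = 2"
    "\<And>x y. x < 2 \<Longrightarrow> y < 2 \<Longrightarrow> outer v $$ (x, y) = v $ x * cnj (v $ y)"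
    using assms by (auto simp: outer_def)
  have ent: "(?k M * mat_adjoint (?k M)) $$ (b, c) = (\<Prod>q<M. v $ qbit q b) * cnj (\<Prod>q<M. v $ qbit q c)"
    if "b < 2 ^ M" "c < 2 ^ M" for b c M
    using that by (simp add: mult_index del: index_mult_mat(1) cnj_prod)
  show ?case
  proof (rule eq_mat_prodI[of _ 2 "2 ^ N" _ 2 "2 ^ N"])
    fix x b y c :: nat assume *: "x < (2::nat)" "b < 2 ^ N" "y < (2::nat)" "c < 2 ^ N"
    have "kron_pow (Suc N) (outer v) $$ (x * 2 ^ N + b, y * 2 ^ N + c)
      = v $ x * cnj (v $ y) * ((\<Prod>q<N. v $ qbit q b) * cnj (\<Prod>q<N. v $ qbit q c))"
      using * assms kron_index[of x "outer v" b "?k N * mat_adjoint (?k N)" y c]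
      by (simp add: Suc ent o del: index_mult_mat(1) cnj_prod)
    also have "\<dots> = (?k (Suc N) * mat_adjoint (?k (Suc N))) $$ (x * 2 ^ N + b, y * 2 ^ N + c)"
      using * prod_index_less[of x 2 b "2 ^ N"] prod_index_less[of y 2 c "2 ^ N"]
      by (simp add: ent qbit_top qbit_low mult_ac del: index_mult_mat(1) cnj_prod) 
    finally show "kron_pow (Suc N) (outer v) $$ (x * 2 ^ N + b, y * 2 ^ N + c)
      = (?k (Suc N) * mat_adjoint (?k (Suc N))) $$ (x * 2 ^ N + b, y * 2 ^ N + c)" .
  qed (use Suc o in auto)
qed

subsection \<open>The minus state\<close>

definition minus_col :: "complex mat" where
  "minus_col = mat 2 1 (\<lambda>(i, _). ket_minus $ i)"

lemma minus_col_dim [simp]: "dim_row minus_col = 2" "dim_col minus_col = 1"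
  by (auto simp: minus_col_def)

lemma ket_minus_dim [simp]: "dim_vec ket_minus = 2"
  by (simp add: ket_minus_def)

lemma outer_dim [simp]: "dim_row (outer v) = dim_vec v" "dim_col (outer v) = dim_vec v"
  by (auto simp: outer_def)

lemma outer_index [simp]: "i < dim_vec v \<Longrightarrow> j < dim_vec v \<Longrightarrow> outer v $$ (i, j) = v $ i * cnj (v $ j)"
  by (auto simp: outer_def)

lemma adjoint_outer [simp]: "mat_adjoint (outer v) = outer v"
  by (intro eq_matI) auto

lemma outer_minus: "outer ket_minus = minus_col * mat_adjoint minus_col"
  by (intro eq_matI) (auto simp: minus_col_def mult_index simp del: index_mult_mat(1))

lemma sqrt2_sq: "complex_of_real (sqrt 2) * complex_of_real (sqrt 2) = 2"
  by (simp flip: of_real_mult)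

lemma ket_minus_norm: "(\<Sum>x<2. (cmod (ket_minus $ x))\<^sup>2) = 1"
  by (simp add: ket_minus_def numeral_2_eq_2 norm_divide power_divide)

lemma outer_mult_vec:
  assumes "(\<Sum>x<dim_vec v. (cmod (v $ x))\<^sup>2) = 1"
  shows "outer v *\<^sub>v v = v"
proof (rule eq_vecI)
  fix i assume i: "i < dim_vec v"
  have "(outer v *\<^sub>v v) $ i = v $ i * (\<Sum>x<dim_vec v. complex_of_real ((cmod (v $ x))\<^sup>2))"
    using i unfolding complex_norm_square
    by (simp add: mult_vec_index sum_distrib_left mult_ac del: index_mult_mat_vec)
  then show "(outer v *\<^sub>v v) $ i = v $ i" using assms by (simp flip: of_real_sum del: of_real_power)
qed simp

lemma outer_idem:
  assumes "(\<Sum>x<dim_vec v. (cmod (v $ x))\<^sup>2) = 1"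
  shows "outer v * outer v = outer v"
proof (rule eq_matI)
  fix i j assume ij: "i < dim_row (outer v)" "j < dim_col (outer v)"
  have "(outer v * outer v) $$ (i, j) = v $ i * cnj (v $ j) * (\<Sum>x<dim_vec v. complex_of_real ((cmod (v $ x))\<^sup>2))"
    using ij unfolding complex_norm_square
    by (simp add: mult_index sum_distrib_left mult_ac del: index_mult_mat(1))
  then show "(outer v * outer v) $$ (i, j) = outer v $$ (i, j)"
    using assms ij by (simp flip: of_real_sum del: of_real_power)
qed auto

subsection \<open>Successive one-qubit interactions\<close>

fun emb_prod :: "nat \<Rightarrow> nat \<Rightarrow> (nat \<Rightarrow> complex mat) \<Rightarrow> nat \<Rightarrow> complex mat" where
  "emb_prod n N F 0 = 1\<^sub>m (n * 2 ^ N)"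
| "emb_prod n N F (Suc k) = emb n N k (F k) * emb_prod n N F k"

lemma emb_prod_dim [simp]:
  "dim_row (emb_prod n N F k) = n * 2 ^ N" "dim_col (emb_prod n N F k) = n * 2 ^ N"
  by (induction k) auto

lemma foldl_conj_emb:
  assumes "dim_row X = n * 2 ^ N" "dim_col X = n * 2 ^ N"
  shows "foldl (\<lambda>\<sigma> k. conj_by (emb n N k (F k)) \<sigma>) X [0..<m] = conj_by (emb_prod n N F m) X"
  using assms by (induction m) (simp_all add: conj_by_mult, simp add: conj_by_def)

text \<open>Each outgoing inverse is the ingoing one conjugated by the same unitary
  \<open>L\<close>. In the product all inner L\<dagger> L cancel, and the reversed order is that of
  the adjoint of \<open>emb_prod\<close>.\<close>

lemma foldl_conj_emb_rev:
  assumes "\<And>k. k < m \<Longrightarrow> emb n N k (G k) = L * mat_adjoint (emb n N k (F k)) * mat_adjoint L"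
    and L: "dim_row L = n * 2 ^ N" "dim_col L = n * 2 ^ N" "L * mat_adjoint L = 1\<^sub>m (n * 2 ^ N)" "mat_adjoint L * L = 1\<^sub>m (n * 2 ^ N)"
    and "dim_row X = n * 2 ^ N" "dim_col X = n * 2 ^ N"
  shows "foldl (\<lambda>\<sigma> k. conj_by (emb n N k (G k)) \<sigma>) X (rev [0..<m]) = conj_by (L * (mat_adjoint (emb_prod n N F m) * mat_adjoint L)) X"
  using assms(1,6,7)
proof (induction m arbitrary: X)
  case 0
  then show ?case using L by (simp add: conj_by_def)
next
  case (Suc m)
  have G: "emb n N m (G m) = L * (mat_adjoint (emb n N m (F m)) * mat_adjoint L)"
    using Suc.prems(1)[of m] L by simp
  have "foldl (\<lambda>\<sigma> k. conj_by (emb n N k (G k)) \<sigma>) X (rev [0..<Suc m])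
    = conj_by (L * (mat_adjoint (emb_prod n N F m) * mat_adjoint L)) (conj_by (emb n N m (G m)) X)"
    using Suc.IH[of "conj_by (emb n N m (G m)) X"] Suc.prems(1) L(1) by simp
  also have "\<dots> = conj_by (L * (mat_adjoint (emb_prod n N F (Suc m)) * mat_adjoint L)) X"
    using Suc.prems L by (simp add: conj_by_mult G mult_left_eq[OF L(4)])
  finally show ?case .
qed

text \<open>The hypothesis \<open>m \<le> k\<close> says that the first m interactions have not
  reached qubit k.\<close>

lemma emb_prod_comm:
  assumes "m \<le> k" "k < N" "dim_row q = 2" "dim_col q = 2"
    and "\<And>k. k < m \<Longrightarrow> F k \<in> carrier_mat (n * 2) (n * 2)"
  shows "emb_prod n N F m * emb n N k (kron (1\<^sub>m n) q) = emb n N k (kron (1\<^sub>m n) q) * emb_prod n N F m"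
  using assms
proof (induction m)
  case (Suc m)
  have "F m \<in> carrier_mat (n * 2) (n * 2)" using Suc by auto
  then have c: "emb n N m (F m) * emb n N k (kron (1\<^sub>m n) q) = emb n N k (kron (1\<^sub>m n) q) * emb n N m (F m)"
    using Suc.prems by (intro emb_comm) auto
  then show ?case using Suc by (simp add: mult_left_eq[OF c])
qed simp

text \<open>Adjoint of \<open>\<tau> \<mapsto> Tr\<^sub>a (W (\<tau> \<otimes> |-\<rangle>\<langle>-|) W\<^sup>\<dagger>)\<close>.\<close>
definition dual :: "nat \<Rightarrow> complex mat \<Rightarrow> complex mat \<Rightarrow> complex mat" where
  "dual n W X = mat_adjoint (W * kron (1\<^sub>m n) minus_col) * (kron X (1\<^sub>m 2) * (W * kron (1\<^sub>m n) minus_col))"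

lemma dual_dim [simp]: "dim_row (dual n W X) = n" "dim_col (dual n W X) = n"
  by (auto simp: dual_def)

lemma kron_sandwich:
  assumes "dim_row X = n" "dim_col X = n" "dim_col c = 1"
  shows "kron (1\<^sub>m n) c * X * mat_adjoint (kron (1\<^sub>m n) c) = kron X (c * mat_adjoint c)"
proof -
  have "kron (1\<^sub>m n) c * kron X (1\<^sub>m 1) * mat_adjoint (kron (1\<^sub>m n) c) = kron X (c * mat_adjoint c)"
    using assms by (simp only: adjoint_kron) (simp add: kron_mult del: kron_one_right)
  then show ?thesis by simp
qed

text \<open>Cyclicity of the trace moves the map W (1 \<otimes> |->) from the observable to the
  state.\<close>

lemma mtrace_dual:
  assumes "W \<in> carrier_mat (n * 2) (n * 2)" "dim_row X = n" "dim_col X = n" "dim_row \<tau> = n" "dim_col \<tau> = n"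
  shows "mtrace (dual n W X * \<tau>) = mtrace (X * ptrace_right n 2 (conj_by W (kron \<tau> (outer ket_minus))))"
proof -
  let ?j = "kron (1\<^sub>m n) minus_col"
  have [simp]: "dim_row W = n * 2" "dim_col W = n * 2" using assms by auto
  have "mtrace (dual n W X * \<tau>) = mtrace (mat_adjoint (W * ?j) * (kron X (1\<^sub>m 2) * (W * ?j) * \<tau>))"
    using assms by (simp add: dual_def)
  also have "\<dots> = mtrace (kron X (1\<^sub>m 2) * (W * ?j) * \<tau> * mat_adjoint (W * ?j))"
    using assms by (intro mtrace_comm) auto
  also have "kron X (1\<^sub>m 2) * (W * ?j) * \<tau> * mat_adjoint (W * ?j) = kron X (1\<^sub>m 2) * (W * (?j * \<tau> * mat_adjoint ?j) * mat_adjoint W)"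
    using assms by simp
  also have "?j * \<tau> * mat_adjoint ?j = kron \<tau> (outer ket_minus)"
    using assms by (subst kron_sandwich) (auto simp: outer_minus)
  also have "W * kron \<tau> (outer ket_minus) * mat_adjoint W = conj_by W (kron \<tau> (outer ket_minus))"
    by (simp add: conj_by_def)
  finally show ?thesis using assms by (subst mtrace_ptrace_right) auto
qed

text \<open>Qubit m is still in |-> after the first m interactions, so the projection
  \<open>Q\<close> onto this state fixes \<open>K\<close> and can be inserted on both sides of the
  operator pulled back through \<open>W\<close>. Between two copies of \<open>Q\<close> only the |->
  expectation on qubit m survives, which is \<open>dual n W X\<close>.\<close>

lemma heisenberg_step:
  assumes "m < N" "\<And>k. k < m \<Longrightarrow> F k \<in> carrier_mat (n * 2) (n * 2)" "f m = ket_minus"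
    and W: "W \<in> carrier_mat (n * 2) (n * 2)" and X: "dim_row X = n" "dim_col X = n"
  defines "K \<equiv> emb_prod n N F m * kron (1\<^sub>m n) (prod_ket N f)"
  shows "mat_adjoint (emb n N m W * K) * (kron X (1\<^sub>m (2 ^ N)) * (emb n N m W * K))
    = mat_adjoint K * (kron (dual n W X) (1\<^sub>m (2 ^ N)) * K)"
proof -
  have [simp]: "dim_row W = n * 2" "dim_col W = n * 2" using W by auto
  have [simp]: "dim_row K = n * 2 ^ N" "dim_col K = n" by (auto simp: K_def)
  let ?q = "kron (1\<^sub>m n) (outer ket_minus)" and ?j = "kron (1\<^sub>m n) minus_col"
  define Q where "Q = emb n N m ?q"
  define Y where "Y = mat_adjoint W * (kron X (1\<^sub>m 2) * W)"
  have [simp]: "dim_row Q = n * 2 ^ N" "dim_col Q = n * 2 ^ N" "dim_row Y = n * 2" "dim_col Y = n * 2"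
    by (auto simp: Q_def Y_def)
  have adjQ: "mat_adjoint Q = Q" using assms(1) by (simp add: Q_def)
  have "f(m := outer ket_minus *\<^sub>v f m) = f"
    using assms(3) ket_minus_norm by (auto simp: outer_mult_vec)
  then have "Q * kron (1\<^sub>m n) (prod_ket N f) = kron (1\<^sub>m n) (prod_ket N f)"
    unfolding Q_def using assms(1,3) by (subst emb_prod_ket) auto
  moreover have "emb_prod n N F m * Q = Q * emb_prod n N F m"
    unfolding Q_def using assms(1,2) by (intro emb_prod_comm) auto
  ultimately have QK: "Q * K = K"
    unfolding K_def by (metis mult_assoc_dim emb_prod_dim \<open>dim_row Q = _\<close> \<open>dim_col Q = _\<close> kron_dim(1) index_one_mat(2) prod_ket_dim(1))
  have KQ: "mat_adjoint K * Q = mat_adjoint K"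
    using arg_cong[OF QK, of mat_adjoint] by (simp add: adjQ)
  have qYq: "?q * (Y * ?q) = kron (dual n W X) (1\<^sub>m 2) * ?q"
  proof -
    have q: "?q = ?j * mat_adjoint ?j" by (simp add: outer_minus kron_mult)
    have "?q * (Y * ?q) = ?j * dual n W X * mat_adjoint ?j"
      unfolding q using X by (simp add: dual_def Y_def del: adjoint_kron)
    also have "\<dots> = kron (dual n W X) (minus_col * mat_adjoint minus_col)"
      by (subst kron_sandwich) auto
    also have "\<dots> = kron (dual n W X) (1\<^sub>m 2) * ?q"
      by (simp add: kron_mult outer_minus)
    finally show ?thesis .
  qed
  have "mat_adjoint (emb n N m W * K) * (kron X (1\<^sub>m (2 ^ N)) * (emb n N m W * K))
    = mat_adjoint K * (mat_adjoint (emb n N m W) * (emb n N m (kron X (1\<^sub>m 2)) * emb n N m W)) * K"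
    using assms(1) X by (simp add: emb_kron_one)
  also have "mat_adjoint (emb n N m W) * (emb n N m (kron X (1\<^sub>m 2)) * emb n N m W) = emb n N m Y"
    using assms(1) X by (simp add: emb_mult Y_def)
  also have "mat_adjoint K * emb n N m Y * K = mat_adjoint K * Q * emb n N m Y * (Q * K)"
    unfolding KQ QK ..
  also have "\<dots> = mat_adjoint K * ((Q * (emb n N m Y * Q)) * K)"
    by simp
  also have "Q * (emb n N m Y * Q) = emb n N m (kron (dual n W X) (1\<^sub>m 2)) * Q"
    using assms(1) by (simp add: Q_def emb_mult qYq del: mult_assoc_dim)
  also have "\<dots> * K = kron (dual n W X) (1\<^sub>m (2 ^ N)) * K"
    using assms(1) by (simp add: QK emb_kron_one)
  finally show ?thesis .
qed

text \<open>The last interaction is pulled back first, so in the \<open>foldr\<close> the dual of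
  the first interaction ends up outermost. Normalisation of the register vector settles the case
  without interactions.\<close>

lemma heisenberg:
  assumes "m \<le> N" "\<And>k. k < m \<Longrightarrow> F k \<in> carrier_mat (n * 2) (n * 2)" "\<And>k. k < m \<Longrightarrow> f k = ket_minus"
    and "\<And>k. k < N \<Longrightarrow> (\<Sum>x<2. (cmod (f k $ x))\<^sup>2) = 1"
    and "dim_row X = n" "dim_col X = n"
  defines "J \<equiv> kron (1\<^sub>m n) (prod_ket N f)"
  shows "mat_adjoint (emb_prod n N F m * J) * (kron X (1\<^sub>m (2 ^ N)) * (emb_prod n N F m * J)) = foldr (\<lambda>k. dual n (F k)) [0..<m] X"
  using assms(1-3,5,6)
proof (induction m arbitrary: X)
  case 0
  have "mat_adjoint J * (kron X (1\<^sub>m (2 ^ N)) * J) = kron X (mat_adjoint (prod_ket N f) * prod_ket N f)"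
    using 0 by (simp add: J_def kron_mult)
  then show ?case using assms(4) by (simp add: prod_ket_norm J_def)
next
  case (Suc m)
  let ?K = "emb_prod n N F m * J"
  have "mat_adjoint (emb n N m (F m) * ?K) * (kron X (1\<^sub>m (2 ^ N)) * (emb n N m (F m) * ?K))
    = mat_adjoint ?K * (kron (dual n (F m) X) (1\<^sub>m (2 ^ N)) * ?K)"
    unfolding J_def using Suc.prems by (intro heisenberg_step) auto
  also have "\<dots> = foldr (\<lambda>k. dual n (F k)) [0..<m] (dual n (F m) X)"
    using Suc.prems by (intro Suc.IH) auto
  finally show ?case by (simp add: J_def)
qed

subsection \<open>The channel and its adjoint\<close>

lemma mtrace_mult_msum:
  assumes "dim_row A = n" "dim_col A = n" "\<And>x. x \<in> S \<Longrightarrow> f x \<in> carrier_mat n n"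
  shows "mtrace (A * msum n S f) = (\<Sum>x\<in>S. mtrace (A * f x))"
proof -
  have d: "dim_row (f x) = n" "dim_col (f x) = n" if "x \<in> S" for x
    using assms(3)[OF that] by auto
  have "mtrace (A * msum n S f) = (\<Sum>i<n. \<Sum>k<n. \<Sum>x\<in>S. A $$ (i, k) * f x $$ (k, i))"
    using assms by (simp add: mtrace_def mult_index sum_distrib_left del: index_mult_mat(1))
  also have "\<dots> = (\<Sum>x\<in>S. \<Sum>i<n. \<Sum>k<n. A $$ (i, k) * f x $$ (k, i))"
    by (simp only: sum.swap[of _ S])
  also have "\<dots> = (\<Sum>x\<in>S. mtrace (A * f x))"
    using assms(1,2) by (intro sum.cong) (auto simp: d mtrace_def mult_index simp del: index_mult_mat(1))
  finally show ?thesis .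
qed

lemma chanW_dim [simp]: "dim_row (chanW n \<Lambda> p Win \<tau>) = n" "dim_col (chanW n \<Lambda> p Win \<tau>) = n"
  by (auto simp: chanW_def)

section \<open>Sequences of independent labels\<close>

lemma sum_label_seqs_Suc:
  "(\<Sum>ls\<in>label_seqs \<Lambda> (Suc T). g ls) = (\<Sum>l\<in>\<Lambda>. \<Sum>ls\<in>label_seqs \<Lambda> T. g (l # ls))"
proof -
  have "label_seqs \<Lambda> (Suc T) = (\<lambda>(l, ls). l # ls) ` (\<Lambda> \<times> label_seqs \<Lambda> T)"
    by (auto simp: label_seqs_def length_Suc_conv image_iff)
  moreover have "inj_on (\<lambda>(l, ls). l # ls) (\<Lambda> \<times> label_seqs \<Lambda> T)"
    by (auto simp: inj_on_def)
  ultimately show ?thesis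
    by (simp add: sum.reindex sum.cartesian_product case_prod_unfold)
qed

lemma label_seqs_0 [simp]: "label_seqs \<Lambda> 0 = {[]}"
  by (auto simp: label_seqs_def)

lemma finite_label_seqs: "finite \<Lambda> \<Longrightarrow> finite (label_seqs \<Lambda> T)"
  unfolding label_seqs_def by (rule finite_lists_length_eq)

lemma seq_prob_Nil [simp]: "seq_prob p [] = 1"
  and seq_prob_Cons [simp]: "seq_prob p (l # ls) = p l * seq_prob p ls"
  by (auto simp: seq_prob_def)

lemma seq_prob_nonneg: "\<forall>l\<in>\<Lambda>. 0 \<le> p l \<Longrightarrow> ls \<in> label_seqs \<Lambda> T \<Longrightarrow> 0 \<le> seq_prob p ls"
  by (induction ls arbitrary: T) (auto simp: label_seqs_def)

lemma sum_seq_prob: "(\<Sum>l\<in>\<Lambda>. p l) = 1 \<Longrightarrow> (\<Sum>ls\<in>label_seqs \<Lambda> T. seq_prob p ls) = 1"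
  by (induction T) (simp_all add: sum_label_seqs_Suc flip: sum_distrib_left)

lemma foldr_dual_dim:
  "dim_row X = n \<Longrightarrow> dim_row (foldr (\<lambda>l. dual n (Win l)) ls X) = n"
  "dim_col X = n \<Longrightarrow> dim_col (foldr (\<lambda>l. dual n (Win l)) ls X) = n"
  by (induction ls) auto

text \<open>The dual of the first label is outermost, so trace duality moves it onto \<rho> and
  leaves the remaining labels; this is why the induction varies \<rho>. The weights factorise, hence
  summing over the first label applies the channel once.\<close>

lemma mtrace_dual_label_seqs:
  assumes "\<forall>l\<in>\<Lambda>. Win l \<in> carrier_mat (n * 2) (n * 2)" "dim_row X = n" "dim_col X = n" "dim_row \<rho> = n" "dim_col \<rho> = n"
  shows "(\<Sum>ls\<in>label_seqs \<Lambda> T. seq_prob p ls * mtrace (foldr (\<lambda>l. dual n (Win l)) ls X * \<rho>))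
    = mtrace (X * (chanW n \<Lambda> p Win ^^ T) \<rho>)"
  using assms(4,5)
proof (induction T arbitrary: \<rho>)
  case (Suc T)
  let ?D = "\<lambda>ls. foldr (\<lambda>l. dual n (Win l)) ls X"
  have "mtrace (?D ls * chanW n \<Lambda> p Win \<rho>) = (\<Sum>l\<in>\<Lambda>. p l * mtrace (?D (l # ls) * \<rho>))" for ls
  proof -
    let ?P = "\<lambda>l. ptrace_right n 2 (conj_by (Win l) (kron \<rho> (outer ket_minus)))"
    have d: "dim_row (?D ls) = n" "dim_col (?D ls) = n" using assms by (simp_all add: foldr_dual_dim)
    have "mtrace (?D ls * chanW n \<Lambda> p Win \<rho>) = (\<Sum>l\<in>\<Lambda>. mtrace (?D ls * (complex_of_real (p l) \<cdot>\<^sub>m ?P l)))"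
      unfolding chanW_def using d by (intro mtrace_mult_msum) (auto intro!: carrier_matI)
    also have "\<dots> = (\<Sum>l\<in>\<Lambda>. p l * mtrace (?D ls * ?P l))"
    proof (intro sum.cong refl)
      fix l
      have "?D ls * (complex_of_real (p l) \<cdot>\<^sub>m ?P l) = complex_of_real (p l) \<cdot>\<^sub>m (?D ls * ?P l)"
        using d by (intro mult_smult_distrib[of _ n n _ n]) (auto intro!: carrier_matI)
      then show "mtrace (?D ls * (complex_of_real (p l) \<cdot>\<^sub>m ?P l)) = p l * mtrace (?D ls * ?P l)"
        using d by (simp add: mtrace_smult)
    qed
    also have "\<dots> = (\<Sum>l\<in>\<Lambda>. p l * mtrace (?D (l # ls) * \<rho>))"
      using assms(1) d Suc.prems by (intro sum.cong refl) (simp add: mtrace_dual)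
    finally show ?thesis .
  qed
  then have *: "(\<Sum>ls\<in>label_seqs \<Lambda> T. seq_prob p ls * (\<Sum>l\<in>\<Lambda>. p l * mtrace (?D (l # ls) * \<rho>)))
     = mtrace (X * (chanW n \<Lambda> p Win ^^ T) (chanW n \<Lambda> p Win \<rho>))"
    using Suc.IH[of "chanW n \<Lambda> p Win \<rho>"] by simp
  show ?case
    unfolding funpow_Suc_right comp_apply *[symmetric] sum_label_seqs_Suc sum_distrib_left
    by (subst sum.swap) (simp add: mult_ac)
qed simp

subsection \<open>The erasure step\<close>

lemma conj_by_carrier [simp]: "dim_row K = n \<Longrightarrow> conj_by K X \<in> carrier_mat n n"
  by (auto intro!: carrier_matI)

lemma gate_dims [simp]:
  "dim_row proj0 = 2" "dim_col proj0 = 2" "dim_row proj1 = 2" "dim_col proj1 = 2"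
  "dim_row hadamard = 2" "dim_col hadamard = 2"
  by (auto simp: proj0_def proj1_def hadamard_def)

lemma reflection_dim [simp]: "dim_vec \<phi> = n \<Longrightarrow> dim_row (reflection n \<phi>) = n" "dim_vec \<phi> = n \<Longrightarrow> dim_col (reflection n \<phi>) = n"
  by (auto simp: reflection_def)

text \<open>The operator |0><-|, which is what outcome 0 does to the control qubit up to a
  scalar.\<close>

definition flip_minus :: "complex mat" where
  "flip_minus = mat 2 2 (\<lambda>(i, j). if i = 0 then ket_minus $ j else 0)"

lemma flip_minus_dim [simp]: "dim_row flip_minus = 2" "dim_col flip_minus = 2"
  by (auto simp: flip_minus_def)

lemma cnj_ket_minus: "x < 2 \<Longrightarrow> cnj (ket_minus $ x) = ket_minus $ x"
  by (simp add: ket_minus_def)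

text \<open>After the Hadamard gate, outcome 0 tests for |+>. The coefficients here and in
  \<open>control_1\<close> are <+|0><0|-> = 1/2 and <+|1><1|-> = -1/2.\<close>

lemma control_0: "proj0 * (hadamard * (proj0 * outer ket_minus)) = (1 / 2) \<cdot>\<^sub>m flip_minus"
proof (rule eq_matI)
  fix i j assume "i < dim_row ((1 / 2) \<cdot>\<^sub>m flip_minus)" "j < dim_col ((1 / 2) \<cdot>\<^sub>m flip_minus)"
  then have ij: "i < 2" "j < 2" by auto
  have "(proj0 * (hadamard * (proj0 * outer ket_minus))) $$ (i, j)
    = (if i = 0 then 1 / (complex_of_real (sqrt 2) * complex_of_real (sqrt 2)) * ket_minus $ j else 0)"
    using ij by (auto simp: mult_index proj0_def hadamard_def numeral_2_eq_2 cnj_ket_minus ket_minus_def less_Suc_eq simp del: index_mult_mat(1))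
  then show "(proj0 * (hadamard * (proj0 * outer ket_minus))) $$ (i, j) = ((1 / 2) \<cdot>\<^sub>m flip_minus) $$ (i, j)"
    using ij by (simp add: flip_minus_def sqrt2_sq)
qed auto

lemma control_1: "proj0 * (hadamard * (proj1 * outer ket_minus)) = (- 1 / 2) \<cdot>\<^sub>m flip_minus"
proof (rule eq_matI)
  fix i j assume "i < dim_row ((- 1 / 2) \<cdot>\<^sub>m flip_minus)" "j < dim_col ((- 1 / 2) \<cdot>\<^sub>m flip_minus)"
  then have ij: "i < 2" "j < 2" by auto
  have "(proj0 * (hadamard * (proj1 * outer ket_minus))) $$ (i, j)
    = (if i = 0 then - 1 / (complex_of_real (sqrt 2) * complex_of_real (sqrt 2)) * ket_minus $ j else 0)"
    using ij by (auto simp: mult_index proj0_def proj1_def hadamard_def numeral_2_eq_2 cnj_ket_minus ket_minus_def less_Suc_eq simp del: index_mult_mat(1))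
  then show "(proj0 * (hadamard * (proj1 * outer ket_minus))) $$ (i, j) = ((- 1 / 2) \<cdot>\<^sub>m flip_minus) $$ (i, j)"
    using ij by (simp add: flip_minus_def sqrt2_sq)
qed auto

text \<open>On the control state \<open>|-\<rangle>\<close>, outcome \<open>0\<close> applies \<open>(1 - (1 - 2P)) / 2 = P\<close> to the system.\<close>
lemma controlled_reflection_outcome0:
  assumes "dim_vec \<phi> = n"
  shows "kron (1\<^sub>m n) proj0 * (kron (1\<^sub>m n) hadamard *
      ((kron (1\<^sub>m n) proj0 + kron (reflection n \<phi>) proj1) * kron (1\<^sub>m n) (outer ket_minus)))
    = kron (outer \<phi>) flip_minus"
proof -
  let ?R = "reflection n \<phi>"
  have "kron (1\<^sub>m n) proj0 * (kron (1\<^sub>m n) hadamard *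
      ((kron (1\<^sub>m n) proj0 + kron ?R proj1) * kron (1\<^sub>m n) (outer ket_minus)))
    = kron (1\<^sub>m n) ((1 / 2) \<cdot>\<^sub>m flip_minus) + kron ?R ((- 1 / 2) \<cdot>\<^sub>m flip_minus)"
    using assms
    by (simp add: add_mult_dim mult_add_dim kron_mult control_0 control_1)
  also have "\<dots> = kron (outer \<phi>) flip_minus"
  proof (rule eq_mat_prodI[of _ n 2 _ n 2])
    fix i x j y :: nat assume *: "i < n" "x < 2" "j < n" "y < 2"
    have a: "kron (1\<^sub>m n) ((1 / 2) \<cdot>\<^sub>m flip_minus) $$ (i * 2 + x, j * 2 + y) = 1 / 2 * 1\<^sub>m n $$ (i, j) * flip_minus $$ (x, y)"
      using * kron_index[of i "1\<^sub>m n" x "(1 / 2) \<cdot>\<^sub>m flip_minus" j y] by simp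
    have b: "kron ?R ((- 1 / 2) \<cdot>\<^sub>m flip_minus) $$ (i * 2 + x, j * 2 + y)
        = - 1 / 2 * (1\<^sub>m n $$ (i, j) - 2 * outer \<phi> $$ (i, j)) * flip_minus $$ (x, y)"
      using * assms kron_index[of i ?R x "(- 1 / 2) \<cdot>\<^sub>m flip_minus" j y] by (simp add: reflection_def)
    have c: "kron (outer \<phi>) flip_minus $$ (i * 2 + x, j * 2 + y) = outer \<phi> $$ (i, j) * flip_minus $$ (x, y)"
      using * assms kron_index[of i "outer \<phi>" x flip_minus j y] by simp
    have "(kron (1\<^sub>m n) ((1 / 2) \<cdot>\<^sub>m flip_minus) + kron ?R ((- 1 / 2) \<cdot>\<^sub>m flip_minus)) $$ (i * 2 + x, j * 2 + y)
      = kron (1\<^sub>m n) ((1 / 2) \<cdot>\<^sub>m flip_minus) $$ (i * 2 + x, j * 2 + y) + kron ?R ((- 1 / 2) \<cdot>\<^sub>m flip_minus) $$ (i * 2 + x, j * 2 + y)"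
      using * assms by (intro index_add_mat(1)) (auto simp: prod_index_less)
    then show "(kron (1\<^sub>m n) ((1 / 2) \<cdot>\<^sub>m flip_minus) + kron ?R ((- 1 / 2) \<cdot>\<^sub>m flip_minus)) $$ (i * 2 + x, j * 2 + y)
      = kron (outer \<phi>) flip_minus $$ (i * 2 + x, j * 2 + y)"
      unfolding a b c by (simp add: algebra_simps del: index_one_mat outer_index)
  qed (use assms in auto)
  finally show ?thesis .
qed

definition ket_zero :: "complex vec" where
  "ket_zero = vec 2 (\<lambda>i. if i = 0 then 1 else 0)"

lemma flip_minus_mult: "flip_minus *\<^sub>v ket_minus = ket_zero"
proof (rule eq_vecI)
  fix i assume "i < dim_vec ket_zero"
  then have i: "i < 2" by (simp add: ket_zero_def)
  have "(flip_minus *\<^sub>v ket_minus) $ i = (if i = 0 then (\<Sum>x<2. ket_minus $ x * cnj (ket_minus $ x)) else 0)"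
    using i by (simp add: mult_vec_index flip_minus_def cnj_ket_minus del: index_mult_mat_vec)
  also have "(\<Sum>x<2. ket_minus $ x * cnj (ket_minus $ x)) = complex_of_real (\<Sum>x<2. (cmod (ket_minus $ x))\<^sup>2)"
    unfolding of_real_sum complex_norm_square ..
  finally show "(flip_minus *\<^sub>v ket_minus) $ i = ket_zero $ i"
    using i by (simp only: ket_minus_norm) (simp add: ket_zero_def)
qed (simp add: ket_zero_def)

definition end_ket :: "nat \<Rightarrow> nat \<Rightarrow> complex vec" where
  "end_ket T = (\<lambda>_. ket_minus)(T := ket_zero)"

lemma end_ket_norm: "(\<Sum>x<2. (cmod (end_ket T k $ x))\<^sup>2) = 1"
  by (simp add: end_ket_def ket_minus_norm) (simp add: ket_zero_def numeral_2_eq_2)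

text \<open>Measuring outcome \<open>0\<close> flips the control qubit from \<open>|-\<rangle>\<close> to \<open>|0\<rangle>\<close>; as it commutes with the
  interactions, the flip is moved to the start, so the register is initialised in \<open>|-\<rangle>\<^bsup>\<otimes>T\<^esup>|0\<rangle>\<close>.\<close>
definition evolve :: "nat \<Rightarrow> nat \<Rightarrow> ('l \<Rightarrow> complex mat) \<Rightarrow> 'l list \<Rightarrow> complex mat" where
  "evolve n T Win ls = emb_prod n (T + 1) (\<lambda>k. Win (ls ! k)) T * kron (1\<^sub>m n) (prod_ket (T + 1) (end_ket T))"

lemma evolve_dim: "dim_row (evolve n T Win ls) = n * 2 ^ (T + 1)" "dim_col (evolve n T Win ls) = n"
  by (auto simp: evolve_def simp del: power_Suc)

text \<open>Absorbing the preparation of the register into one rectangular matrix makes the state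
  before the measurement a single conjugation of \<rho>.\<close>

lemma state_ii_eq:
  assumes "dim_row \<rho> = n" "dim_col \<rho> = n" "dim_vec \<phi> = n"
  shows "state_ii n T Win \<phi> ls \<rho> =
    conj_by (emb n (T + 1) T (kron (1\<^sub>m n) hadamard) * (emb n (T + 1) T (kron (1\<^sub>m n) proj0 + kron (reflection n \<phi>) proj1) *
      (emb_prod n (T + 1) (\<lambda>k. Win (ls ! k)) T * kron (1\<^sub>m n) (prod_ket (T + 1) (\<lambda>_. ket_minus))))) \<rho>"
proof -
  let ?J = "kron (1\<^sub>m n) (prod_ket (T + 1) (\<lambda>_. ket_minus))"
  have J: "kron \<rho> (kron_pow (T + 1) (outer ket_minus)) = conj_by ?J \<rho>"
    using assms by (simp only: kron_pow_outer[OF ket_minus_dim]) (simp add: conj_by_def kron_sandwich del: adjoint_kron power_Suc mult_assoc_dim)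
  show ?thesis
    unfolding state_ii_def Let_def J
    using assms by (simp add: foldl_conj_emb conj_by_mult del: power_Suc)
qed

lemma outcome0:
  assumes \<rho>: "dim_row \<rho> = n" "dim_col \<rho> = n" and \<phi>: "dim_vec \<phi> = n"
    and W: "\<forall>k<T. Win (ls ! k) \<in> carrier_mat (n * 2) (n * 2)"
  shows "conj_by (meas_proj n T proj0) (state_ii n T Win \<phi> ls \<rho>)
    = conj_by (kron (outer \<phi>) (1\<^sub>m (2 ^ (T + 1))) * evolve n T Win ls) \<rho>"
proof -
  define N where "N = T + 1"
  have T: "T < N" by (simp add: N_def)
  let ?J = "kron (1\<^sub>m n) (prod_ket N (\<lambda>_. ket_minus))"
  let ?V = "emb_prod n N (\<lambda>k. Win (ls ! k)) T"
  let ?e = "\<lambda>A. emb n N T A"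
  let ?q = "kron (1\<^sub>m n) (outer ket_minus)" and ?Rc = "kron (1\<^sub>m n) proj0 + kron (reflection n \<phi>) proj1"
  have Rc: "dim_row ?Rc = n * 2" "dim_col ?Rc = n * 2" using \<phi> by auto
  \<comment> \<open>The control starts in |->, so the projection onto |-> can be inserted.
    \<open>controlled_reflection_outcome0\<close> needs it next to the controlled reflection, and it
    gets there by commuting with the interactions.\<close>
  have "(\<lambda>_. ket_minus)(T := outer ket_minus *\<^sub>v ket_minus) = (\<lambda>_. ket_minus)"
    using ket_minus_norm by (auto simp: outer_mult_vec)
  then have QJ: "?e ?q * ?J = ?J"
    using T by (subst emb_prod_ket) auto
  have EJ: "?e (kron (1\<^sub>m n) flip_minus) * ?J = kron (1\<^sub>m n) (prod_ket N (end_ket T))"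
    using T by (subst emb_prod_ket) (auto simp: flip_minus_mult end_ket_def)
  have comm: "?V * ?e (kron (1\<^sub>m n) m) = ?e (kron (1\<^sub>m n) m) * ?V" if "dim_row m = 2" "dim_col m = 2" for m
    using T W that by (intro emb_prod_comm) auto
  have VJ: "?V * ?J = ?e ?q * (?V * ?J)"
  proof -
    have "?V * ?J = ?V * (?e ?q * ?J)" by (simp only: QJ)
    also have "\<dots> = ?e ?q * (?V * ?J)" by (subst mult_left_eq[OF comm]) auto
    finally show ?thesis .
  qed
  have "?e (kron (1\<^sub>m n) proj0) * (?e (kron (1\<^sub>m n) hadamard) * (?e ?Rc * (?V * ?J)))
    = ?e (kron (1\<^sub>m n) proj0) * (?e (kron (1\<^sub>m n) hadamard) * (?e ?Rc * (?e ?q * (?V * ?J))))"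
    by (simp only: VJ[symmetric])
  also have "\<dots> = (?e (kron (1\<^sub>m n) proj0) * (?e (kron (1\<^sub>m n) hadamard) * (?e ?Rc * ?e ?q))) * (?V * ?J)"
    by simp
  also have "?e (kron (1\<^sub>m n) proj0) * (?e (kron (1\<^sub>m n) hadamard) * (?e ?Rc * ?e ?q)) = ?e (kron (outer \<phi>) flip_minus)"
    using T Rc \<phi> by (simp add: emb_mult controlled_reflection_outcome0 del: index_add_mat)
  also have "kron (outer \<phi>) flip_minus = kron (outer \<phi>) (1\<^sub>m 2) * kron (1\<^sub>m n) flip_minus"
    using \<phi> by (simp add: kron_mult)
  also have "?e \<dots> = kron (outer \<phi>) (1\<^sub>m (2 ^ N)) * ?e (kron (1\<^sub>m n) flip_minus)"
    using T \<phi> by (simp add: emb_mult[symmetric] emb_kron_one)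
  also have "\<dots> * (?V * ?J) = kron (outer \<phi>) (1\<^sub>m (2 ^ N)) * (?e (kron (1\<^sub>m n) flip_minus) * ?V * ?J)"
    using \<phi> by simp
  also have "?e (kron (1\<^sub>m n) flip_minus) * ?V * ?J = ?V * (?e (kron (1\<^sub>m n) flip_minus) * ?J)"
    by (simp add: comm[symmetric, of flip_minus] del: mult_assoc_dim) simp
  also have "\<dots> = evolve n T Win ls"
    by (simp only: EJ) (simp only: evolve_def N_def)
  finally have K: "?e (kron (1\<^sub>m n) proj0) * (?e (kron (1\<^sub>m n) hadamard) * (?e ?Rc * (?V * ?J)))
    = kron (outer \<phi>) (1\<^sub>m (2 ^ N)) * evolve n T Win ls" .
  show ?thesis
    unfolding state_ii_eq[OF \<rho> \<phi>] meas_proj_def N_def[symmetric] K[symmetric]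
    using \<rho> by (subst conj_by_mult) auto
qed

subsection \<open>Replacing the system and undoing the interactions\<close>

lemma kron_one_right_index:
  "i < dim_row R \<Longrightarrow> k < dim_col R \<Longrightarrow> x < d \<Longrightarrow> z < d \<Longrightarrow>
    kron R (1\<^sub>m d) $$ (i * d + x, k * d + z) = (if z = x then R $$ (i, k) else 0)"
  using kron_index[of i R x "1\<^sub>m d" k z] by auto

text \<open>Conjugation by |a><b| \<otimes> 1 leaves |a><a| on the system and the block <b|X|b> on
  the register. The uses with the projection onto \<phi> and with \<open>U\<close> times it share b
  = \<phi>, hence the same register block.\<close>

lemma conj_rank_one_index:
  assumes "dim_row X = n * d" "dim_col X = n * d" "i < n" "j < n" "x < d" "y < d"
    and R: "dim_row R = n" "dim_col R = n" "\<And>i k. i < n \<Longrightarrow> k < n \<Longrightarrow> R $$ (i, k) = a i * cnj (b k)"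
  shows "conj_by (kron R (1\<^sub>m d)) X $$ (i * d + x, j * d + y)
    = a i * cnj (a j) * (\<Sum>k<n. \<Sum>l<n. cnj (b k) * X $$ (k * d + x, l * d + y) * b l)"
proof -
  have "conj_by (kron R (1\<^sub>m d)) X $$ (i * d + x, j * d + y)
    = (\<Sum>k<n. \<Sum>z<d. \<Sum>l<n. \<Sum>u<d. if u = y then if z = x then (a i * cnj (b k)) * X $$ (k * d + x, l * d + y) * cnj (a j * cnj (b l)) else 0 else 0)"
    using assms by (simp add: conj_by_index prod_index_less sum_prod_index kron_one_right_index
      if_distrib[of cnj] if_distrib[of "\<lambda>z. z * _"] if_distrib[of "\<lambda>z. _ * z"] cong: if_cong)
  also have "\<dots> = (\<Sum>k<n. \<Sum>l<n. (a i * cnj (b k)) * X $$ (k * d + x, l * d + y) * cnj (a j * cnj (b l)))"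
    using assms by (simp add: sum_if)
  finally show ?thesis by (simp add: sum_distrib_left mult_ac)
qed

text \<open>After the projection onto \<phi> the system is uncorrelated with the register.
  Discarding it and preparing U \<phi> therefore has the same effect as applying
  \<open>U\<close>.\<close>

lemma replace_system:
  assumes X: "dim_row X = n * d" "dim_col X = n * d" and U: "dim_row U = n" "dim_col U = n"
    and \<phi>: "dim_vec \<phi> = n" "(\<Sum>x<dim_vec \<phi>. (cmod (\<phi> $ x))\<^sup>2) = 1"
  defines "Y \<equiv> conj_by (kron (outer \<phi>) (1\<^sub>m d)) X"
  shows "kron (outer (U *\<^sub>v \<phi>)) (ptrace_left n d Y) = conj_by (kron U (1\<^sub>m d)) Y"
proof -
  let ?S = "\<lambda>x y. \<Sum>k<n. \<Sum>l<n. cnj (\<phi> $ k) * X $$ (k * d + x, l * d + y) * \<phi> $ l"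
  have U\<phi>: "(U * outer \<phi>) $$ (i, k) = (U *\<^sub>v \<phi>) $ i * cnj (\<phi> $ k)" if "i < n" "k < n" for i k
    using that U \<phi> by (simp add: mult_index mult_vec_index sum_distrib_left sum_distrib_right mult_ac del: index_mult_mat(1) index_mult_mat_vec)
  have "conj_by (kron U (1\<^sub>m d)) Y = conj_by (kron (U * outer \<phi>) (1\<^sub>m d)) X"
    unfolding Y_def using X U \<phi> by (subst conj_by_mult) (auto simp: kron_mult)
  moreover have "kron (outer (U *\<^sub>v \<phi>)) (ptrace_left n d Y) = conj_by (kron (U * outer \<phi>) (1\<^sub>m d)) X"
  proof (rule eq_mat_prodI[of _ n d _ n d])
    fix i x j y :: nat assume *: "i < n" "x < d" "j < n" "y < d"
    have "ptrace_left n d Y $$ (x, y) = (\<Sum>i<n. Y $$ (i * d + x, i * d + y))"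
      using * by (simp add: ptrace_left_def)
    also have "\<dots> = (\<Sum>i<n. \<phi> $ i * cnj (\<phi> $ i) * ?S x y)"
      unfolding Y_def using * X \<phi>(1)
      by (intro sum.cong refl conj_rank_one_index) (auto)
    also have "\<dots> = (\<Sum>i<n. complex_of_real ((cmod (\<phi> $ i))\<^sup>2)) * ?S x y"
      unfolding complex_norm_square sum_distrib_right ..
    also have "\<dots> = ?S x y" using \<phi> by (simp flip: of_real_sum del: of_real_power)
    finally have "ptrace_left n d Y $$ (x, y) = ?S x y" .
    moreover have "conj_by (kron (U * outer \<phi>) (1\<^sub>m d)) X $$ (i * d + x, j * d + y) = (U *\<^sub>v \<phi>) $ i * cnj ((U *\<^sub>v \<phi>) $ j) * ?S x y"
      using * X U \<phi> U\<phi> by (intro conj_rank_one_index) (auto simp del: index_mult_mat(1) index_mult_mat_vec)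
    ultimately show "kron (outer (U *\<^sub>v \<phi>)) (ptrace_left n d Y) $$ (i * d + x, j * d + y) = conj_by (kron (U * outer \<phi>) (1\<^sub>m d)) X $$ (i * d + x, j * d + y)"
      using * U kron_index[of i "outer (U *\<^sub>v \<phi>)" x "ptrace_left n d Y" j y]
      by (simp del: index_mult_mat_vec)
  qed (use U in auto)
  ultimately show ?thesis by simp
qed

text \<open>The product of the inverse outgoing interactions in the form delivered by
  \<open>foldl_conj_emb_rev\<close>, with U \<otimes> 1 as \<open>L\<close>.\<close>

definition undo :: "nat \<Rightarrow> nat \<Rightarrow> complex mat \<Rightarrow> ('l \<Rightarrow> complex mat) \<Rightarrow> 'l list \<Rightarrow> complex mat" where
  "undo n T U Win ls = kron U (1\<^sub>m (2 ^ (T + 1))) *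
    (mat_adjoint (emb_prod n (T + 1) (\<lambda>k. Win (ls ! k)) T) * mat_adjoint (kron U (1\<^sub>m (2 ^ (T + 1)))))"

lemma undo_dim:
  "dim_row U = n \<Longrightarrow> dim_row (undo n T U Win ls) = n * 2 ^ (T + 1)"
  "dim_row U = n \<Longrightarrow> dim_col (undo n T U Win ls) = n * 2 ^ (T + 1)"
  by (auto simp: undo_def simp del: power_Suc)

lemma steps_iii_iv_eq:
  assumes U: "unitary_mat n U" and W: "\<forall>k<T. Win (ls ! k) \<in> carrier_mat (n * 2) (n * 2)"
  shows "steps_iii_iv n T U Win \<phi> ls \<sigma> = ptrace_right n (2 ^ (T + 1))
    (conj_by (undo n T U Win ls) (kron (outer (U *\<^sub>v \<phi>)) (ptrace_left n (2 ^ (T + 1)) \<sigma>)))"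
proof -
  note [simp] = unitary_matD(1-3)[OF U]
  define N where "N = T + 1"
  let ?L = "kron U (1\<^sub>m (2 ^ N))"
  let ?X = "kron (outer (U *\<^sub>v \<phi>)) (ptrace_left n (2 ^ N) \<sigma>)"
  have emb_W_out: "emb n N k (mat_adjoint (W_out n U Win (ls ! k))) = ?L * mat_adjoint (emb n N k (Win (ls ! k))) * mat_adjoint ?L"
    if "k < T" for k
  proof -
    have [simp]: "dim_row (Win (ls ! k)) = n * 2" "dim_col (Win (ls ! k)) = n * 2" using W that by auto
    have k: "k < N" using that by (simp add: N_def)
    have "mat_adjoint (W_out n U Win (ls ! k)) = kron U (1\<^sub>m 2) * (mat_adjoint (Win (ls ! k)) * kron (mat_adjoint U) (1\<^sub>m 2))"
      by (simp add: W_out_def)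
    then show ?thesis
      using k by (simp add: emb_mult[symmetric] emb_kron_one)
  qed
  have L: "?L * mat_adjoint ?L = 1\<^sub>m (n * 2 ^ N)" "mat_adjoint ?L * ?L = 1\<^sub>m (n * 2 ^ N)"
    by (simp_all add: kron_mult unitary_matD(4,5)[OF U] kron_one_one)
  have "foldl (\<lambda>\<tau> k. conj_by (emb n N k (mat_adjoint (W_out n U Win (ls ! k)))) \<tau>) ?X (rev [0..<T])
    = conj_by (?L * (mat_adjoint (emb_prod n N (\<lambda>k. Win (ls ! k)) T) * mat_adjoint ?L)) ?X"
    by (rule foldl_conj_emb_rev[OF emb_W_out _ _ L]) auto
  then show ?thesis
    unfolding steps_iii_iv_def Let_def undo_def N_def[symmetric] by simp
qed

text \<open>For outcome 1 positivity is all that the argument extracts: that branch enters the first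
  bound as a positive term to be dropped.\<close>

lemma psd_steps_iii_iv:
  assumes U: "unitary_mat n U" and W: "\<forall>k<T. Win (ls ! k) \<in> carrier_mat (n * 2) (n * 2)"
    and \<sigma>: "psd (n * 2 ^ (T + 1)) \<sigma>"
  shows "psd n (steps_iii_iv n T U Win \<phi> ls \<sigma>)"
proof -
  note [simp] = unitary_matD(1-3)[OF U]
  define w where "w = U *\<^sub>v \<phi>"
  define c where "c = mat n 1 (\<lambda>(i, _). w $ i)"
  have "outer w = c * mat_adjoint c"
    by (intro eq_matI) (auto simp: c_def mult_index w_def simp del: index_mult_mat(1) index_mult_mat_vec)
  then have "psd n (outer w)" using psd_gram[of c n 1] by (simp add: c_def)
  then have "psd (n * 2 ^ (T + 1)) (kron (outer w) (ptrace_left n (2 ^ (T + 1)) \<sigma>))"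
    using psd_ptrace_left[OF \<sigma>] by (rule psd_kron)
  then have "psd (n * 2 ^ (T + 1)) (conj_by (undo n T U Win ls) (kron (outer w) (ptrace_left n (2 ^ (T + 1)) \<sigma>)))"
    by (rule psd_conj) (auto intro!: carrier_matI simp: undo_dim)
  then show ?thesis
    unfolding steps_iii_iv_eq[OF assms(1,2)] w_def[symmetric] by (rule psd_ptrace_right)
qed

text \<open>Separates the two outcomes, which \<open>E_U\<close> adds before the
  replacement.\<close>

lemma steps_iii_iv_add:
  assumes U: "unitary_mat n U" and W: "\<forall>k<T. Win (ls ! k) \<in> carrier_mat (n * 2) (n * 2)"
    and \<sigma>: "\<sigma> \<in> carrier_mat (n * 2 ^ (T + 1)) (n * 2 ^ (T + 1))" "\<tau> \<in> carrier_mat (n * 2 ^ (T + 1)) (n * 2 ^ (T + 1))"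
  shows "steps_iii_iv n T U Win \<phi> ls (\<sigma> + \<tau>) = steps_iii_iv n T U Win \<phi> ls \<sigma> + steps_iii_iv n T U Win \<phi> ls \<tau>"
proof -
  note [simp] = unitary_matD(1-3)[OF U]
  define d :: nat where "d = 2 ^ (T + 1)"
  let ?K = "undo n T U Win ls"
  let ?A = "outer (U *\<^sub>v \<phi>)"
  have [simp]: "dim_row ?K = n * d" "dim_col ?K = n * d" by (simp_all add: undo_dim d_def)
  note \<sigma> = \<sigma>[folded d_def]
  have pl: "ptrace_left n d (\<sigma> + \<tau>) = ptrace_left n d \<sigma> + ptrace_left n d \<tau>"
    using \<sigma> by (intro eq_matI) (auto simp: ptrace_left_def prod_index_less sum.distrib)
  have k: "kron ?A (X + Y) = kron ?A X + kron ?A Y" if "dim_row X = d" "dim_row Y = d" "dim_col X = d" "dim_col Y = d" for X Y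
    using that kron_index[of _ ?A _ X] kron_index[of _ ?A _ Y] kron_index[of _ ?A _ "X + Y"]
    by (intro eq_mat_prodI[of _ n d _ n d]) (auto simp: prod_index_less distrib_left simp del: index_mult_mat_vec)
  have c: "conj_by ?K (X + Y) = conj_by ?K X + conj_by ?K Y"
    if "X \<in> carrier_mat (n * d) (n * d)" "Y \<in> carrier_mat (n * d) (n * d)" for X Y
    using that
    by (auto simp: conj_by_def add_mult_dim mult_add_dim)
  have pr: "ptrace_right n d (X + Y) = ptrace_right n d X + ptrace_right n d Y"
    if "X \<in> carrier_mat (n * d) (n * d)" "Y \<in> carrier_mat (n * d) (n * d)" for X Y
    using that by (intro eq_matI) (auto simp: ptrace_right_def prod_index_less sum.distrib)
  show ?thesis
    unfolding steps_iii_iv_eq[OF assms(1,2)] d_def[symmetric] pl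
    by (subst k, simp_all, subst c) (auto simp: carrier_matI intro!: pr)
qed

text \<open>By \<open>replace_system\<close> the replacement is conjugation by U \<otimes> 1, and
  the adjoint of this factor inside \<open>undo\<close> cancels it. So V\<dagger> meets the
  projected state directly and one \<open>U\<close> remains at the far left.\<close>

lemma undo_conj:
  assumes U: "unitary_mat n U" and \<rho>: "dim_row \<rho> = n" "dim_col \<rho> = n"
    and \<phi>: "dim_vec \<phi> = n" "(\<Sum>x<dim_vec \<phi>. (cmod (\<phi> $ x))\<^sup>2) = 1"
    and W: "\<forall>k<T. Win (ls ! k) \<in> carrier_mat (n * 2) (n * 2)"
  defines "d \<equiv> 2 ^ (T + 1)"
  defines "K \<equiv> kron (outer \<phi>) (1\<^sub>m d) * evolve n T Win ls"
  shows "steps_iii_iv n T U Win \<phi> ls (conj_by K \<rho>) = ptrace_right n d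
    (conj_by (kron U (1\<^sub>m d) * (mat_adjoint (emb_prod n (T + 1) (\<lambda>k. Win (ls ! k)) T) * K)) \<rho>)"
proof -
  note [simp] = unitary_matD(1-3)[OF U]
  let ?L = "kron U (1\<^sub>m d)"
  define V where "V = emb_prod n (T + 1) (\<lambda>k. Win (ls ! k)) T"
  have [simp]: "dim_row V = n * d" "dim_col V = n * d" by (simp_all add: V_def d_def del: power_Suc)
  have [simp]: "dim_row (undo n T U Win ls) = n * d" "dim_col (undo n T U Win ls) = n * d" by (simp_all add: undo_dim d_def)
  have [simp]: "dim_row (evolve n T Win ls) = n * d" "dim_col (evolve n T Win ls) = n" by (simp_all add: evolve_dim d_def)
  have [simp]: "dim_row K = n * d" "dim_col K = n" using \<phi> by (auto simp: K_def)
  have LL: "mat_adjoint ?L * ?L = 1\<^sub>m (n * d)"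
    by (simp add: kron_mult unitary_matD(5)[OF U] kron_one_one)
  have K: "conj_by K \<rho> = conj_by (kron (outer \<phi>) (1\<^sub>m d)) (conj_by (evolve n T Win ls) \<rho>)"
    unfolding K_def using \<rho> \<phi> by (subst conj_by_mult) auto
  have "kron (outer (U *\<^sub>v \<phi>)) (ptrace_left n d (conj_by K \<rho>)) = conj_by ?L (conj_by K \<rho>)"
    unfolding K using \<phi> by (intro replace_system) auto
  also have "\<dots> = conj_by (?L * K) \<rho>"
    using \<rho> by (intro conj_by_mult) auto
  finally have r: "kron (outer (U *\<^sub>v \<phi>)) (ptrace_left n d (conj_by K \<rho>)) = conj_by (?L * K) \<rho>" .
  have "conj_by (undo n T U Win ls) (kron (outer (U *\<^sub>v \<phi>)) (ptrace_left n d (conj_by K \<rho>)))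
    = conj_by (undo n T U Win ls * (?L * K)) \<rho>"
    unfolding r using \<rho> by (subst conj_by_mult) auto
  also have "undo n T U Win ls * (?L * K) = ?L * (mat_adjoint V * K)"
    unfolding undo_def d_def[symmetric] V_def[symmetric] using mult_left_eq[OF LL, of K] by (simp del: adjoint_kron)
  finally show ?thesis
    unfolding steps_iii_iv_eq[OF U W] d_def V_def by simp
qed

subsection \<open>Averaging over the labels\<close>

text \<open>Covariance as the mean of the products minus the product of the means, for complex
  random variables.\<close>

lemma sum_weighted_deviation:
  fixes p :: "'b \<Rightarrow> real" and a b :: "'b \<Rightarrow> complex"
  assumes "(\<Sum>x\<in>S. p x) = 1"
  defines "m \<equiv> \<Sum>x\<in>S. p x * a x" and "k \<equiv> \<Sum>x\<in>S. p x * b x"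
  shows "(\<Sum>x\<in>S. p x * ((a x - m) * cnj (b x - k))) = (\<Sum>x\<in>S. p x * (a x * cnj (b x))) - m * cnj k"
proof -
  have "(\<Sum>x\<in>S. p x * ((a x - m) * cnj (b x - k)))
    = (\<Sum>x\<in>S. p x * (a x * cnj (b x)) - p x * a x * cnj k - m * cnj (p x * b x) + complex_of_real (p x) * (m * cnj k))"
    by (intro sum.cong refl) (simp add: algebra_simps)
  also have "\<dots> = (\<Sum>x\<in>S. p x * (a x * cnj (b x))) - (\<Sum>x\<in>S. p x * a x * cnj k) - (\<Sum>x\<in>S. m * cnj (p x * b x))
      + (\<Sum>x\<in>S. complex_of_real (p x) * (m * cnj k))"
    by (simp only: sum.distrib sum_subtractf)
  also have "(\<Sum>x\<in>S. p x * a x * cnj k) = m * cnj k"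
    unfolding m_def sum_distrib_right ..
  also have "(\<Sum>x\<in>S. m * cnj (p x * b x)) = m * cnj k"
    unfolding k_def cnj_sum sum_distrib_left ..
  also have "(\<Sum>x\<in>S. complex_of_real (p x) * (m * cnj k)) = m * cnj k"
    by (simp add: assms(1) flip: sum_distrib_right of_real_sum)
  finally show ?thesis by simp
qed

text \<open>Operator Jensen inequality; the gap is \<open>\<Sum>\<^sub>x p x (K x - K) \<rho> (K x - K)\<^sup>\<dagger>\<close> for the mean \<open>K\<close>.\<close>
lemma psd_msum_minus_conj_mean:
  assumes S: "finite S" "\<And>x. x \<in> S \<Longrightarrow> 0 \<le> p x" "(\<Sum>x\<in>S. p x) = 1" and \<rho>: "psd n \<rho>"
    and \<sigma>: "\<And>x. x \<in> S \<Longrightarrow> psd n (\<sigma> x - conj_by (K x) \<rho>)"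
    and dim: "\<And>x. x \<in> S \<Longrightarrow> \<sigma> x \<in> carrier_mat n n" "\<And>x. x \<in> S \<Longrightarrow> K x \<in> carrier_mat n n"
  defines "M \<equiv> msum n S (\<lambda>x. complex_of_real (p x) \<cdot>\<^sub>m K x)"
  shows "psd n (msum n S (\<lambda>x. complex_of_real (p x) \<cdot>\<^sub>m \<sigma> x) - conj_by M \<rho>)"
proof -
  note [simp] = psdD(1-4)[OF \<rho>]
  have d: "dim_row (\<sigma> x) = n" "dim_col (\<sigma> x) = n" "dim_row (K x) = n" "dim_col (K x) = n" if "x \<in> S" for x
    using dim that by auto
  have [simp]: "dim_row M = n" "dim_col M = n" by (auto simp: M_def)
  \<comment> \<open>The gap splits into the averaged slack of the hypothesis, \<open>?A\<close>, and
    the covariance of the Kraus operators, \<open>?B\<close>.\<close>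
  let ?A = "msum n S (\<lambda>x. complex_of_real (p x) \<cdot>\<^sub>m (\<sigma> x - conj_by (K x) \<rho>))"
  let ?B = "msum n S (\<lambda>x. complex_of_real (p x) \<cdot>\<^sub>m conj_by (K x - M) \<rho>)"
  have "msum n S (\<lambda>x. complex_of_real (p x) \<cdot>\<^sub>m \<sigma> x) - conj_by M \<rho> = ?A + ?B"
  proof (rule eq_matI)
    fix i j assume "i < dim_row (?A + ?B)" "j < dim_col (?A + ?B)"
    then have ij: "i < n" "j < n" by auto
    have Mi: "M $$ (i, k) = (\<Sum>x\<in>S. p x * K x $$ (i, k))" if "i < n" "k < n" for i k
      using that by (auto simp: M_def d intro!: sum.cong)
    have wd: "(\<Sum>x\<in>S. p x * ((K x $$ (i, k) - M $$ (i, k)) * cnj (K x $$ (j, m) - M $$ (j, m))))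
      = (\<Sum>x\<in>S. p x * (K x $$ (i, k) * cnj (K x $$ (j, m)))) - M $$ (i, k) * cnj (M $$ (j, m))" if "k < n" "m < n" for k m
      unfolding Mi[OF ij(1) that(1)] Mi[OF ij(2) that(2)] by (rule sum_weighted_deviation[OF S(3)])
    have "?B $$ (i, j) = (\<Sum>x\<in>S. \<Sum>k<n. \<Sum>m<n. \<rho> $$ (k, m) * (p x * ((K x $$ (i, k) - M $$ (i, k)) * cnj (K x $$ (j, m) - M $$ (j, m)))))"
      using ij by (auto simp: conj_by_index d sum_distrib_left mult_ac intro!: sum.cong)
    also have "\<dots> = (\<Sum>k<n. \<Sum>m<n. \<rho> $$ (k, m) * (\<Sum>x\<in>S. p x * ((K x $$ (i, k) - M $$ (i, k)) * cnj (K x $$ (j, m) - M $$ (j, m)))))"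
      by (simp only: sum.swap[of _ S] sum_distrib_left)
    also have "\<dots> = (\<Sum>k<n. \<Sum>m<n. \<rho> $$ (k, m) * ((\<Sum>x\<in>S. p x * (K x $$ (i, k) * cnj (K x $$ (j, m)))) - M $$ (i, k) * cnj (M $$ (j, m))))"
      by (intro sum.cong refl) (simp only: wd lessThan_iff)
    also have "\<dots> = (\<Sum>k<n. \<Sum>m<n. \<Sum>x\<in>S. p x * (K x $$ (i, k) * \<rho> $$ (k, m) * cnj (K x $$ (j, m)))) - conj_by M \<rho> $$ (i, j)"
      using ij by (simp add: conj_by_index right_diff_distrib sum_subtractf sum_distrib_left mult_ac)
    also have "(\<Sum>k<n. \<Sum>m<n. \<Sum>x\<in>S. p x * (K x $$ (i, k) * \<rho> $$ (k, m) * cnj (K x $$ (j, m))))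
      = (\<Sum>x\<in>S. \<Sum>k<n. \<Sum>m<n. p x * (K x $$ (i, k) * \<rho> $$ (k, m) * cnj (K x $$ (j, m))))"
      by (simp only: sum.swap[of _ S])
    also have "\<dots> = (\<Sum>x\<in>S. p x * conj_by (K x) \<rho> $$ (i, j))"
      using ij by (auto simp: conj_by_index d sum_distrib_left intro!: sum.cong)
    finally have B: "?B $$ (i, j) = (\<Sum>x\<in>S. p x * conj_by (K x) \<rho> $$ (i, j)) - conj_by M \<rho> $$ (i, j)" .
    have A: "?A $$ (i, j) = (\<Sum>x\<in>S. p x * \<sigma> x $$ (i, j)) - (\<Sum>x\<in>S. p x * conj_by (K x) \<rho> $$ (i, j))"
      using ij by (auto simp: d right_diff_distrib simp flip: sum_subtractf intro!: sum.cong)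
    have "(?A + ?B) $$ (i, j) = ?A $$ (i, j) + ?B $$ (i, j)" using ij by simp
    also have "\<dots> = (\<Sum>x\<in>S. p x * \<sigma> x $$ (i, j)) - conj_by M \<rho> $$ (i, j)" unfolding A B by simp
    also have "\<dots> = (msum n S (\<lambda>x. complex_of_real (p x) \<cdot>\<^sub>m \<sigma> x) - conj_by M \<rho>) $$ (i, j)"
      using ij by (auto simp: d intro!: sum.cong)
    finally show "(msum n S (\<lambda>x. complex_of_real (p x) \<cdot>\<^sub>m \<sigma> x) - conj_by M \<rho>) $$ (i, j) = (?A + ?B) $$ (i, j)" by simp
  qed auto
  moreover have "psd n ?A" using S \<sigma> by (intro psd_msum psd_smult) auto
  moreover have "psd n ?B" using S d by (intro psd_msum psd_smult psd_conj[OF \<rho>]) (auto intro!: carrier_matI)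
  ultimately show ?thesis using psd_add by simp
qed

section \<open>One label sequence: domination and outcome probability\<close>

lemma unit_vec_norm:
  assumes "is_unit_vec n \<phi>"
  shows "dim_vec \<phi> = n" "(\<Sum>x<dim_vec \<phi>. (cmod (\<phi> $ x))\<^sup>2) = 1"
proof -
  have "complex_of_real (\<Sum>x<dim_vec \<phi>. (cmod (\<phi> $ x))\<^sup>2) = complex_of_real 1"
    using assms unfolding is_unit_vec_def cscalar_self[symmetric] by simp
  then show "(\<Sum>x<dim_vec \<phi>. (cmod (\<phi> $ x))\<^sup>2) = 1" by (simp only: of_real_eq_iff)
  show "dim_vec \<phi> = n" using assms by (simp add: is_unit_vec_def)
qed

text \<open>The operator M of one label sequence, already in Heisenberg form.\<close>

abbreviation overlap :: "nat \<Rightarrow> ('l \<Rightarrow> complex mat) \<Rightarrow> complex vec \<Rightarrow> 'l list \<Rightarrow> complex mat" where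
  "overlap n Win \<phi> ls \<equiv> foldr (\<lambda>l. dual n (Win l)) ls (outer \<phi>)"

text \<open>\<open>end_ket T\<close> differs from |-> only at position T, the control, which no
  interaction reaches; so the pull-back through the ancillas applies.\<close>

lemma evolve_overlap:
  assumes "length ls = T" "\<forall>k<T. Win (ls ! k) \<in> carrier_mat (n * 2) (n * 2)" "dim_vec \<phi> = n"
  shows "mat_adjoint (evolve n T Win ls) * (kron (outer \<phi>) (1\<^sub>m (2 ^ (T + 1))) * evolve n T Win ls) = overlap n Win \<phi> ls"
proof -
  have "mat_adjoint (evolve n T Win ls) * (kron (outer \<phi>) (1\<^sub>m (2 ^ (T + 1))) * evolve n T Win ls)
    = foldr (\<lambda>k. dual n (Win (ls ! k))) [0..<T] (outer \<phi>)"
    unfolding evolve_def using assms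
    by (intro heisenberg) (auto simp: end_ket_norm, simp add: end_ket_def)
  also have "\<dots> = overlap n Win \<phi> (map ((!) ls) [0..<T])"
    by (simp add: foldr_map comp_def)
  also have "map ((!) ls) [0..<T] = ls"
    using map_nth[of ls] assms(1) by simp
  finally show ?thesis .
qed

text \<open>The row w\<dagger> acts on the register alone, so it passes \<open>U\<close> and
  combines with V\<dagger> to the adjoint of \<open>evolve\<close>. This turns the compressed Kraus
  operator into \<open>U\<close> times the overlap, and \<open>psd_ptrace_right_minus\<close>
  accounts for the rest of the register.\<close>

lemma post_state0_branch_ge:
  assumes U: "unitary_mat n U" and \<rho>: "psd n \<rho>"
    and \<phi>: "dim_vec \<phi> = n" "(\<Sum>x<dim_vec \<phi>. (cmod (\<phi> $ x))\<^sup>2) = 1"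
    and ls: "length ls = T" and W: "\<forall>k<T. Win (ls ! k) \<in> carrier_mat (n * 2) (n * 2)"
  shows "psd n (steps_iii_iv n T U Win \<phi> ls (conj_by (kron (outer \<phi>) (1\<^sub>m (2 ^ (T + 1))) * evolve n T Win ls) \<rho>)
    - conj_by (U * overlap n Win \<phi> ls) \<rho>)"
proof -
  note [simp] = unitary_matD(1-3)[OF U] psdD(1-4)[OF \<rho>]
  define d :: nat where "d = 2 ^ (T + 1)"
  define w where "w = prod_ket (T + 1) (end_ket T)"
  define V where "V = emb_prod n (T + 1) (\<lambda>k. Win (ls ! k)) T"
  define K where "K = kron (outer \<phi>) (1\<^sub>m d) * evolve n T Win ls"
  have [simp]: "dim_row V = n * d" "dim_col V = n * d" "dim_row w = d" "dim_col w = 1"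
    by (simp_all add: V_def w_def d_def del: power_Suc)
  have [simp]: "dim_row K = n * d" "dim_col K = n" using \<phi> by (auto simp: K_def evolve_dim)
  let ?L = "kron U (1\<^sub>m d)"
  define X where "X = conj_by (?L * (mat_adjoint V * K)) \<rho>"
  have X: "psd (n * d) X"
    unfolding X_def by (rule psd_conj[OF \<rho>]) (auto intro!: carrier_matI)
  have w: "w \<in> carrier_mat d 1" "mat_adjoint w * w = 1\<^sub>m 1"
    by (simp add: carrier_matI) (simp only: w_def prod_ket_norm end_ket_norm)
  have "kron (1\<^sub>m n) (mat_adjoint w) * ?L = U * kron (1\<^sub>m n) (mat_adjoint w)"
  proof -
    have "U * kron (1\<^sub>m n) (mat_adjoint w) = kron U (1\<^sub>m (Suc 0)) * kron (1\<^sub>m n) (mat_adjoint w)" by simp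
    also have "\<dots> = kron (1\<^sub>m n) (mat_adjoint w) * ?L" by (simp add: kron_mult del: kron_one_right)
    finally show ?thesis ..
  qed
  from mult_left_eq[OF this, of "mat_adjoint V * K"]
  have "kron (1\<^sub>m n) (mat_adjoint w) * (?L * (mat_adjoint V * K)) = U * (kron (1\<^sub>m n) (mat_adjoint w) * (mat_adjoint V * K))"
    by simp
  also have "kron (1\<^sub>m n) (mat_adjoint w) * (mat_adjoint V * K) = mat_adjoint (evolve n T Win ls) * K"
    unfolding evolve_def w_def[symmetric] V_def[symmetric] by simp
  also have "\<dots> = overlap n Win \<phi> ls"
    unfolding K_def d_def using ls W \<phi> by (intro evolve_overlap)
  finally have "conj_by (kron (1\<^sub>m n) (mat_adjoint w)) X = conj_by (U * overlap n Win \<phi> ls) \<rho>"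
    unfolding X_def by (subst conj_by_mult) auto
  moreover have "steps_iii_iv n T U Win \<phi> ls (conj_by K \<rho>) = ptrace_right n d X"
    unfolding X_def V_def K_def d_def using U \<phi> W by (intro undo_conj) auto
  ultimately show ?thesis
    using psd_ptrace_right_minus[OF X w] by (simp add: K_def d_def)
qed

text \<open>Since the projection onto \<phi> is idempotent, cycling the trace removes one of its two
  copies. The operator that appears in the Kraus operator of \<open>post_state0_branch_ge\<close> is
  thereby also the effect of outcome 0.\<close>

lemma mtrace_outcome0:
  assumes \<rho>: "dim_row \<rho> = n" "dim_col \<rho> = n"
    and \<phi>: "dim_vec \<phi> = n" "(\<Sum>x<dim_vec \<phi>. (cmod (\<phi> $ x))\<^sup>2) = 1"
    and ls: "length ls = T" and W: "\<forall>k<T. Win (ls ! k) \<in> carrier_mat (n * 2) (n * 2)"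
  shows "mtrace (conj_by (kron (outer \<phi>) (1\<^sub>m (2 ^ (T + 1))) * evolve n T Win ls) \<rho>) = mtrace (overlap n Win \<phi> ls * \<rho>)"
proof -
  define d :: nat where "d = 2 ^ (T + 1)"
  let ?P = "kron (outer \<phi>) (1\<^sub>m d)" and ?E = "evolve n T Win ls"
  have [simp]: "dim_row ?E = n * d" "dim_col ?E = n" by (simp_all add: evolve_dim d_def)
  have "mat_adjoint ?P * ?P = ?P" using \<phi> by (simp add: kron_mult outer_idem)
  from mult_left_eq[OF this, of ?E]
  have P: "mat_adjoint ?P * (?P * ?E) = ?P * ?E" using \<phi> by simp
  have "mtrace (conj_by (?P * ?E) \<rho>) = mtrace (mat_adjoint (?P * ?E) * (?P * ?E * \<rho>))"
    unfolding conj_by_def using \<rho> \<phi> by (intro mtrace_comm) auto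
  also have "mat_adjoint (?P * ?E) * (?P * ?E * \<rho>) = mat_adjoint ?E * (mat_adjoint ?P * (?P * ?E)) * \<rho>"
    using \<rho> \<phi> by simp
  also have "\<dots> = overlap n Win \<phi> ls * \<rho>"
    by (simp only: P evolve_overlap[OF ls W \<phi>(1), folded d_def])
  finally show ?thesis by (simp add: d_def)
qed

section \<open>Both fidelity bounds for the averaged output\<close>

theorem theorem1:
  fixes n T :: nat and \<Lambda> :: "'l set" and p :: "'l \<Rightarrow> real"
    and U :: "complex mat" and Win :: "'l \<Rightarrow> complex mat" and \<phi>in :: "complex vec"
  assumes "n \<ge> 1"
    and "unitary_mat n U"
    and "finite \<Lambda>" and "\<forall>l\<in>\<Lambda>. 0 \<le> p l" and "(\<Sum>l\<in>\<Lambda>. p l) = 1"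
    and "\<forall>l\<in>\<Lambda>. unitary_mat (n * 2) (Win l)"
    and "is_unit_vec n \<phi>in"
    and "T \<ge> 1"
  shows "\<forall>\<rho>. density n \<rho> \<longrightarrow>
           prob_outcome0 n T \<Lambda> p Win \<phi>in \<rho> = p_erase n T \<Lambda> p Win \<phi>in \<rho>
         \<and> fidelity (E_U n T \<Lambda> p U Win \<phi>in \<rho>) (U * \<rho> * mat_adjoint U) \<ge> p_erase n T \<Lambda> p Win \<phi>in \<rho>
         \<and> (pure_state n \<rho> \<longrightarrow>
              fidelity (post_state0 n T \<Lambda> p U Win \<phi>in \<rho>) (U * \<rho> * mat_adjoint U)
                \<ge> sqrt (p_erase n T \<Lambda> p Win \<phi>in \<rho>))"
proof (intro allI impI)
  fix \<rho> assume "density n \<rho>"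
  then have \<rho>: "psd n \<rho>" by (simp add: density_def)
  note U = assms(2) and \<phi> = unit_vec_norm[OF assms(7)]
  note [simp] = unitary_matD(1-3)[OF U] psdD(1-4)[OF \<rho>]
  have W: "\<forall>l\<in>\<Lambda>. Win l \<in> carrier_mat (n * 2) (n * 2)" using assms(6) by (auto simp: unitary_mat_def)
  define S where "S = label_seqs \<Lambda> T"
  have len: "length ls = T" and WS: "\<forall>k<T. Win (ls ! k) \<in> carrier_mat (n * 2) (n * 2)" if "ls \<in> S" for ls
    using that W nth_mem[of _ ls] unfolding S_def label_seqs_def by blast+
  have S: "finite S" "\<And>ls. ls \<in> S \<Longrightarrow> 0 \<le> seq_prob p ls" "(\<Sum>ls\<in>S. seq_prob p ls) = 1"
    unfolding S_def using assms(3-5) by (auto intro: finite_label_seqs seq_prob_nonneg sum_seq_prob)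
  let ?M = "\<lambda>ls. overlap n Win \<phi>in ls"
  have dimM: "dim_row (?M ls) = n" "dim_col (?M ls) = n" for ls using \<phi> by (simp_all add: foldr_dual_dim)
  let ?s0 = "\<lambda>ls. conj_by (meas_proj n T proj0) (state_ii n T Win \<phi>in ls \<rho>)"
  let ?s1 = "\<lambda>ls. conj_by (meas_proj n T proj1) (state_ii n T Win \<phi>in ls \<rho>)"
  let ?st = "steps_iii_iv n T U Win \<phi>in"
  let ?pe = "p_erase n T \<Lambda> p Win \<phi>in \<rho>"
  have s0: "?s0 ls = conj_by (kron (outer \<phi>in) (1\<^sub>m (2 ^ (T + 1))) * evolve n T Win ls) \<rho>" if "ls \<in> S" for ls
    using WS[OF that] \<phi> by (intro outcome0) auto
  have psd_state: "psd (n * 2 ^ (T + 1)) (conj_by (meas_proj n T m) (state_ii n T Win \<phi>in ls \<rho>))" for m ls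
    unfolding state_ii_eq[OF psdD(3,4)[OF \<rho>] \<phi>(1)]
    by (intro psd_conj[OF psd_conj[OF \<rho>]]) (auto intro!: carrier_matI simp: meas_proj_def)
  have sum_tr: "(\<Sum>ls\<in>S. seq_prob p ls * mtrace (?M ls * \<rho>)) = mtrace (outer \<phi>in * (chanW n \<Lambda> p Win ^^ T) \<rho>)"
    unfolding S_def using W \<phi> by (intro mtrace_dual_label_seqs) auto
  have pe: "?pe = (\<Sum>ls\<in>S. seq_prob p ls * Re (mtrace (?M ls * \<rho>)))"
  proof -
    define \<tau> where "\<tau> = (chanW n \<Lambda> p Win ^^ T) \<rho>"
    have [simp]: "dim_row \<tau> = n" "dim_col \<tau> = n" unfolding \<tau>_def by (induction T) simp_all
    have "(\<tau> *\<^sub>v \<phi>in) \<bullet>c \<phi>in = (\<Sum>i<n. \<Sum>k<n. \<tau> $$ (i, k) * \<phi>in $ k * cnj (\<phi>in $ i))"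
      using \<phi> by (simp add: cscalar_sum mult_vec_index sum_distrib_right del: index_mult_mat_vec)
    also have "\<dots> = (\<Sum>k<n. \<Sum>i<n. \<tau> $$ (i, k) * \<phi>in $ k * cnj (\<phi>in $ i))" by (rule sum.swap)
    also have "\<dots> = mtrace (outer \<phi>in * \<tau>)"
      using \<phi> by (simp add: mtrace_def mult_index mult_ac del: index_mult_mat(1))
    finally show ?thesis
      unfolding p_erase_def \<tau>_def[symmetric] sum_tr[folded \<tau>_def, symmetric] by simp
  qed
  have prob: "prob_outcome0 n T \<Lambda> p Win \<phi>in \<rho> = ?pe"
    unfolding prob_outcome0_def pe S_def[symmetric]
    using s0 mtrace_outcome0[OF psdD(3,4)[OF \<rho>] \<phi> len WS] by (intro sum.cong) auto
  have pe0: "0 \<le> ?pe"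
    unfolding prob[symmetric] prob_outcome0_def S_def[symmetric]
    using S psd_trace_nonneg[OF psd_state] by (intro sum_nonneg mult_nonneg_nonneg) auto
  define B where "B = U * \<rho> * mat_adjoint U"
  have B: "psd n B" using psd_conj[OF \<rho>, of U n] by (simp add: B_def conj_by_def)
  define M where "M = msum n S (\<lambda>ls. complex_of_real (seq_prob p ls) \<cdot>\<^sub>m ?M ls)"
  \<comment> \<open>M conjugated by \<open>U\<close> acts on the output side: N U = U M, so
    conjugating \<open>B\<close> by \<open>N\<close> amounts to conjugating \<rho> by U M, and tr (N
    B) = tr (M \<rho>).\<close>
  define N where "N = U * (M * mat_adjoint U)"
  have [simp]: "dim_row M = n" "dim_col M = n" "dim_row N = n" "dim_col N = n" by (auto simp: M_def N_def)
  have "mtrace (M * \<rho>) = mtrace (\<rho> * M)" by (rule mtrace_comm) auto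
  also have "\<dots> = (\<Sum>ls\<in>S. mtrace (\<rho> * (complex_of_real (seq_prob p ls) \<cdot>\<^sub>m ?M ls)))"
    unfolding M_def by (rule mtrace_mult_msum) (auto intro!: carrier_matI simp: dimM)
  also have "\<dots> = (\<Sum>ls\<in>S. seq_prob p ls * mtrace (?M ls * \<rho>))"
  proof (intro sum.cong refl)
    fix ls
    have "\<rho> * (complex_of_real (seq_prob p ls) \<cdot>\<^sub>m ?M ls) = complex_of_real (seq_prob p ls) \<cdot>\<^sub>m (\<rho> * ?M ls)"
      by (rule mult_smult_distrib[of _ n n _ n]) (auto intro!: carrier_matI simp: dimM)
    moreover have "mtrace (\<rho> * ?M ls) = mtrace (?M ls * \<rho>)"
      by (rule mtrace_comm) (auto simp: dimM)
    ultimately show "mtrace (\<rho> * (complex_of_real (seq_prob p ls) \<cdot>\<^sub>m ?M ls)) = seq_prob p ls * mtrace (?M ls * \<rho>)"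
      by (simp add: mtrace_smult dimM)
  qed
  finally have trM: "Re (mtrace (M * \<rho>)) = ?pe" unfolding pe by simp
  note UU = mult_left_eq[OF unitary_matD(5)[OF U]]
  have "mtrace (N * B) = mtrace (U * (M * \<rho> * mat_adjoint U))"
    by (simp add: N_def B_def UU)
  also have "\<dots> = mtrace (M * \<rho> * mat_adjoint U * U)"
    by (rule mtrace_comm) auto
  also have "\<dots> = mtrace (M * \<rho>)" by (simp add: unitary_matD(5)[OF U])
  finally have trN: "Re (mtrace (N * B)) = ?pe" using trM by simp
  have NB: "conj_by N B = conj_by (U * M) \<rho>"
    by (simp add: conj_by_def N_def B_def UU)
  have UM: "msum n S (\<lambda>ls. complex_of_real (seq_prob p ls) \<cdot>\<^sub>m (U * ?M ls)) = U * M"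
  proof (rule eq_matI)
    fix i j assume "i < dim_row (U * M)" "j < dim_col (U * M)"
    then have ij: "i < n" "j < n" by auto
    have "(U * M) $$ (i, j) = (\<Sum>k<n. \<Sum>ls\<in>S. U $$ (i, k) * (seq_prob p ls * ?M ls $$ (k, j)))"
      using ij by (simp add: mult_index M_def dimM sum_distrib_left del: index_mult_mat(1))
    also have "\<dots> = (\<Sum>ls\<in>S. \<Sum>k<n. U $$ (i, k) * (seq_prob p ls * ?M ls $$ (k, j)))" by (rule sum.swap)
    also have "\<dots> = msum n S (\<lambda>ls. complex_of_real (seq_prob p ls) \<cdot>\<^sub>m (U * ?M ls)) $$ (i, j)"
      using ij by (simp add: mult_index dimM sum_distrib_left mult_ac del: index_mult_mat(1))
    finally show "msum n S (\<lambda>ls. complex_of_real (seq_prob p ls) \<cdot>\<^sub>m (U * ?M ls)) $$ (i, j) = (U * M) $$ (i, j)" by simp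
  qed auto
  \<comment> \<open>Common to both bounds: \<sigma> is the output with the outcome ignored in the
    first, and the outcome 0 part in the second.\<close>
  have ge: "psd n (msum n S (\<lambda>ls. complex_of_real (seq_prob p ls) \<cdot>\<^sub>m \<sigma> ls) - conj_by N B)"
    if "\<And>ls. ls \<in> S \<Longrightarrow> psd n (\<sigma> ls)" "\<And>ls. ls \<in> S \<Longrightarrow> psd n (\<sigma> ls - conj_by (U * ?M ls) \<rho>)" for \<sigma>
    unfolding NB UM[symmetric]
    by (rule psd_msum_minus_conj_mean[OF S \<rho> that(2)]) (auto intro!: carrier_matI simp: dimM psdD(3,4)[OF that(1)])
  have st0: "psd n (?st ls (?s0 ls) - conj_by (U * ?M ls) \<rho>)" if "ls \<in> S" for ls
    unfolding s0[OF that] using len[OF that] WS[OF that] by (intro post_state0_branch_ge U \<rho> \<phi>)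
  have st: "psd n (?st ls (conj_by (meas_proj n T m) (state_ii n T Win \<phi>in ls \<rho>)))" if "ls \<in> S" for m ls
    by (rule psd_steps_iii_iv[OF U WS[OF that] psd_state])
  have st_add: "?st ls (?s0 ls + ?s1 ls) = ?st ls (?s0 ls) + ?st ls (?s1 ls)" if "ls \<in> S" for ls
    using psdD(1)[OF psd_state] by (intro steps_iii_iv_add[OF U WS[OF that]])
  have st01: "psd n (?st ls (?s0 ls + ?s1 ls))" if "ls \<in> S" for ls
    unfolding st_add[OF that] by (intro psd_add st that)
  have st01_ge: "psd n (?st ls (?s0 ls + ?s1 ls) - conj_by (U * ?M ls) \<rho>)" if "ls \<in> S" for ls
  proof -
    note d = psdD(3,4)[OF st[OF that]]
    \<comment> \<open>Outcome 1 adds a positive term to the slack already available from outcome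
      0.\<close>
    have "?st ls (?s0 ls + ?s1 ls) - conj_by (U * ?M ls) \<rho> = (?st ls (?s0 ls) - conj_by (U * ?M ls) \<rho>) + ?st ls (?s1 ls)"
      unfolding st_add[OF that] by (rule eq_matI) (auto simp: d)
    then show ?thesis using psd_add[OF st0[OF that] st[OF that]] by simp
  qed
  have "fidelity (E_U n T \<Lambda> p U Win \<phi>in \<rho>) B \<ge> ?pe"
  proof -
    define A where "A = msum n S (\<lambda>ls. complex_of_real (seq_prob p ls) \<cdot>\<^sub>m ?st ls (?s0 ls + ?s1 ls))"
    have "psd n A" unfolding A_def by (intro psd_msum psd_smult S st01)
    moreover have "psd n (A - conj_by N B)" unfolding A_def by (intro ge st01 st01_ge)
    ultimately show ?thesis
      using fidelity_ge[OF _ B, of A N] trN by (simp add: E_U_def A_def S_def carrier_matI)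
  qed
  moreover have "fidelity (post_state0 n T \<Lambda> p U Win \<phi>in \<rho>) B \<ge> sqrt ?pe"
  proof -
    define A where "A = msum n S (\<lambda>ls. complex_of_real (seq_prob p ls) \<cdot>\<^sub>m ?st ls (?s0 ls))"
    have A: "psd n A" unfolding A_def by (intro psd_msum psd_smult S st)
    have A_ge: "psd n (A - conj_by N B)" unfolding A_def by (intro ge st st0)
    note [simp] = psdD(1-4)[OF A] psdD(1-4)[OF B]
    \<comment> \<open>If \<open>?pe\<close> is 0, then c = 0 by the convention for division, as in
      \<open>post_state0\<close>. The normalised state is then the zero matrix, and
      \<open>sqrt c * ?pe = sqrt ?pe\<close> still holds with both sides 0.\<close>
    define c where "c = 1 / ?pe"
    \<comment> \<open>Conjugation is quadratic in \<open>N\<close>, so scaling the output by c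
      scales \<open>N\<close> by sqrt c only; this produces the square root in the second
      bound.\<close>
    let ?N = "complex_of_real (sqrt c) \<cdot>\<^sub>m N"
    have c0: "0 \<le> c" using pe0 by (simp add: c_def)
    have "conj_by ?N B = complex_of_real c \<cdot>\<^sub>m conj_by N B"
    proof (rule eq_matI)
      fix i j assume "i < dim_row (complex_of_real c \<cdot>\<^sub>m conj_by N B)" "j < dim_col (complex_of_real c \<cdot>\<^sub>m conj_by N B)"
      then have ij: "i < n" "j < n" by auto
      have "complex_of_real (sqrt c) * complex_of_real (sqrt c) = complex_of_real c"
        using c0 by (simp flip: of_real_mult)
      then show "conj_by ?N B $$ (i, j) = (complex_of_real c \<cdot>\<^sub>m conj_by N B) $$ (i, j)"
        using ij by (simp add: conj_by_index sum_distrib_left mult_ac) (simp flip: mult.assoc)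
    qed auto
    moreover have "complex_of_real c \<cdot>\<^sub>m A - complex_of_real c \<cdot>\<^sub>m conj_by N B = complex_of_real c \<cdot>\<^sub>m (A - conj_by N B)"
      by (rule eq_matI) (auto simp: right_diff_distrib)
    ultimately have "psd n (complex_of_real c \<cdot>\<^sub>m A - conj_by ?N B)"
      using psd_smult[OF A_ge c0] by simp
    then have "Re (mtrace (?N * B)) \<le> fidelity (complex_of_real c \<cdot>\<^sub>m A) B"
      by (intro fidelity_ge[OF psd_smult[OF A c0] B]) (auto intro!: carrier_matI)
    moreover have "?N * B = complex_of_real (sqrt c) \<cdot>\<^sub>m (N * B)"
      by (rule mult_smult_assoc_mat[of _ n n _ n]) (auto intro!: carrier_matI)
    then have "Re (mtrace (?N * B)) = sqrt c * ?pe"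
      by (simp add: mtrace_smult trN)
    moreover have "sqrt c * ?pe = sqrt ?pe"
      using pe0 by (simp add: c_def real_sqrt_divide real_div_sqrt)
    moreover have "post_state0 n T \<Lambda> p U Win \<phi>in \<rho> = complex_of_real c \<cdot>\<^sub>m A"
      by (simp add: post_state0_def prob c_def A_def S_def)
    ultimately show ?thesis by simp
  qed
  ultimately show "prob_outcome0 n T \<Lambda> p Win \<phi>in \<rho> = ?pe
      \<and> fidelity (E_U n T \<Lambda> p U Win \<phi>in \<rho>) (U * \<rho> * mat_adjoint U) \<ge> ?pe
      \<and> (pure_state n \<rho> \<longrightarrow> fidelity (post_state0 n T \<Lambda> p U Win \<phi>in \<rho>) (U * \<rho> * mat_adjoint U) \<ge> sqrt ?pe)"
    using prob unfolding B_def by blast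
qed

end
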